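(* There exist matrix-valued functions $P_0(\tau)$ (defined for $\tau\in[0,T]$), $P_1(s,\tau)$ (defined for $0\le s\le \tau\le T$) and $P_2(s,\nu,\tau)$ (defined for $0\le s,\nu\le\tau\le T$) with values in $\mathbb{R}^{d\times d}$, depending neither on the initial condition nor on the reference signal $y$, and, for every continuous reference signal $y\in C([0,T];\mathbb{R}^p)$, functions $d_1:[0,T]\to\mathbb{R}^d$, $d_2:\{(s,\tau):0\le s\le\tau\le T\}\to\mathbb{R}^d$ and $M:[0,T]\to\mathbb{R}$, depending on $y$ but not on the initial condition, such that the following hold. (1) (Regularity and symmetry) $P_0\in C^1([0,T])$; $P_1$, $\partial_\tau P_1$, $P_2$, $\partial_\tau P_2$, $d_2$, $\partial_\tau d_2$ are continuous on their domains; $d_1$ and $M$ are of class $C^1$ on $[0,T]$; $P_0(\tau)=P_0^*(\tau)$ and $P_2(s,\nu,\tau)=P_2^*(\nu,s,\tau)$. If $y=0$ then $d_1=0$, $d_2=0$ and $M=0$. (2) (Value function) For every $\tau\in[0,T)$ and every $\Xi_\tau=(\hat\xi,\tilde\xi)\in M^2_\tau$, $$W_\tau(\Xi_\tau)=\langle\hat\xi,P_0(\tau)\hat\xi\rangle+2\Big\langle\hat\xi,\int_0^\tau P_1(s,\tau)\tilde\xi(s)\,ds\Big\rangle+\int_0^\tau\!\!\int_0^\tau\langle\tilde\xi(s),P_2(s,\nu,\tau)\tilde\xi(\nu)\rangle\,d\nu\,ds+2\langle\hat\xi,d_1(\tau)\rangle+2\int_0^\tau\langle\tilde\xi(s),d_2(s,\tau)\rangle\,ds+M(\tau).$$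 (3) (Optimal control) For every $\tau\in[0,T)$ and every $\Xi_\tau=(\hat\xi,\tilde\xi)\in M^2_\tau$, $$u^+_\tau(\tau;\Xi_\tau)=-B^*\Big[P_0(\tau)\hat\xi+\int_0^\tau P_1(s,\tau)\tilde\xi(s)\,ds+d_1(\tau)\Big].$$ In particular, for the problem with initial time $0$ and initial condition $\hat\xi=w(0)$, for every $\tau\in[0,T)$ the optimal control is $$u^+_0(\tau;\hat\xi)=-B^*\Big[P_0(\tau)w(\tau)+\int_0^\tau P_1(s,\tau)w(s)\,ds+d_1(\tau)\Big],\qquad w=w^+_0(\cdot;\hat\xi).$$ (4) (Riccati equations) With a superimposed dot denoting the derivative with respect to $\tau$, $$\dot P_0(\tau)+A^*P_0(\tau)+P_0(\tau)A+P_1(\tau,\tau)+P_1^*(\tau,\tau)-P_0(\tau)BB^*P_0(\tau)+C^*C=0,$$ $$\dot P_1(s,\tau)+A^*P_1(s,\tau)+P_0(\tau)N(\tau-s)+P_2(\tau,s,\tau)-P_0(\tau)BB^*P_1(s,\tau)=0,$$ $$\dot P_2(s,\nu,\tau)+N^*(\tau-s)P_1(\nu,\tau)+P_1^*(s,\tau)N(\tau-\nu)-P_1^*(s,\tau)BB^*P_1(\nu,\tau)=0,$$ with $P_0(T)=0$, $P_1(s,T)=0$, $P_2(s,\nu,T)=0$ for all $s,\nu\in[0,T]$. (5) (Equations depending on $y$) $$\dot d_1(\tau)+(A^*-P_0(\tau)BB^* )d_1(\tau)+d_2(\tau,\tau)-C^*y(\tau)=0,\qquad d_1(T)=0,$$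 $$\dot d_2(s,\tau)+N^*(\tau-s)d_1(\tau)-P_1^*(s,\tau)BB^*d_1(\tau)=0,\qquad d_2(s,T)=0,$$ $$\dot M(\tau)=\|B^*d_1(\tau)\|^2-\|y(\tau)\|^2,\qquad M(T)=0.$$
   Context: Fix $T>0$, constant real matrices $A\in\mathbb{R}^{d\times d}$, $B\in\mathbb{R}^{d\times m}$, $C\in\mathbb{R}^{p\times d}$, and a continuous function $N:[0,T]\to\mathbb{R}^{d\times d}$ (the matrices need not commute). A star denotes transpose. For $\tau\in(0,T)$ let $M^2_\tau=\mathbb{R}^d\times L^2(0,\tau;\mathbb{R}^d)$ with elements $\Xi_\tau=(\hat\xi,\tilde\xi)$; for $\tau=0$ the initial condition is $\Xi_0=\hat\xi\in\mathbb{R}^d$ (i.e. $M^2_0=\mathbb{R}^d$, and integrals over $(0,0)$ vanish). For $\tau\in[0,T)$, $\Xi_\tau\in M^2_\tau$ and $u\in L^2(\tau,T;\mathbb{R}^m)$ let $w$ be the solution on $[\tau,T]$ of $$w'(t)=Aw(t)+\int_\tau^tN(t-s)w(s)\,ds+Bu(t)+\int_0^\tau N(t-s)\tilde\xi(s)\,ds,\qquad w(\tau)=\hat\xi.$$ Given a continuous reference signal $y:[0,T]\to\mathbb{R}^p$, put $J_\tau(\Xi_\tau;u)=\int_\tau^T\big[\|Cw(t)-y(t)\|^2+\|u(t)\|^2\big]\,dt$. For each $\Xi_\tau$ there is a unique minimizer in $L^2(\tau,T;\mathbb{R}^m)$, the optimal control, denoted $u^+_\tau(\cdot;\Xi_\tau)$;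 it has a continuous representative on $[\tau,T]$, which is the one used for pointwise values. The corresponding solution is denoted $w^+_\tau(\cdot;\Xi_\tau)$, and $W_\tau(\Xi_\tau)=\min_uJ_\tau(\Xi_\tau;u)$. Derivatives at boundary points of the domains are one-sided. *)

theory Defs
  imports "HOL-Analysis.Analysis"
begin

text \<open>Representatives of \<open>L\<^sup>2\<close> functions on \<open>S\<close>. For \<open>S = {0..0}\<close>, a null set, every function
  qualifies and all integrals vanish, so a pair \<open>(\<xi>h, \<xi>t)\<close> at initial time 0 carries
  no more information than \<open>\<xi>h\<close>, matching \<open>M\<^sup>2\<close> at 0 being just the Euclidean space.\<close>

definition L2_on :: "real set \<Rightarrow> (real \<Rightarrow> 'a::euclidean_space) set" where
  "L2_on S = {f. f \<in> borel_measurable (lebesgue_on S) \<and>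
                 integrable (lebesgue_on S) (\<lambda>t. (norm (f t))\<^sup>2)}"

text \<open>The control is only square integrable, so the integro-differential equation is understood
  in the sense of Caratheodory: \<open>w\<close> is continuous and is the indefinite integral, starting
  from \<open>w \<tau> = \<xi>h\<close>, of the right-hand side.\<close>

definition volterra_rhs ::
  "real^'d^'d \<Rightarrow> real^'m^'d \<Rightarrow> (real \<Rightarrow> real^'d^'d) \<Rightarrow> real \<Rightarrow> (real \<Rightarrow> real^'d)
    \<Rightarrow> (real \<Rightarrow> real^'m) \<Rightarrow> (real \<Rightarrow> real^'d) \<Rightarrow> real \<Rightarrow> real^'d" where
  "volterra_rhs A B N \<tau> \<xi>t u w t =
     A *v w t + integral {\<tau>..t} (\<lambda>s. N (t - s) *v w s) + B *v u t
     + integral {0..\<tau>} (\<lambda>s. N (t - s) *v \<xi>t s)"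

definition is_solution ::
  "real \<Rightarrow> real^'d^'d \<Rightarrow> real^'m^'d \<Rightarrow> (real \<Rightarrow> real^'d^'d) \<Rightarrow> real \<Rightarrow> real^'d \<Rightarrow> (real \<Rightarrow> real^'d)
    \<Rightarrow> (real \<Rightarrow> real^'m) \<Rightarrow> (real \<Rightarrow> real^'d) \<Rightarrow> bool" where
  "is_solution T A B N \<tau> \<xi>h \<xi>t u w \<longleftrightarrow>
     continuous_on {\<tau>..T} w \<and> w \<tau> = \<xi>h \<and>
     (\<forall>t\<in>{\<tau>..T}. (volterra_rhs A B N \<tau> \<xi>t u w has_integral (w t - w \<tau>)) {\<tau>..t})"

text \<open>The choice only affects values outside \<open>{\<tau>..T}\<close>, where solutions are unconstrained;
  the same holds for the optimal control below.\<close>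

definition sol ::
  "real \<Rightarrow> real^'d^'d \<Rightarrow> real^'m^'d \<Rightarrow> (real \<Rightarrow> real^'d^'d) \<Rightarrow> real \<Rightarrow> real^'d \<Rightarrow> (real \<Rightarrow> real^'d)
    \<Rightarrow> (real \<Rightarrow> real^'m) \<Rightarrow> real \<Rightarrow> real^'d" where
  "sol T A B N \<tau> \<xi>h \<xi>t u = (SOME w. is_solution T A B N \<tau> \<xi>h \<xi>t u w)"

definition cost ::
  "real \<Rightarrow> real^'d^'d \<Rightarrow> real^'m^'d \<Rightarrow> real^'d^'p \<Rightarrow> (real \<Rightarrow> real^'d^'d) \<Rightarrow> (real \<Rightarrow> real^'p)
    \<Rightarrow> real \<Rightarrow> real^'d \<Rightarrow> (real \<Rightarrow> real^'d) \<Rightarrow> (real \<Rightarrow> real^'m) \<Rightarrow> real" where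
  "cost T A B C N y \<tau> \<xi>h \<xi>t u =
     integral {\<tau>..T} (\<lambda>t. (norm (C *v sol T A B N \<tau> \<xi>h \<xi>t u t - y t))\<^sup>2 + (norm (u t))\<^sup>2)"

definition is_optimal_control ::
  "real \<Rightarrow> real^'d^'d \<Rightarrow> real^'m^'d \<Rightarrow> real^'d^'p \<Rightarrow> (real \<Rightarrow> real^'d^'d) \<Rightarrow> (real \<Rightarrow> real^'p)
    \<Rightarrow> real \<Rightarrow> real^'d \<Rightarrow> (real \<Rightarrow> real^'d) \<Rightarrow> (real \<Rightarrow> real^'m) \<Rightarrow> bool" where
  "is_optimal_control T A B C N y \<tau> \<xi>h \<xi>t u \<longleftrightarrow>
     u \<in> L2_on {\<tau>..T} \<and>
     (\<forall>v\<in>L2_on {\<tau>..T}. cost T A B C N y \<tau> \<xi>h \<xi>t u \<le> cost T A B C N y \<tau> \<xi>h \<xi>t v)"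

text \<open>The continuous representative of the minimizer.\<close>

definition opt_control ::
  "real \<Rightarrow> real^'d^'d \<Rightarrow> real^'m^'d \<Rightarrow> real^'d^'p \<Rightarrow> (real \<Rightarrow> real^'d^'d) \<Rightarrow> (real \<Rightarrow> real^'p)
    \<Rightarrow> real \<Rightarrow> real^'d \<Rightarrow> (real \<Rightarrow> real^'d) \<Rightarrow> real \<Rightarrow> real^'m" where
  "opt_control T A B C N y \<tau> \<xi>h \<xi>t =
     (SOME u. is_optimal_control T A B C N y \<tau> \<xi>h \<xi>t u \<and> continuous_on {\<tau>..T} u)"

definition opt_state ::
  "real \<Rightarrow> real^'d^'d \<Rightarrow> real^'m^'d \<Rightarrow> real^'d^'p \<Rightarrow> (real \<Rightarrow> real^'d^'d) \<Rightarrow> (real \<Rightarrow> real^'p)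
    \<Rightarrow> real \<Rightarrow> real^'d \<Rightarrow> (real \<Rightarrow> real^'d) \<Rightarrow> real \<Rightarrow> real^'d" where
  "opt_state T A B C N y \<tau> \<xi>h \<xi>t =
     sol T A B N \<tau> \<xi>h \<xi>t (opt_control T A B C N y \<tau> \<xi>h \<xi>t)"

text \<open>\<open>LEAST\<close> over the reals is the minimum, not the infimum.\<close>

definition value_fn ::
  "real \<Rightarrow> real^'d^'d \<Rightarrow> real^'m^'d \<Rightarrow> real^'d^'p \<Rightarrow> (real \<Rightarrow> real^'d^'d) \<Rightarrow> (real \<Rightarrow> real^'p)
    \<Rightarrow> real \<Rightarrow> real^'d \<Rightarrow> (real \<Rightarrow> real^'d) \<Rightarrow> real" where
  "value_fn T A B C N y \<tau> \<xi>h \<xi>t =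
     (LEAST r. r \<in> cost T A B C N y \<tau> \<xi>h \<xi>t ` L2_on {\<tau>..T})"

text \<open>Domains of \<open>P1\<close>, \<open>d2\<close> (pairs \<open>(s, \<tau>)\<close>) and of \<open>P2\<close> (triples \<open>(s, \<nu>, \<tau>)\<close>).\<close>

definition dom2 :: "real \<Rightarrow> (real \<times> real) set" where
  "dom2 T = {(s, \<tau>). 0 \<le> s \<and> s \<le> \<tau> \<and> \<tau> \<le> T}"

definition dom3 :: "real \<Rightarrow> (real \<times> real \<times> real) set" where
  "dom3 T = {(s, \<nu>, \<tau>). 0 \<le> s \<and> s \<le> \<tau> \<and> 0 \<le> \<nu> \<and> \<nu> \<le> \<tau> \<and> \<tau> \<le> T}"

definition C1_on :: "real set \<Rightarrow> (real \<Rightarrow> 'a::real_normed_vector) \<Rightarrow> (real \<Rightarrow> 'a) \<Rightarrow> bool" where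
  "C1_on S f f' \<longleftrightarrow>
     (\<forall>t\<in>S. (f has_vector_derivative f' t) (at t within S)) \<and> continuous_on S f'"

text \<open>\<open>C1_tau2 T f f'\<close>: \<open>f\<close> and its partial derivative \<open>f'\<close> in \<open>\<tau>\<close> are continuous on \<open>dom2 T\<close>.
  For fixed \<open>s\<close>, \<open>\<tau>\<close> ranges over \<open>{s..T}\<close>, so derivatives at the end points are one-sided.
  At \<open>s = T\<close> this interval is a single point and the derivative condition is void; there
  \<open>f'\<close> is determined by its continuity. Likewise for \<open>C1_tau3\<close>.\<close>

definition C1_tau2 ::
  "real \<Rightarrow> (real \<Rightarrow> real \<Rightarrow> 'a::real_normed_vector) \<Rightarrow> (real \<Rightarrow> real \<Rightarrow> 'a) \<Rightarrow> bool" where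
  "C1_tau2 T f f' \<longleftrightarrow>
     continuous_on (dom2 T) (\<lambda>(s, \<tau>). f s \<tau>) \<and>
     continuous_on (dom2 T) (\<lambda>(s, \<tau>). f' s \<tau>) \<and>
     (\<forall>(s, \<tau>)\<in>dom2 T. ((\<lambda>\<sigma>. f s \<sigma>) has_vector_derivative f' s \<tau>) (at \<tau> within {s..T}))"

definition C1_tau3 ::
  "real \<Rightarrow> (real \<Rightarrow> real \<Rightarrow> real \<Rightarrow> 'a::real_normed_vector) \<Rightarrow> (real \<Rightarrow> real \<Rightarrow> real \<Rightarrow> 'a) \<Rightarrow> bool" where
  "C1_tau3 T f f' \<longleftrightarrow>
     continuous_on (dom3 T) (\<lambda>(s, \<nu>, \<tau>). f s \<nu> \<tau>) \<and>
     continuous_on (dom3 T) (\<lambda>(s, \<nu>, \<tau>). f' s \<nu> \<tau>) \<and>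
     (\<forall>(s, \<nu>, \<tau>)\<in>dom3 T.
        ((\<lambda>\<sigma>. f s \<nu> \<sigma>) has_vector_derivative f' s \<nu> \<tau>) (at \<tau> within {max s \<nu>..T}))"

end

theory Submission
  imports Defs
begin

text \<open>The kernels are obtained from the Riccati equations themselves, not from the optimal control.
  Let the index \<open>-1\<close> stand for the current state and \<open>{0..T}\<close> for the past; then \<open>P0\<close>, \<open>P1\<close>,
  \<open>P2\<close> are the blocks of one symmetric kernel \<open>Q i j t\<close>, and the three Riccati equations are one
  quadratic equation for \<open>Q\<close>. With \<open>N\<close> extended continuously to the real line it makes sense on
  a square that does not shrink with \<open>\<tau>\<close>, and with a truncated quadratic term it has a global
  solution by a contraction argument. Completing the square shows that, as long as the truncation is
  inactive, \<open>Q\<close> is the kernel of a value function, which is nonnegative and bounded by the cost of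
  the zero control. Applied to histories that are sums of two atoms this bounds \<open>Q\<close> pointwise,
  so the truncation never becomes active. Completing the square along the closed loop gives
  the value, and its first-order condition gives the optimality among all square integrable controls.\<close>

text \<open>The Riccati equation is not a separate ODE for each pair of indices: the current value
  turns into history at time t, so the derivative of the kernel at (i, j) contains its values on the
  moving lines i = t and j = t, which lie on the boundary of the original domains. Sup bounds over
  all indices at a fixed time absorb this nonlocality once the indices form a fixed compact set.
  Indices above \<tau> are no histories of the original problem; there, mass b at an index s only
  adds a forcing term N(t - s) b, so the value function and its bounds keep a meaning. Only the
  factors of the quadratic term are truncated, the rest being affine in the kernel. Two atoms
  suffice for pointwise bounds because the form lies between 0 and a multiple of the squared total
  mass, and polarization then controls every matrix entry. The square is completed only for
  continuous controls, where the state is differentiable at every time. For a square integrable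
  control it need not be, so there the cost is expanded exactly around the closed loop, and
  integration by parts removes the cross term.\<close>

declare transpose_matrix_vector [simp del]

subsection \<open>Weighted contractions and parameter integrals\<close>

text \<open>On the compact set the weighted distance of \<open>Z\<close> and \<open>Y\<close>
  attains its maximum \<open>f z\<close>. One application of \<open>\<Phi>\<close> halves it up to
  the defect of \<open>Y\<close>, so \<open>f z \<le> f z / 2 + M0\<close>. With
  \<open>M0 = 0\<close> this is uniqueness of the fixed point, with \<open>Y = 0\<close> an a priori
  bound.\<close>

lemma weighted_contraction_stability:
  fixes \<Phi> :: "('a::metric_space \<Rightarrow> 'b::real_normed_vector) \<Rightarrow> 'a \<Rightarrow> 'b" and \<omega> :: "'a \<Rightarrow> real"
  assumes K: "compact K" and \<omega>: "continuous_on K \<omega>" "\<And>x. x \<in> K \<Longrightarrow> 0 < \<omega> x"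
    and contr: "\<And>Z Z' M. \<lbrakk>continuous_on K Z; continuous_on K Z'; 0 \<le> M;
        \<And>x. x \<in> K \<Longrightarrow> norm (Z x - Z' x) \<le> M * \<omega> x\<rbrakk>
        \<Longrightarrow> \<forall>x\<in>K. norm (\<Phi> Z x - \<Phi> Z' x) \<le> M / 2 * \<omega> x"
    and Z: "continuous_on K Z" "\<And>x. x \<in> K \<Longrightarrow> \<Phi> Z x = Z x"
    and Y: "continuous_on K Y" "\<And>x. x \<in> K \<Longrightarrow> norm (\<Phi> Y x - Y x) \<le> M0 * \<omega> x"
    and x: "x \<in> K"
  shows "norm (Z x - Y x) \<le> 2 * M0 * \<omega> x"
proof -
  define f where "f x = norm (Z x - Y x) / \<omega> x" for x
  have "continuous_on K f"
    unfolding f_def using \<omega> by (intro continuous_intros Z Y) force+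
  then obtain z where z: "z \<in> K" "\<And>x. x \<in> K \<Longrightarrow> f x \<le> f z"
    using continuous_attains_sup[OF K] x by blast
  have fz: "0 \<le> f z" using \<omega>(2)[OF z(1)] by (simp add: f_def)
  have le: "norm (Z x - Y x) \<le> f z * \<omega> x" if "x \<in> K" for x
    using z(2)[OF that] \<omega>(2)[OF that] by (simp add: f_def pos_divide_le_eq)
  have "norm (\<Phi> Z z - \<Phi> Y z) \<le> f z / 2 * \<omega> z"
    using contr[OF Z(1) Y(1) fz le] z(1) by blast
  moreover have "norm (Z z - Y z) \<le> norm (\<Phi> Z z - \<Phi> Y z) + norm (\<Phi> Y z - Y z)"
    using Z(2)[OF z(1)] norm_triangle_ineq[of "\<Phi> Z z - \<Phi> Y z" "\<Phi> Y z - Y z"] by simp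
  ultimately have "norm (Z z - Y z) \<le> (f z / 2 + M0) * \<omega> z"
    using Y(2)[OF z(1)] by (simp add: algebra_simps)
  then have "f z \<le> f z / 2 + M0"
    using \<omega>(2)[OF z(1)] by (simp add: f_def pos_divide_le_eq)
  then have "f z \<le> 2 * M0" by simp
  then have "f z * \<omega> x \<le> 2 * M0 * \<omega> x"
    using \<omega>(2)[OF x] by (intro mult_right_mono) auto
  then show ?thesis using le[OF x] by linarith
qed

text \<open>Banach's iteration from 0, carried out on plain functions observed on \<open>K\<close>.
  Relative to the weight the increments decay like \<open>1 / 2 ^ n\<close>, and the weight is
  bounded on \<open>K\<close>, so the telescoping series converges uniformly.\<close>

lemma weighted_contraction_fixpoint:
  fixes \<Phi> :: "('a::metric_space \<Rightarrow> 'b::banach) \<Rightarrow> 'a \<Rightarrow> 'b" and \<omega> :: "'a \<Rightarrow> real"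
  assumes K: "compact K" and \<omega>: "continuous_on K \<omega>" "\<And>x. x \<in> K \<Longrightarrow> 0 < \<omega> x"
    and cont: "\<And>Z. continuous_on K Z \<Longrightarrow> continuous_on K (\<Phi> Z)"
    and contr: "\<And>Z Z' M. \<lbrakk>continuous_on K Z; continuous_on K Z'; 0 \<le> M;
        \<And>x. x \<in> K \<Longrightarrow> norm (Z x - Z' x) \<le> M * \<omega> x\<rbrakk>
        \<Longrightarrow> \<forall>x\<in>K. norm (\<Phi> Z x - \<Phi> Z' x) \<le> M / 2 * \<omega> x"
  obtains Z where "continuous_on K Z" "\<And>x. x \<in> K \<Longrightarrow> \<Phi> Z x = Z x"
proof (cases "K = {}")
  case False
  define z where "z n = (\<Phi> ^^ n) (\<lambda>_. 0)" for n
  have z_cont: "continuous_on K (z n)" for n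
    by (induction n) (auto simp: z_def intro: cont)
  have "continuous_on K (\<lambda>x. norm (\<Phi> (\<lambda>_. 0) x) / \<omega> x)"
    using \<omega> by (intro continuous_intros cont) force+
  then obtain a where a: "a \<in> K" "\<And>x. x \<in> K \<Longrightarrow> norm (\<Phi> (\<lambda>_. 0) x) / \<omega> x \<le> norm (\<Phi> (\<lambda>_. 0) a) / \<omega> a"
    using continuous_attains_sup[OF K False] by blast
  define D where "D = norm (\<Phi> (\<lambda>_. 0) a) / \<omega> a"
  have D: "0 \<le> D" using \<omega>(2)[OF a(1)] by (simp add: D_def)
  have step: "\<forall>x\<in>K. norm (z (Suc n) x - z n x) \<le> D / 2 ^ n * \<omega> x" for n
  proof (induction n)
    case 0
    show ?case using a(2) \<omega>(2) by (simp add: z_def D_def pos_divide_le_eq)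
  next
    case (Suc n)
    have "\<forall>x\<in>K. norm (\<Phi> (z (Suc n)) x - \<Phi> (z n) x) \<le> D / 2 ^ n / 2 * \<omega> x"
      using Suc D by (intro contr z_cont) auto
    then show ?case by (simp add: z_def field_simps)
  qed
  obtain b where b: "b \<in> K" "\<And>x. x \<in> K \<Longrightarrow> \<omega> x \<le> \<omega> b"
    using continuous_attains_sup[OF K False \<omega>(1)] by blast
  obtain c where c: "c \<in> K" "\<And>x. x \<in> K \<Longrightarrow> \<omega> c \<le> \<omega> x"
    using continuous_attains_inf[OF K False \<omega>(1)] by blast
  define L where "L x = (\<Sum>i. z (Suc i) x - z i x)" for x
  have z0: "z 0 = (\<lambda>_. 0)" by (simp add: z_def)
  have tele: "(\<Sum>i<n. z (Suc i) x - z i x) = z n x" for n x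
    using sum_lessThan_telescope[of "\<lambda>i. z i x" n] z0 by simp
  have "uniform_limit K (\<lambda>n x. \<Sum>i<n. z (Suc i) x - z i x) L sequentially"
    unfolding L_def
  proof (rule Weierstrass_m_test)
    show "norm (z (Suc n) x - z n x) \<le> D * \<omega> b * (1/2) ^ n" if "x \<in> K" for n x
    proof -
      have "D / 2 ^ n * \<omega> x \<le> D / 2 ^ n * \<omega> b"
        using D b that by (intro mult_left_mono) auto
      then show ?thesis using bspec[OF step[of n] that] by (simp add: field_simps)
    qed
    show "summable (\<lambda>n. D * \<omega> b * (1/2) ^ n)"
      by (intro summable_mult summable_geometric) auto
  qed
  then have ul: "uniform_limit K z L sequentially"
    by (simp add: tele)
  have Lc: "continuous_on K L"
    by (rule uniform_limit_theorem[OF _ ul]) (auto intro!: always_eventually z_cont)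
  have "\<Phi> L x = L x" if x: "x \<in> K" for x
  proof -
    have "norm (\<Phi> L x - L x) \<le> 0 + e" if e: "e > 0" for e
    proof -
      \<comment> \<open>The minimum \<open>\<omega> c\<close> of the weight turns uniform closeness
        of the iterates into weighted closeness. The total error is
        \<open>3/2 * e' * \<omega> x\<close>, which this choice keeps below
        \<open>e\<close>.\<close>
      define e' where "e' = e / (2 * \<omega> x)"
      have e': "e' > 0" using e \<omega>(2)[OF x] by (simp add: e'_def)
      then have "e' * \<omega> c > 0" using \<omega>(2)[OF c(1)] by simp
      from uniform_limitD[OF ul this] obtain n where
        n: "\<And>m y. m \<ge> n \<Longrightarrow> y \<in> K \<Longrightarrow> dist (z m y) (L y) < e' * \<omega> c"
        unfolding eventually_sequentially by blast
      have n': "norm (L y - z m y) \<le> e' * \<omega> y" if "m \<ge> n" "y \<in> K" for m y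
      proof -
        have "e' * \<omega> c \<le> e' * \<omega> y" using e' c(2)[OF that(2)] by simp
        then show ?thesis using n[OF that] by (simp add: dist_norm norm_minus_commute)
      qed
      have "norm (\<Phi> L x - \<Phi> (z n) x) \<le> e' / 2 * \<omega> x"
        using contr[OF Lc z_cont[of n], of e'] n'[of n] e' x by simp
      moreover have "\<Phi> (z n) x = z (Suc n) x" by (simp add: z_def)
      moreover have "norm (z (Suc n) x - L x) \<le> e' * \<omega> x"
        using n'[of "Suc n" x] x by (simp add: norm_minus_commute)
      ultimately have "norm (\<Phi> L x - L x) \<le> e' / 2 * \<omega> x + e' * \<omega> x"
        using norm_triangle_ineq[of "\<Phi> L x - \<Phi> (z n) x" "\<Phi> (z n) x - L x"] by simp
      also have "\<dots> \<le> 2 * e' * \<omega> x" using e' \<omega>(2)[OF x] by (simp add: mult_less_0_iff)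
      finally show ?thesis using \<omega>(2)[OF x] by (simp add: e'_def)
    qed
    then have "norm (\<Phi> L x - L x) \<le> 0" by (rule field_le_epsilon)
    then show ?thesis by simp
  qed
  then show thesis using that Lc by blast
qed (use that in auto)

text \<open>The gain \<open>1 / l\<close> makes an integral operator with any Lipschitz constant a
  contraction for an exponential weight of large rate. The mirrored version below serves equations
  with a terminal value.\<close>

lemma norm_integral_exp_le:
  fixes f :: "real \<Rightarrow> 'b::euclidean_space"
  assumes "a \<le> t" "0 < l" "f integrable_on {a..t}" "0 \<le> c"
    and le: "\<And>s. s \<in> {a..t} \<Longrightarrow> norm (f s) \<le> c * exp (l * s)"
  shows "norm (integral {a..t} f) \<le> c / l * exp (l * t)"
proof -
  have "((\<lambda>s. c * exp (l * s)) has_integral (c / l * exp (l * t) - c / l * exp (l * a))) {a..t}"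
    using assms(1,2) by (intro fundamental_theorem_of_calculus)
      (auto intro!: derivative_eq_intros simp: has_real_derivative_iff_has_vector_derivative[symmetric])
  note I = this
  have "norm (integral {a..t} f) \<le> integral {a..t} (\<lambda>s. c * exp (l * s))"
    using assms(3) le I by (intro integral_norm_bound_integral) auto
  also have "\<dots> = c / l * exp (l * t) - c / l * exp (l * a)"
    using I by (rule integral_unique)
  also have "\<dots> \<le> c / l * exp (l * t)" using assms by simp
  finally show ?thesis .
qed

lemma norm_integral_exp_le':
  fixes f :: "real \<Rightarrow> 'b::euclidean_space"
  assumes "t \<le> b" "0 < l" "f integrable_on {t..b}" "0 \<le> c"
    and le: "\<And>s. s \<in> {t..b} \<Longrightarrow> norm (f s) \<le> c * exp (l * (b - s))"
  shows "norm (integral {t..b} f) \<le> c / l * exp (l * (b - t))"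
proof -
  have "((\<lambda>s. c * exp (l * (b - s))) has_integral (- c / l * exp (l * (b - b)) - (- c / l * exp (l * (b - t))))) {t..b}"
    using assms(1,2) by (intro fundamental_theorem_of_calculus)
      (auto intro!: derivative_eq_intros simp: has_real_derivative_iff_has_vector_derivative[symmetric])
  note I = this
  have "norm (integral {t..b} f) \<le> integral {t..b} (\<lambda>s. c * exp (l * (b - s)))"
    using assms(3) le I by (intro integral_norm_bound_integral) auto
  also have "\<dots> = - c / l * exp (l * (b - b)) - (- c / l * exp (l * (b - t)))"
    using I by (rule integral_unique)
  also have "\<dots> \<le> c / l * exp (l * (b - t))" using assms by simp
  finally show ?thesis .
qed

lemma continuous_on_section2:
  assumes "continuous_on (U \<times> V) (\<lambda>(x, t). f x t)" "x \<in> U"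
  shows "continuous_on V (f x)"
proof -
  have "continuous_on V (\<lambda>t. (\<lambda>(x, t). f x t) (x, t))"
    using assms by (intro continuous_on_compose2[OF assms(1)] continuous_intros) auto
  then show ?thesis by simp
qed

lemma continuous_on_section1:
  assumes "continuous_on (U \<times> V) (\<lambda>(x, t). f x t)" "t \<in> V"
  shows "continuous_on U (\<lambda>x. f x t)"
proof -
  have "continuous_on U (\<lambda>x. (\<lambda>(x, t). f x t) (x, t))"
    using assms by (intro continuous_on_compose2[OF assms(1)] continuous_intros) auto
  then show ?thesis by simp
qed

text \<open>Replacing \<open>s\<close> by \<open>min s t\<close> in the integrand removes the moving end point.\<close>

lemma continuous_on_integral_upper:
  fixes f :: "'a::topological_space \<Rightarrow> real \<Rightarrow> 'b::euclidean_space"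
  assumes "continuous_on (U \<times> {a..b}) (\<lambda>(x, t). f x t)"
  shows "continuous_on (U \<times> {a..b}) (\<lambda>(x, t). integral {a..t} (f x))"
proof -
  have fc: "continuous_on {a..b} (f x)" if "x \<in> U" for x
    using assms that by (rule continuous_on_section2)
  have 1: "integral {a..t} (f x) = integral (cbox a b) (\<lambda>s. f x (min s t)) - (b - t) *\<^sub>R f x t"
    if x: "x \<in> U" and t: "t \<in> {a..b}" for x t
  proof -
    have c: "continuous_on {a..b} (\<lambda>s. f x (min s t))"
      using t by (intro continuous_on_compose2[OF fc[OF x]] continuous_intros) auto
    have "integral {a..b} (\<lambda>s. f x (min s t))
        = integral {a..t} (\<lambda>s. f x (min s t)) + integral {t..b} (\<lambda>s. f x (min s t))"
      using t c by (intro Henstock_Kurzweil_Integration.integral_combine[symmetric] integrable_continuous_real) auto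
    also have "integral {a..t} (\<lambda>s. f x (min s t)) = integral {a..t} (f x)"
      by (intro integral_cong) (auto simp: min_def)
    also have "integral {t..b} (\<lambda>s. f x (min s t)) = integral {t..b} (\<lambda>s. f x t)"
      by (intro integral_cong) (auto simp: min_def intro: antisym)
    finally show ?thesis using t by simp
  qed
  have "continuous_on ((U \<times> {a..b}) \<times> cbox a b)
      (\<lambda>q. (\<lambda>(x, t). f x t) (fst (fst q), min (snd q) (snd (fst q))))"
    by (rule continuous_on_compose2[OF assms]) (auto intro!: continuous_intros)
  then have "continuous_on (U \<times> {a..b}) (\<lambda>p. integral (cbox a b) (\<lambda>s. f (fst p) (min s (snd p))))"
    by (intro integral_continuous_on_param) (simp add: case_prod_unfold)
  moreover have "continuous_on (U \<times> {a..b}) (\<lambda>p. f (fst p) (snd p))"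
    using assms by (simp add: case_prod_unfold)
  ultimately have "continuous_on (U \<times> {a..b}) (\<lambda>p. integral (cbox a b) (\<lambda>s. f (fst p) (min s (snd p)))
      - (b - snd p) *\<^sub>R f (fst p) (snd p))"
    by (intro continuous_intros)
  then show ?thesis
    by (rule continuous_on_eq) (auto simp: 1 simp del: box_real)
qed

lemma continuous_on_integral_lower:
  fixes f :: "'a::topological_space \<Rightarrow> real \<Rightarrow> 'b::euclidean_space"
  assumes "continuous_on (U \<times> {a..b}) (\<lambda>(x, t). f x t)"
  shows "continuous_on (U \<times> {a..b}) (\<lambda>(x, t). integral {t..b} (f x))"
proof -
  have fc: "continuous_on {a..b} (f x)" if "x \<in> U" for x
    using assms that by (rule continuous_on_section2)
  have 1: "integral {t..b} (f x) = integral (cbox a b) (f x) - integral {a..t} (f x)"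
    if x: "x \<in> U" and t: "t \<in> {a..b}" for x t
    using Henstock_Kurzweil_Integration.integral_combine[of a t b "f x"] t fc[OF x]
    by (simp add: integrable_continuous_real algebra_simps)
  have "continuous_on U (\<lambda>x. integral (cbox a b) (f x))"
    by (rule integral_continuous_on_param) (use assms in simp)
  then have "continuous_on (U \<times> {a..b}) (\<lambda>p. integral (cbox a b) (f (fst p)))"
    by (rule continuous_on_compose2) (auto intro!: continuous_intros)
  from continuous_on_diff[OF this continuous_on_integral_upper[OF assms, unfolded case_prod_unfold]]
  show ?thesis by (rule continuous_on_eq) (clarify, simp only: 1 prod.case fst_conv snd_conv)
qed

lemma integral_lower_has_vector_derivative:
  fixes f :: "real \<Rightarrow> 'b::euclidean_space"
  assumes "continuous_on {a..b} f" "t \<in> {a..b}"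
  shows "((\<lambda>t. integral {t..b} f) has_vector_derivative - f t) (at t within {a..b})"
proof -
  have 1: "integral {t..b} f = integral {a..b} f - integral {a..t} f" if "t \<in> {a..b}" for t
    using Henstock_Kurzweil_Integration.integral_combine[of a t b f] that assms(1)
    by (simp add: integrable_continuous_real algebra_simps)
  have "((\<lambda>t. integral {a..b} f - integral {a..t} f) has_vector_derivative 0 - f t) (at t within {a..b})"
    by (intro derivative_intros integral_has_vector_derivative assms)
  from has_vector_derivative_transform[OF assms(2) 1 this] show ?thesis by simp
qed

subsection \<open>Bilinear pairings with integrable weights\<close>

lemma bounded_bilinear_matrix_vector:
  "bounded_bilinear ((*v) :: real^'n^'m \<Rightarrow> real^'n \<Rightarrow> real^'m)"
  unfolding bilinear_conv_bounded_bilinear[symmetric] bilinear_def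
  by (auto intro!: linearI simp: matrix_vector_right_distrib matrix_vector_mult_add_rdistrib
      scaleR_matrix_vector_assoc[symmetric] matrix_vector_mult_scaleR)

lemma bounded_bilinear_matrix_matrix:
  "bounded_bilinear ((**) :: real^'n^'m \<Rightarrow> real^'k^'n \<Rightarrow> real^'k^'m)"
  unfolding bilinear_conv_bounded_bilinear[symmetric] bilinear_def
  by (auto intro!: linearI simp: matrix_add_ldistrib matrix_matrix_mult_def vec_eq_iff
      sum.distrib sum_distrib_left algebra_simps)

lemma bounded_linear_transpose: "bounded_linear (transpose :: real^'n^'m \<Rightarrow> real^'m^'n)"
  unfolding linear_conv_bounded_linear[symmetric]
  by (rule linearI) (auto simp: transpose_def vec_eq_iff)

lemmas mat_cont [continuous_intros] =
  bounded_bilinear.continuous_on[OF bounded_bilinear_matrix_vector]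
  bounded_bilinear.continuous_on[OF bounded_bilinear_matrix_matrix]
  bounded_linear.continuous_on[OF bounded_linear_transpose]

lemma absolutely_integrable_bilinear_continuous:
  fixes pr :: "'a::euclidean_space \<Rightarrow> 'b::euclidean_space \<Rightarrow> 'c::euclidean_space" and a b :: real
  assumes pr: "bounded_bilinear pr" and f: "continuous_on {a..b} f" and g: "g absolutely_integrable_on {a..b}"
  shows "(\<lambda>s. pr (f s) (g s)) absolutely_integrable_on {a..b}"
proof (rule absolutely_integrable_bounded_measurable_product[where h = pr and f = f and g = g])
  show "bilinear pr" using pr by (simp add: bilinear_conv_bounded_bilinear)
  show "f \<in> borel_measurable (lebesgue_on {a..b})"
    by (intro continuous_imp_measurable_on_sets_lebesgue f) auto
  show "bounded (f ` {a..b})"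
    by (intro compact_imp_bounded compact_continuous_image f) auto
qed (use g in auto)

lemma norm_bilinear_integral_le:
  fixes pr :: "'a::euclidean_space \<Rightarrow> 'b::euclidean_space \<Rightarrow> 'c::euclidean_space" and a b :: real
  assumes pr: "bounded_bilinear pr" and K: "\<And>x y. norm (pr x y) \<le> norm x * norm y * K" "0 \<le> K"
    and f: "continuous_on {a..b} f" "\<And>s. s \<in> {a..b} \<Longrightarrow> norm (f s) \<le> e"
    and g: "g absolutely_integrable_on {a..b}"
  shows "norm (integral {a..b} (\<lambda>s. pr (f s) (g s))) \<le> e * K * integral {a..b} (\<lambda>s. norm (g s))"
proof -
  have "norm (integral {a..b} (\<lambda>s. pr (f s) (g s))) \<le> integral {a..b} (\<lambda>s. e * K * norm (g s))"
  proof (rule integral_norm_bound_integral)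
    show "(\<lambda>s. pr (f s) (g s)) integrable_on {a..b}"
      using absolutely_integrable_bilinear_continuous[OF pr f(1) g] by (rule set_lebesgue_integral_eq_integral)
    show "(\<lambda>s. e * K * norm (g s)) integrable_on {a..b}"
      using g by (intro integrable_on_mult_right) (auto simp: absolutely_integrable_on_def)
    show "norm (pr (f s) (g s)) \<le> e * K * norm (g s)" if "s \<in> {a..b}" for s
    proof -
      have "norm (f s) * (norm (g s) * K) \<le> e * (norm (g s) * K)"
        using f(2)[OF that] K(2) by (intro mult_right_mono) auto
      then show ?thesis using K(1)[of "f s" "g s"] by (simp add: mult_ac)
    qed
  qed
  then show ?thesis by simp
qed

lemma uniformly_close_in_parameter:
  fixes F :: "real \<Rightarrow> real \<Rightarrow> 'a::real_normed_vector"
  assumes "compact S" "compact U" "continuous_on (S \<times> U) (\<lambda>(s, t). F s t)" "t \<in> U" "0 < e"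
  obtains d where "0 < d" "\<And>s t'. s \<in> S \<Longrightarrow> t' \<in> U \<Longrightarrow> \<bar>t' - t\<bar> < d \<Longrightarrow> norm (F s t' - F s t) < e"
proof -
  have "uniformly_continuous_on (S \<times> U) (\<lambda>(s, t). F s t)"
    using assms by (intro compact_uniformly_continuous compact_Times)
  then obtain d where d: "0 < d" "\<And>x x'. x \<in> S \<times> U \<Longrightarrow> x' \<in> S \<times> U \<Longrightarrow> dist x' x < d \<Longrightarrow>
      dist ((\<lambda>(s, t). F s t) x') ((\<lambda>(s, t). F s t) x) < e"
    using assms(5) unfolding uniformly_continuous_on_def by metis
  show thesis
  proof (rule that[OF d(1)])
    show "norm (F s t' - F s t) < e" if "s \<in> S" "t' \<in> U" "\<bar>t' - t\<bar> < d" for s t'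
      using d(2)[of "(s, t)" "(s, t')"] that assms(4) by (simp add: dist_Pair_Pair dist_norm)
  qed
qed

text \<open>The weight \<open>g\<close> is only integrable. By compactness \<open>F s t'\<close> is
  close to \<open>F s t\<close> uniformly in \<open>s\<close>, and this uniform error is multiplied
  by the integral of the norm of \<open>g\<close>.\<close>

lemma weighted_integral_continuous:
  fixes pr :: "'a::euclidean_space \<Rightarrow> 'b::euclidean_space \<Rightarrow> 'c::euclidean_space" and U :: "real set" and a b :: real
  assumes pr: "bounded_bilinear pr" and U: "compact U"
    and F: "continuous_on ({a..b} \<times> U) (\<lambda>(s, t). F s t)" and g: "g absolutely_integrable_on {a..b}"
  shows "continuous_on U (\<lambda>t. integral {a..b} (\<lambda>s. pr (F s t) (g s)))"
  unfolding continuous_on_iff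
proof (intro ballI allI impI)
  fix t and e :: real assume t: "t \<in> U" and e: "0 < e"
  obtain K where K: "K \<ge> 0" "\<And>x y. norm (pr x y) \<le> norm x * norm y * K"
    using bounded_bilinear.nonneg_bounded[OF pr] by blast
  define I where "I = integral {a..b} (\<lambda>s. norm (g s))"
  have I: "I \<ge> 0" unfolding I_def by (rule integral_nonneg) (use g in \<open>auto simp: absolutely_integrable_on_def\<close>)
  have Fc: "continuous_on {a..b} (\<lambda>s. F s t)" if "t \<in> U" for t
    using F that by (rule continuous_on_section1)
  \<comment> \<open>The summand 1 keeps the denominator positive when \<open>K * I = 0\<close> and
    makes the final estimate strict.\<close>
  define e' where "e' = e / (K * I + 1)"
  have KI: "K * I + 1 > 0" using K(1) I by (simp add: add_nonneg_pos)
  have e': "e' > 0" using e KI by (simp add: e'_def)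
  obtain d where d: "0 < d" "\<And>s t'. s \<in> {a..b} \<Longrightarrow> t' \<in> U \<Longrightarrow> \<bar>t' - t\<bar> < d \<Longrightarrow> norm (F s t' - F s t) < e'"
    using uniformly_close_in_parameter[OF _ U F t e'] by auto
  show "\<exists>d>0. \<forall>t'\<in>U. dist t' t < d \<longrightarrow> dist (integral {a..b} (\<lambda>s. pr (F s t') (g s))) (integral {a..b} (\<lambda>s. pr (F s t) (g s))) < e"
  proof (intro exI conjI ballI impI)
    fix t' assume t': "t' \<in> U" "dist t' t < d"
    have int: "(\<lambda>s. pr (F s t) (g s)) integrable_on {a..b}" if "t \<in> U" for t
      using absolutely_integrable_bilinear_continuous[OF pr Fc[OF that] g] by (rule set_lebesgue_integral_eq_integral)
    have "integral {a..b} (\<lambda>s. pr (F s t') (g s)) - integral {a..b} (\<lambda>s. pr (F s t) (g s))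
       = integral {a..b} (\<lambda>s. pr (F s t' - F s t) (g s))"
      using int t t' by (simp add: bounded_bilinear.diff_left[OF pr] Henstock_Kurzweil_Integration.integral_diff)
    also have "norm \<dots> \<le> e' * K * I"
      unfolding I_def using d(2)[OF _ t'(1)] t'(2)
      by (intro norm_bilinear_integral_le[OF pr K(2,1)] continuous_intros Fc t t'(1) g)
         (auto simp: dist_real_def intro!: less_imp_le)
    also have "\<dots> = e * (K * I) / (K * I + 1)" by (simp add: e'_def)
    also have "\<dots> < e" using KI e by (simp add: pos_divide_less_eq algebra_simps)
    finally show "dist (integral {a..b} (\<lambda>s. pr (F s t') (g s))) (integral {a..b} (\<lambda>s. pr (F s t) (g s))) < e"
      by (simp add: dist_norm)
  qed (rule d)
qed

text \<open>The first-order remainder of \<open>F s\<close> is at most a small multiple of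
  \<open>\<bar>t' - t\<bar>\<close>, uniformly in \<open>s\<close>: this is the mean value
  inequality on the segment between \<open>t\<close> and \<open>t'\<close>, with uniform continuity
  of \<open>F'\<close>. Such a bound survives integration against the weight.\<close>

lemma weighted_integral_has_vector_derivative:
  fixes pr :: "'a::euclidean_space \<Rightarrow> 'b::euclidean_space \<Rightarrow> 'c::euclidean_space" and a b :: real
  assumes pr: "bounded_bilinear pr"
    and F: "continuous_on ({a..b} \<times> {c..d}) (\<lambda>(s, t). F s t)"
    and F': "continuous_on ({a..b} \<times> {c..d}) (\<lambda>(s, t). F' s t)"
    and deriv: "\<And>s t. s \<in> {a..b} \<Longrightarrow> t \<in> {c..d} \<Longrightarrow> (F s has_vector_derivative F' s t) (at t within {c..d})"
    and g: "g absolutely_integrable_on {a..b}" and t: "t \<in> {c..d}"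
  shows "((\<lambda>t. integral {a..b} (\<lambda>s. pr (F s t) (g s))) has_vector_derivative
     integral {a..b} (\<lambda>s. pr (F' s t) (g s))) (at t within {c..d})"
  unfolding has_vector_derivative_def has_derivative_within_alt
proof (intro conjI allI impI)
  show "bounded_linear (\<lambda>x. x *\<^sub>R integral {a..b} (\<lambda>s. pr (F' s t) (g s)))"
    by (rule bounded_linear_scaleR_left)
  fix e :: real assume e: "0 < e"
  obtain K where K: "K \<ge> 0" "\<And>x y. norm (pr x y) \<le> norm x * norm y * K"
    using bounded_bilinear.nonneg_bounded[OF pr] by blast
  define I where "I = integral {a..b} (\<lambda>s. norm (g s))"
  have I: "I \<ge> 0" unfolding I_def by (rule integral_nonneg) (use g in \<open>auto simp: absolutely_integrable_on_def\<close>)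
  have Fc: "continuous_on {a..b} (\<lambda>s. F s t)" if "t \<in> {c..d}" for t
    using F that by (rule continuous_on_section1)
  have Fc': "continuous_on {a..b} (\<lambda>s. F' s t)" if "t \<in> {c..d}" for t
    using F' that by (rule continuous_on_section1)
  define e' where "e' = e / (K * I + 1)"
  have KI: "K * I + 1 > 0" using K(1) I by (simp add: add_nonneg_pos)
  have e': "e' > 0" using e KI by (simp add: e'_def)
  obtain \<delta> where \<delta>: "0 < \<delta>" "\<And>s t'. s \<in> {a..b} \<Longrightarrow> t' \<in> {c..d} \<Longrightarrow> \<bar>t' - t\<bar> < \<delta> \<Longrightarrow> norm (F' s t' - F' s t) < e'"
    using uniformly_close_in_parameter[OF _ _ F' t e'] by auto
  show "\<exists>\<delta>>0. \<forall>t'\<in>{c..d}. norm (t' - t) < \<delta> \<longrightarrow>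
      norm (integral {a..b} (\<lambda>s. pr (F s t') (g s)) - integral {a..b} (\<lambda>s. pr (F s t) (g s))
        - (t' - t) *\<^sub>R integral {a..b} (\<lambda>s. pr (F' s t) (g s))) \<le> e * norm (t' - t)"
  proof (intro exI conjI ballI impI)
    fix t' assume t': "t' \<in> {c..d}" "norm (t' - t) < \<delta>"
    have int: "(\<lambda>s. pr (h s) (g s)) integrable_on {a..b}" if "continuous_on {a..b} h" for h
      using absolutely_integrable_bilinear_continuous[OF pr that g] by (rule set_lebesgue_integral_eq_integral)
    have "integral {a..b} (\<lambda>s. pr (F s t') (g s)) - integral {a..b} (\<lambda>s. pr (F s t) (g s))
        - (t' - t) *\<^sub>R integral {a..b} (\<lambda>s. pr (F' s t) (g s))
       = integral {a..b} (\<lambda>s. pr (F s t' - F s t - (t' - t) *\<^sub>R F' s t) (g s))"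
      using int[OF Fc[OF t'(1)]] int[OF Fc[OF t]] int[OF Fc'[OF t]]
      by (simp add: bounded_bilinear.diff_left[OF pr] bounded_bilinear.scaleR_left[OF pr]
          Henstock_Kurzweil_Integration.integral_diff integrable_diff integrable_cmul)
    also have "norm \<dots> \<le> (\<bar>t' - t\<bar> * e') * K * I"
      unfolding I_def
    proof (intro norm_bilinear_integral_le[OF pr K(2,1)] continuous_intros Fc Fc' t t'(1) g)
      fix s assume s: "s \<in> {a..b}"
      let ?S = "closed_segment t t'"
      have sub: "?S \<subseteq> {c..d}" using t t' by (simp add: closed_segment_subset)
      have "norm (F s t' - F s t - (t' - t) *\<^sub>R F' s t) \<le> norm (t' - t) * e'"
      proof (rule vector_differentiable_bound_linearization[where S = ?S])
        show "(F s has_vector_derivative F' s x) (at x within ?S)" if "x \<in> ?S" for x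
          using deriv[OF s] sub that has_vector_derivative_within_subset by blast
        show "norm (F' s x - F' s t) \<le> e'" if "x \<in> ?S" for x
        proof -
          have "\<bar>x - t\<bar> < \<delta>" using that t' by (auto simp: closed_segment_eq_real_ivl split: if_splits)
          then show ?thesis using \<delta>(2)[OF s, of x] sub that by auto
        qed
      qed auto
      then show "norm (F s t' - F s t - (t' - t) *\<^sub>R F' s t) \<le> \<bar>t' - t\<bar> * e'" by simp
    qed
    also have "\<dots> = (e * (K * I) / (K * I + 1)) * \<bar>t' - t\<bar>" by (simp add: e'_def)
    also have "\<dots> \<le> e * norm (t' - t)"
      using KI e by (intro mult_mono) (auto simp: pos_divide_le_eq algebra_simps intro!: divide_nonneg_pos mult_nonneg_nonneg K I)
    finally show "norm (integral {a..b} (\<lambda>s. pr (F s t') (g s)) - integral {a..b} (\<lambda>s. pr (F s t) (g s))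
        - (t' - t) *\<^sub>R integral {a..b} (\<lambda>s. pr (F' s t) (g s))) \<le> e * norm (t' - t)" .
  qed (rule \<delta>)
qed

lemma continuous_on_integral_diagonal:
  fixes f :: "real \<Rightarrow> real \<Rightarrow> 'b::euclidean_space"
  assumes "continuous_on ({a..b} \<times> {a..b}) (\<lambda>(r, s). f r s)"
  shows "continuous_on {a..b} (\<lambda>r. integral {a..r} (f r))"
proof -
  have "continuous_on {a..b} (\<lambda>r. (\<lambda>(x, t). integral {a..t} (f x)) (r, r))"
    by (rule continuous_on_compose2[OF continuous_on_integral_upper[OF assms]])
      (auto intro!: continuous_intros)
  then show ?thesis by simp
qed

lemma integral_moving_end_has_vector_derivative:
  fixes f :: "real \<Rightarrow> real \<Rightarrow> 'b::euclidean_space"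
  assumes f: "continuous_on ({c..d} \<times> {c..d}) (\<lambda>(s, t). f s t)" and t: "t \<in> {c..d}"
    and deriv: "((\<lambda>t'. integral {c..t} (\<lambda>s. f s t')) has_vector_derivative D) (at t within {c..d})"
  shows "((\<lambda>t. integral {c..t} (\<lambda>s. f s t)) has_vector_derivative (f t t + D)) (at t within {c..d})"
proof -
  define k where "k t' = integral {c..t'} (\<lambda>s. f s t') - integral {c..t} (\<lambda>s. f s t')" for t'
  have fc: "continuous_on {c..d} (\<lambda>s. f s t')" if "t' \<in> {c..d}" for t'
    using f that by (rule continuous_on_section1)
  have "(k has_vector_derivative f t t) (at t within {c..d})"
    unfolding has_vector_derivative_def has_derivative_within_alt
  proof (intro conjI allI impI)
    fix e :: real assume e: "0 < e"
    obtain \<delta> where \<delta>: "\<delta> > 0" "\<And>p. p \<in> {c..d} \<times> {c..d} \<Longrightarrow> dist p (t, t) < \<delta> \<Longrightarrow>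
        dist (case p of (s, t) \<Rightarrow> f s t) (case (t, t) of (s, t) \<Rightarrow> f s t) < e"
      using f t e unfolding continuous_on_iff by (metis mem_Sigma_iff)
    have near: "norm (f s t' - f t t) \<le> e"
      if "s \<in> {c..d}" "t' \<in> {c..d}" "\<bar>s - t\<bar> \<le> \<bar>t' - t\<bar>" "\<bar>t' - t\<bar> < \<delta> / 2" for s t'
    proof -
      have "dist (s, t') (t, t) \<le> \<bar>s - t\<bar> + \<bar>t' - t\<bar>"
        by (simp add: dist_Pair_Pair dist_real_def sqrt_sum_squares_le_sum_abs)
      then have "dist (s, t') (t, t) < \<delta>" using that by linarith
      from \<delta>(2)[OF _ this] that show ?thesis by (simp add: dist_norm)
    qed
    show "\<exists>\<delta>>0. \<forall>t'\<in>{c..d}. norm (t' - t) < \<delta> \<longrightarrow>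
        norm (k t' - k t - (t' - t) *\<^sub>R f t t) \<le> e * norm (t' - t)"
    proof (intro exI[of _ "\<delta> / 2"] conjI ballI impI)
      fix t' assume t': "t' \<in> {c..d}" "norm (t' - t) < \<delta> / 2"
      show "norm (k t' - k t - (t' - t) *\<^sub>R f t t) \<le> e * norm (t' - t)"
      proof (cases "t \<le> t'")
        case True
        have int: "(\<lambda>s. f s t') integrable_on {t..t'}"
          using t t' by (intro integrable_continuous_real continuous_on_subset[OF fc[OF t'(1)]]) auto
        have split: "integral {t..t'} (\<lambda>s. f s t' - f t t) = integral {t..t'} (\<lambda>s. f s t') - (t' - t) *\<^sub>R f t t"
          using Henstock_Kurzweil_Integration.integral_diff[OF int integrable_const_ivl] True by simp
        have "k t' - k t - (t' - t) *\<^sub>R f t t = integral {t..t'} (\<lambda>s. f s t' - f t t)"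
          using Henstock_Kurzweil_Integration.integral_combine[of c t t' "\<lambda>s. f s t'"] True t t'
            integrable_continuous_real[OF continuous_on_subset[OF fc[OF t'(1)], of "{c..t'}"]] int
          by (simp add: k_def split algebra_simps)
        also have "norm \<dots> \<le> integral {t..t'} (\<lambda>_. e)"
          using t t' True int
          by (intro integral_norm_bound_integral near integrable_diff) auto
        finally show ?thesis using True by (simp add: mult_ac)
      next
        case False
        have int: "(\<lambda>s. f s t') integrable_on {t'..t}"
          using t t' by (intro integrable_continuous_real continuous_on_subset[OF fc[OF t'(1)]]) auto
        have split: "integral {t'..t} (\<lambda>s. f s t' - f t t) = integral {t'..t} (\<lambda>s. f s t') - (t - t') *\<^sub>R f t t"
          using Henstock_Kurzweil_Integration.integral_diff[OF int integrable_const_ivl] False by simp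
        have "k t' - k t - (t' - t) *\<^sub>R f t t = - integral {t'..t} (\<lambda>s. f s t' - f t t)"
          using Henstock_Kurzweil_Integration.integral_combine[of c t' t "\<lambda>s. f s t'"] False t t'
            integrable_continuous_real[OF continuous_on_subset[OF fc[OF t'(1)], of "{c..t}"]] int
          by (simp add: k_def split algebra_simps)
        also have "norm \<dots> \<le> integral {t'..t} (\<lambda>_. e)"
          unfolding norm_minus_cancel using t t' False int
          by (intro integral_norm_bound_integral near integrable_diff) auto
        finally show ?thesis using False by (simp add: mult_ac)
      qed
    qed (use \<delta> in auto)
  qed (rule bounded_linear_scaleR_left)
  from has_vector_derivative_add[OF this deriv] show ?thesis by (simp add: k_def)
qed

lemma moving_weighted_integral_has_vector_derivative:
  fixes pr :: "'a::euclidean_space \<Rightarrow> 'b::euclidean_space \<Rightarrow> 'c::euclidean_space" and c d :: real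
  assumes pr: "bounded_bilinear pr"
    and F: "continuous_on ({c..d} \<times> {c..d}) (\<lambda>(s, t). F s t)"
    and F': "continuous_on ({c..d} \<times> {c..d}) (\<lambda>(s, t). F' s t)"
    and deriv: "\<And>s t. s \<in> {c..d} \<Longrightarrow> t \<in> {c..d} \<Longrightarrow> (F s has_vector_derivative F' s t) (at t within {c..d})"
    and w: "continuous_on {c..d} w" and t: "t \<in> {c..d}"
  shows "((\<lambda>t. integral {c..t} (\<lambda>s. pr (F s t) (w s))) has_vector_derivative
     (pr (F t t) (w t) + integral {c..t} (\<lambda>s. pr (F' s t) (w s)))) (at t within {c..d})"
proof (rule integral_moving_end_has_vector_derivative[OF _ t])
  have "continuous_on ({c..d} \<times> {c..d}) (\<lambda>p. pr (case p of (s, t) \<Rightarrow> F s t) (w (fst p)))"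
    by (intro bounded_bilinear.continuous_on[OF pr] F continuous_on_compose2[OF w] continuous_intros) auto
  then show "continuous_on ({c..d} \<times> {c..d}) (\<lambda>(s, t). pr (F s t) (w s))"
    by (simp add: case_prod_unfold)
  have sub: "{c..t} \<times> {c..d} \<subseteq> {c..d} \<times> {c..d}" using t by auto
  show "((\<lambda>t'. integral {c..t} (\<lambda>s. pr (F s t') (w s))) has_vector_derivative
     integral {c..t} (\<lambda>s. pr (F' s t) (w s))) (at t within {c..d})"
    using t by (intro weighted_integral_has_vector_derivative[OF pr] deriv
        absolutely_integrable_continuous_real
        continuous_on_subset[OF w] continuous_on_subset[OF F sub] continuous_on_subset[OF F' sub]) auto
qed

text \<open>Increments of the difference of the two sides over \<open>[x, y]\<close> are bounded by a multiple of
  \<open>(y - x) * (integral of norm g over [x, y])\<close>, so that it has derivative zero at every point,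
  although \<open>integral {a..t} g\<close> is in general differentiable only almost everywhere.\<close>

lemma integration_by_parts_indefinite:
  fixes p p' :: "real \<Rightarrow> 'a::euclidean_space"
  assumes ab: "a \<le> b"
    and p: "\<And>t. t \<in> {a..b} \<Longrightarrow> (p has_vector_derivative p' t) (at t within {a..b})"
    and p': "continuous_on {a..b} p'" and g: "g absolutely_integrable_on {a..b}"
  shows "((\<lambda>t. p' t \<bullet> integral {a..t} g + p t \<bullet> g t) has_integral p b \<bullet> integral {a..b} g) {a..b}"
proof -
  define G where "G t = integral {a..t} g" for t
  define H where "H t = integral {a..t} (\<lambda>t. norm (g t))" for t
  define f where "f t = p' t \<bullet> G t + p t \<bullet> g t" for t
  define D where "D t = p t \<bullet> G t - integral {a..t} f" for t
  have gi: "g integrable_on {a..b}" and ngi: "(\<lambda>t. norm (g t)) integrable_on {a..b}"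
    using g by (auto simp: absolutely_integrable_on_def)
  have gi': "g integrable_on {x..y}" and ngi': "(\<lambda>t. norm (g t)) integrable_on {x..y}"
    if "a \<le> x" "y \<le> b" for x y
    using that by (auto intro: integrable_on_subinterval[OF gi] integrable_on_subinterval[OF ngi])
  have pc: "continuous_on {a..b} p"
    using p by (metis has_vector_derivative_continuous continuous_on_eq_continuous_within)
  have Gc: "continuous_on {a..b} G" unfolding G_def by (intro indefinite_integral_continuous_1 gi)
  have Hc: "continuous_on {a..b} H" unfolding H_def by (intro indefinite_integral_continuous_1 ngi)
  have pgi: "(\<lambda>t. h t \<bullet> g t) integrable_on {a..b}" if "continuous_on {a..b} h" for h
    by (rule set_lebesgue_integral_eq_integral(1)[OF
        absolutely_integrable_bilinear_continuous[OF bounded_bilinear_inner that g]])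
  have fi: "f integrable_on {a..b}"
    unfolding f_def by (intro integrable_add pgi pc integrable_continuous_real continuous_intros p' Gc)
  obtain C where C: "C > 0" "\<And>t. t \<in> {a..b} \<Longrightarrow> norm (p' t) \<le> C"
    using compact_imp_bounded[OF compact_continuous_image[OF p' compact_Icc]]
    unfolding bounded_pos by auto
  have diff: "G y - G x = integral {x..y} g" "H y - H x = integral {x..y} (\<lambda>t. norm (g t))"
    "integral {a..y} f - integral {a..x} f = integral {x..y} f"
    if "a \<le> x" "x \<le> y" "y \<le> b" for x y
  proof -
    have fi': "f integrable_on {a..y}" using that by (intro integrable_on_subinterval[OF fi]) auto
    show "G y - G x = integral {x..y} g"
      using Henstock_Kurzweil_Integration.integral_combine[OF that(1,2) gi'[OF order_refl that(3)]]
      by (simp add: G_def algebra_simps)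
    show "H y - H x = integral {x..y} (\<lambda>t. norm (g t))"
      using Henstock_Kurzweil_Integration.integral_combine[OF that(1,2) ngi'[OF order_refl that(3)]]
      by (simp add: H_def algebra_simps)
    show "integral {a..y} f - integral {a..x} f = integral {x..y} f"
      using Henstock_Kurzweil_Integration.integral_combine[OF that(1,2) fi']
      by (simp add: algebra_simps)
  qed
  have nG: "norm (G y - G x) \<le> H y - H x" and Hm: "H x \<le> H y" if "a \<le> x" "x \<le> y" "y \<le> b" for x y
  proof -
    show *: "norm (G y - G x) \<le> H y - H x"
      unfolding diff[OF that] using gi'[of x y] ngi'[of x y] that by (intro integral_norm_bound_integral) auto
    show "H x \<le> H y" using norm_ge_zero[of "G y - G x"] * by linarith
  qed
  have np: "norm (p y - p x) \<le> C * (y - x)" if "a \<le> x" "x \<le> y" "y \<le> b" for x y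
  proof -
    have "(p' has_integral (p y - p x)) {x..y}"
      using that by (intro fundamental_theorem_of_calculus has_vector_derivative_within_subset[OF p]) auto
    moreover have "norm (p' t) \<le> C" if "t \<in> {x..y} - {}" for t
      using C(2)[of t] that \<open>a \<le> x\<close> \<open>y \<le> b\<close> by auto
    ultimately have "norm (p y - p x) \<le> C * measure lborel {x..y}"
      using has_integral_bound_real[OF less_imp_le[OF C(1)] finite.emptyI] by metis
    then show ?thesis using that by simp
  qed
  have bound: "\<bar>D y - D x\<bar> \<le> 2 * C * (y - x) * (H y - H x)" if xy: "a \<le> x" "x \<le> y" "y \<le> b" for x y
  proof -
    have sub: "{x..y} \<subseteq> {a..b}" using xy by auto
    have 1: "(p' has_integral (p y - p x)) {x..y}"
      using xy by (intro fundamental_theorem_of_calculus has_vector_derivative_within_subset[OF p]) auto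
    have 2: "((\<lambda>t. p' t \<bullet> G x) has_integral (p y - p x) \<bullet> G x) {x..y}"
      using has_integral_linear[OF 1 bounded_linear_inner_left[of "G x"]] by (simp add: o_def)
    have 3: "((\<lambda>t. p y \<bullet> g t) has_integral p y \<bullet> (G y - G x)) {x..y}"
      using has_integral_linear[OF integrable_integral[OF gi'[of x y]] bounded_linear_inner_right[of "p y"]] xy
      by (simp add: o_def diff)
    have 4: "(f has_integral (integral {a..y} f - integral {a..x} f)) {x..y}"
      unfolding diff[OF xy] by (rule integrable_integral[OF integrable_on_subinterval[OF fi sub]])
    \<comment> \<open>The increment of \<open>p \<bullet> G\<close> is written as
      \<open>(p y - p x) \<bullet> G x + p y \<bullet> (G y - G x)\<close>. After subtracting
      \<open>f\<close>, each factor that remains beside \<open>p' t\<close> or \<open>g t\<close> is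
      itself an increment, hence small.\<close>
    have "((\<lambda>t. p' t \<bullet> G x + p y \<bullet> g t - f t) has_integral D y - D x) {x..y}"
      by (rule has_integral_eq_rhs[OF has_integral_diff[OF has_integral_add[OF 2 3] 4]])
        (simp add: D_def inner_diff_left inner_diff_right)
    then have 5: "((\<lambda>t. p' t \<bullet> (G x - G t) + (p y - p t) \<bullet> g t) has_integral D y - D x) {x..y}"
      by (rule has_integral_eq[rotated]) (simp add: f_def inner_diff_left inner_diff_right)
    have 6: "((\<lambda>t. C * (H y - H x) + C * (y - x) * norm (g t)) has_integral
        (y - x) * (C * (H y - H x)) + C * (y - x) * (H y - H x)) {x..y}"
      unfolding diff[OF xy] using xy ngi'[of x y] has_integral_const_real[of "C * integral {x..y} (\<lambda>t. norm (g t))" x y]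
      by (intro has_integral_add has_integral_mult_right integrable_integral) auto
    have "norm (integral {x..y} (\<lambda>t. p' t \<bullet> (G x - G t) + (p y - p t) \<bullet> g t))
        \<le> integral {x..y} (\<lambda>t. C * (H y - H x) + C * (y - x) * norm (g t))"
    proof (rule integral_norm_bound_integral)
      fix t assume t: "t \<in> {x..y}"
      have "\<bar>p' t \<bullet> (G x - G t)\<bar> \<le> norm (p' t) * norm (G x - G t)" by (rule Cauchy_Schwarz_ineq2)
      also have "\<dots> \<le> C * (H y - H x)"
      proof (rule mult_mono)
        show "norm (G x - G t) \<le> H y - H x"
          using nG[of x t] Hm[of t y] t xy by (simp add: norm_minus_commute)
      qed (use C t xy in auto)
      finally have "\<bar>p' t \<bullet> (G x - G t)\<bar> \<le> C * (H y - H x)" .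
      moreover have "\<bar>(p y - p t) \<bullet> g t\<bar> \<le> C * (y - x) * norm (g t)"
      proof -
        have "norm (p y - p t) \<le> C * (y - t)" using np[of t y] t xy by auto
        also have "\<dots> \<le> C * (y - x)" using t C by auto
        finally show ?thesis
          using mult_right_mono[of "norm (p y - p t)" "C * (y - x)" "norm (g t)", OF _ norm_ge_zero]
            Cauchy_Schwarz_ineq2[of "p y - p t" "g t"] by linarith
      qed
      ultimately show "norm (p' t \<bullet> (G x - G t) + (p y - p t) \<bullet> g t) \<le> C * (H y - H x) + C * (y - x) * norm (g t)"
        unfolding real_norm_def by linarith
    qed (rule has_integral_integrable[OF 5] has_integral_integrable[OF 6])+
    then show ?thesis using integral_unique[OF 5] integral_unique[OF 6] by (simp add: algebra_simps)
  qed
  have bound': "\<bar>D y - D x\<bar> \<le> 2 * C * \<bar>y - x\<bar> * \<bar>H y - H x\<bar>" if "x \<in> {a..b}" "y \<in> {a..b}" for x y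
  proof (cases "x \<le> y")
    case True
    then show ?thesis using bound[of x y] Hm[of x y] that by simp
  next
    case False
    then show ?thesis using bound[of y x] Hm[of y x] that by (simp add: abs_minus_commute)
  qed
  have "(D has_vector_derivative 0) (at x within {a..b})" if x: "x \<in> {a..b}" for x
    unfolding has_vector_derivative_def has_derivative_within_alt
  proof (intro conjI allI impI)
    fix e :: real assume e: "0 < e"
    then have "e / (2 * C) > 0" using C by simp
    then obtain \<delta> where \<delta>: "\<delta> > 0" "\<And>y. y \<in> {a..b} \<Longrightarrow> \<bar>y - x\<bar> < \<delta> \<Longrightarrow> \<bar>H y - H x\<bar> < e / (2 * C)"
      using Hc x unfolding continuous_on_iff dist_real_def by blast
    show "\<exists>\<delta>>0. \<forall>y\<in>{a..b}. norm (y - x) < \<delta> \<longrightarrow> norm (D y - D x - (y - x) *\<^sub>R 0) \<le> e * norm (y - x)"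
    proof (intro exI[of _ \<delta>] conjI ballI impI)
      fix y assume y: "y \<in> {a..b}" "norm (y - x) < \<delta>"
      have "2 * C * \<bar>y - x\<bar> * \<bar>H y - H x\<bar> \<le> 2 * C * \<bar>y - x\<bar> * (e / (2 * C))"
        using \<delta>(2)[of y] y C by (intro mult_left_mono) auto
      then show "norm (D y - D x - (y - x) *\<^sub>R 0) \<le> e * norm (y - x)"
        using bound'[OF x y(1)] C by (simp add: mult_ac)
    qed (rule \<delta>)
  qed (rule bounded_linear_scaleR_left)
  note D' = this
  obtain c where c: "\<And>x. x \<in> {a..b} \<Longrightarrow> D x = c"
    using has_vector_derivative_zero_constant[OF convex_real_interval(5) D'] by blast
  have "D b = D a" using c[of a] c[of b] ab by simp
  then have "integral {a..b} f = p b \<bullet> G b" by (simp add: D_def G_def)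
  then show ?thesis
    using integrable_integral[OF fi] unfolding f_def G_def by simp
qed

subsection \<open>Linear Volterra equations\<close>

text \<open>The free term \<open>U\<close> stays outside the integral: it will contain the integral
  of a square integrable control, which is continuous but need not be differentiable
  everywhere.\<close>

definition volterra_op :: "(real \<Rightarrow> real^'n^'n) \<Rightarrow> (real \<Rightarrow> real \<Rightarrow> real^'n^'n) \<Rightarrow> (real \<Rightarrow> real^'n)
    \<Rightarrow> real \<Rightarrow> (real \<Rightarrow> real^'n) \<Rightarrow> real \<Rightarrow> real^'n" where
  "volterra_op L k U a w t = U t + integral {a..t} (\<lambda>r. L r *v w r + integral {a..r} (\<lambda>s. k r s *v w s))"

lemma volterra_integrand_continuous:
  assumes L: "continuous_on {a..b} L" and k: "continuous_on ({a..b} \<times> {a..b}) (\<lambda>(r, s). k r s)"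
    and w: "continuous_on {a..b} (w :: real \<Rightarrow> real^'n)"
  shows "continuous_on {a..b} (\<lambda>r. L r *v w r + integral {a..r} (\<lambda>s. (k r s :: real^'n^'m) *v w s))"
proof -
  have "continuous_on ({a..b} \<times> {a..b}) (\<lambda>p. (case p of (r, s) \<Rightarrow> k r s) *v w (snd p))"
    by (intro continuous_intros k continuous_on_compose2[OF w]) auto
  then have "continuous_on ({a..b} \<times> {a..b}) (\<lambda>(r, s). k r s *v w s)"
    by (simp add: case_prod_unfold)
  from continuous_on_integral_diagonal[OF this] show ?thesis
    by (intro continuous_intros L w)
qed

lemma volterra_op_continuous:
  assumes L: "continuous_on {a..b} L" and k: "continuous_on ({a..b} \<times> {a..b}) (\<lambda>(r, s). k r s)"
    and U: "continuous_on {a..b} U" and w: "continuous_on {a..b} w"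
  shows "continuous_on {a..b} (volterra_op L k U a w)"
  unfolding volterra_op_def
  by (intro continuous_on_add U indefinite_integral_continuous_1 integrable_continuous_real
      volterra_integrand_continuous L k w)

lemma matrix_vector_norm_bound:
  obtains K where "0 < K" "\<And>(X :: real^'n^'m) x. norm (X *v x) \<le> K * norm X * norm x"
  using bounded_bilinear.pos_bounded[OF bounded_bilinear_matrix_vector] by (metis mult.assoc mult.commute)

lemma matrix_matrix_norm_bound:
  obtains K where "0 < K" "\<And>(X :: real^'n^'m) (Y :: real^'k^'n). norm (X ** Y) \<le> K * norm X * norm Y"
  using bounded_bilinear.pos_bounded[OF bounded_bilinear_matrix_matrix] by (metis mult.assoc mult.commute)

text \<open>The weight is increasing, so on \<open>s \<le> r\<close> the difference is bounded by
  its weight at \<open>r\<close>, and the memory term costs a factor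
  \<open>\<kappa> * (b - a)\<close> on top of \<open>l\<close>. A rate \<open>c\<close> of at least
  twice the resulting Lipschitz constant gives the factor 1/2.\<close>

lemma volterra_op_contraction:
  fixes L :: "real \<Rightarrow> real^'n^'n"
  assumes K: "0 < K" "\<And>(X :: real^'n^'n) x. norm (X *v x) \<le> K * norm X * norm x"
    and L: "continuous_on {a..b} L" "\<And>r. r \<in> {a..b} \<Longrightarrow> norm (L r) \<le> l"
    and k: "continuous_on ({a..b} \<times> {a..b}) (\<lambda>(r, s). k r s)"
      "\<And>r s. r \<in> {a..b} \<Longrightarrow> s \<in> {a..b} \<Longrightarrow> norm (k r s) \<le> \<kappa>"
    and c: "2 * K * (l + \<kappa> * (b - a)) \<le> c" "0 < c"
    and w: "continuous_on {a..b} w" "continuous_on {a..b} w'" and M: "0 \<le> M"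
    and le: "\<And>t. t \<in> {a..b} \<Longrightarrow> norm (w t - w' t) \<le> M * exp (c * t)"
  shows "\<forall>t\<in>{a..b}. norm (volterra_op L k U a w t - volterra_op L k U a w' t) \<le> M / 2 * exp (c * t)"
proof
  fix t assume t: "t \<in> {a..b}"
  have l0: "0 \<le> l" using L(2)[OF t] norm_ge_zero[of "L t"] by linarith
  have k0: "0 \<le> \<kappa>" using k(2)[OF t t] norm_ge_zero[of "k t t"] by linarith
  define m where "m = K * (l + \<kappa> * (b - a))"
  have m0: "0 \<le> m" using K l0 k0 t by (simp add: m_def)
  define f where "f w r = L r *v w r + integral {a..r} (\<lambda>s. k r s *v w s)" for w r
  have fc: "continuous_on {a..b} (f w)" if "continuous_on {a..b} w" for w
    unfolding f_def by (intro volterra_integrand_continuous L k that)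
  have fi: "f w integrable_on {a..t}" if "continuous_on {a..b} w" for w
    using t by (intro integrable_continuous_real continuous_on_subset[OF fc[OF that]]) auto
  have "volterra_op L k U a w t - volterra_op L k U a w' t = integral {a..t} (\<lambda>r. f w r - f w' r)"
    using fi w by (simp add: volterra_op_def f_def[symmetric] Henstock_Kurzweil_Integration.integral_diff)
  also have "norm \<dots> \<le> m * M / c * exp (c * t)"
  proof (rule norm_integral_exp_le)
    show "(\<lambda>r. f w r - f w' r) integrable_on {a..t}" using fi w by (intro integrable_diff) auto
    show "0 \<le> m * M" using m0 M by simp
    fix r assume r: "r \<in> {a..t}"
    then have rb: "r \<in> {a..b}" using t by auto
    have ki: "(\<lambda>s. k r s *v w s) integrable_on {a..r}" if "continuous_on {a..b} w" for w
    proof -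
      have "continuous_on {a..b} (\<lambda>s. k r s *v w s)"
        by (intro continuous_intros that continuous_on_section2[OF k(1) rb])
      then show ?thesis
        using rb by (intro integrable_continuous_real) (auto elim!: continuous_on_subset)
    qed
    have eq: "f w r - f w' r = L r *v (w r - w' r) + integral {a..r} (\<lambda>s. k r s *v (w s - w' s))"
      using ki[OF w(1)] ki[OF w(2)]
      by (simp add: f_def matrix_vector_mult_diff_distrib Henstock_Kurzweil_Integration.integral_diff)
    have 1: "norm (L r *v (w r - w' r)) \<le> K * l * (M * exp (c * r))"
      using K(2)[of "L r" "w r - w' r"] le[OF rb] L(2)[OF rb] K(1) l0
      by (elim order_trans) (intro mult_mono, auto)
    have "norm (integral {a..r} (\<lambda>s. k r s *v (w s - w' s))) \<le> integral {a..r} (\<lambda>s. K * \<kappa> * (M * exp (c * r)))"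
    proof (rule integral_norm_bound_integral)
      show "(\<lambda>s. k r s *v (w s - w' s)) integrable_on {a..r}"
        using ki[of "\<lambda>s. w s - w' s"] w by (auto intro!: continuous_intros)
      fix s assume s: "s \<in> {a..r}"
      then have sb: "s \<in> {a..b}" using rb by auto
      have "norm (w s - w' s) \<le> M * exp (c * r)"
      proof -
        have "M * exp (c * s) \<le> M * exp (c * r)" using s c(2) M by (intro mult_left_mono) auto
        then show ?thesis using le[OF sb] by linarith
      qed
      then show "norm (k r s *v (w s - w' s)) \<le> K * \<kappa> * (M * exp (c * r))"
        using K(2)[of "k r s" "w s - w' s"] k(2)[OF rb sb] K(1) k0
        by (elim order_trans) (intro mult_mono, auto)
    qed auto
    also have "\<dots> = (r - a) * (K * \<kappa> * (M * exp (c * r)))" using r by simp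
    also have "\<dots> \<le> (b - a) * (K * \<kappa> * (M * exp (c * r)))"
      using rb K(1) k0 M by (intro mult_right_mono) auto
    finally have 2: "norm (integral {a..r} (\<lambda>s. k r s *v (w s - w' s))) \<le> (b - a) * (K * \<kappa> * (M * exp (c * r)))" .
    show "norm (f w r - f w' r) \<le> m * M * exp (c * r)"
      unfolding eq using norm_triangle_ineq[of "L r *v (w r - w' r)" "integral {a..r} (\<lambda>s. k r s *v (w s - w' s))"] 1 2
      by (simp add: m_def algebra_simps)
  qed (use t c in auto)
  also have "\<dots> \<le> M / 2 * exp (c * t)"
  proof -
    have "m * M \<le> M / 2 * c" using c(1) M mult_right_mono[of "2 * m" c M] by (simp add: m_def mult_ac)
    then have "m * M / c \<le> M / 2" using c(2) by (simp add: pos_divide_le_eq)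
    then show ?thesis by (rule mult_right_mono) simp
  qed
  finally show "norm (volterra_op L k U a w t - volterra_op L k U a w' t) \<le> M / 2 * exp (c * t)" .
qed

text \<open>The solution is compared with the zero function, whose image is \<open>U\<close> and
  whose defect is therefore at most \<open>u\<close>. The factor \<open>exp (- c * a)\<close>
  normalizes the weight to be at least 1 on the interval.\<close>

lemma volterra_stability:
  fixes L :: "real \<Rightarrow> real^'n^'n"
  assumes K: "0 < K" "\<And>(X :: real^'n^'n) x. norm (X *v x) \<le> K * norm X * norm x"
    and L: "continuous_on {a..b} L" "\<And>r. r \<in> {a..b} \<Longrightarrow> norm (L r) \<le> l"
    and k: "continuous_on ({a..b} \<times> {a..b}) (\<lambda>(r, s). k r s)"
      "\<And>r s. r \<in> {a..b} \<Longrightarrow> s \<in> {a..b} \<Longrightarrow> norm (k r s) \<le> \<kappa>"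
    and c: "2 * K * (l + \<kappa> * (b - a)) \<le> c" "0 < c"
    and w: "continuous_on {a..b} w" "\<And>t. t \<in> {a..b} \<Longrightarrow> w t = volterra_op L k U a w t"
    and U: "\<And>t. t \<in> {a..b} \<Longrightarrow> norm (U t) \<le> u"
    and t: "t \<in> {a..b}"
  shows "norm (w t) \<le> 2 * u * exp (c * (b - a))"
proof -
  have u0: "0 \<le> u" using U[OF t] norm_ge_zero[of "U t"] by linarith
  have "norm (w t - 0) \<le> 2 * (u * exp (- c * a)) * exp (c * t)"
  proof (rule weighted_contraction_stability[where \<Phi> = "volterra_op L k U a" and K = "{a..b}"
        and \<omega> = "\<lambda>t. exp (c * t)" and Y = "\<lambda>_. 0", OF compact_Icc _ _ _ w(1) _ _ _ t])
    fix Z Z' :: "real \<Rightarrow> real^'n" and M assume h: "continuous_on {a..b} Z" "continuous_on {a..b} Z'" "0 \<le> M"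
      "\<And>x. x \<in> {a..b} \<Longrightarrow> norm (Z x - Z' x) \<le> M * exp (c * x)"
    show "\<forall>x\<in>{a..b}. norm (volterra_op L k U a Z x - volterra_op L k U a Z' x) \<le> M / 2 * exp (c * x)"
      by (rule volterra_op_contraction[OF K L k c]) (rule h | assumption)+
  next
    fix x assume x: "x \<in> {a..b}"
    have "volterra_op L k U a (\<lambda>_. 0) x = U x"
      by (simp add: volterra_op_def)
    moreover have "exp (- c * a) * exp (c * x) \<ge> 1"
      using c x by (simp add: exp_add[symmetric] algebra_simps)
    then have "u * 1 \<le> u * (exp (- c * a) * exp (c * x))" using u0 by (intro mult_left_mono)
    ultimately show "norm (volterra_op L k U a (\<lambda>_. 0) x - 0) \<le> u * exp (- c * a) * exp (c * x)"
      using U[OF x] by (simp add: mult_ac)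
    show "volterra_op L k U a w x = w x" using w(2)[OF x] by simp
  qed (auto intro!: continuous_intros)
  also have "2 * (u * exp (- c * a)) * exp (c * t) = 2 * u * exp (c * (t - a))"
    by (simp add: exp_diff exp_minus right_diff_distrib field_simps)
  also have "\<dots> \<le> 2 * u * exp (c * (b - a))"
    using t c u0 by (intro mult_left_mono) auto
  finally show ?thesis by simp
qed

lemma volterra_exists_unique:
  fixes L :: "real \<Rightarrow> real^'n^'n"
  assumes ab: "a \<le> b"
    and L: "continuous_on {a..b} L" and k: "continuous_on ({a..b} \<times> {a..b}) (\<lambda>(r, s). k r s)"
    and U: "continuous_on {a..b} U"
  obtains w where "continuous_on {a..b} w" "\<And>t. t \<in> {a..b} \<Longrightarrow> w t = volterra_op L k U a w t"
    "\<And>w' t. continuous_on {a..b} w' \<Longrightarrow> (\<And>t. t \<in> {a..b} \<Longrightarrow> w' t = volterra_op L k U a w' t)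
      \<Longrightarrow> t \<in> {a..b} \<Longrightarrow> w' t = w t"
proof -
  obtain K where K: "0 < K" "\<And>(X :: real^'n^'n) x. norm (X *v x) \<le> K * norm X * norm x"
    by (rule matrix_vector_norm_bound[where 'n = 'n and 'm = 'n]) (rule that)
  obtain l where l: "0 < l" "\<And>r. r \<in> {a..b} \<Longrightarrow> norm (L r) \<le> l"
    using compact_imp_bounded[OF compact_continuous_image[OF L compact_Icc]] unfolding bounded_pos by auto
  obtain \<kappa> where \<kappa>: "0 < \<kappa>" "\<And>r s. r \<in> {a..b} \<Longrightarrow> s \<in> {a..b} \<Longrightarrow> norm (k r s) \<le> \<kappa>"
    using compact_imp_bounded[OF compact_continuous_image[OF k compact_Times[OF compact_Icc compact_Icc]]]
    unfolding bounded_pos by fastforce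
  define c where "c = 2 * K * (l + \<kappa> * (b - a))"
  have c: "c > 0" unfolding c_def using K(1) l(1) \<kappa>(1) ab by (intro mult_pos_pos add_pos_nonneg) auto
  have \<omega>: "continuous_on {a..b} (\<lambda>t. exp (c * t))" "0 < exp (c * t)" for t
    by (auto intro!: continuous_intros)
  obtain w where w: "continuous_on {a..b} w" "\<And>t. t \<in> {a..b} \<Longrightarrow> volterra_op L k U a w t = w t"
  proof (rule weighted_contraction_fixpoint[where \<Phi> = "volterra_op L k U a" and K = "{a..b}" and \<omega> = "\<lambda>t. exp (c * t)", OF compact_Icc \<omega>])
    show "continuous_on {a..b} (volterra_op L k U a Z)" if "continuous_on {a..b} Z" for Z :: "real \<Rightarrow> real^'n"
      by (rule volterra_op_continuous[OF L k U that])
  next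
    fix Z Z' :: "real \<Rightarrow> real^'n" and M assume h: "continuous_on {a..b} Z" "continuous_on {a..b} Z'" "0 \<le> M"
      "\<And>x. x \<in> {a..b} \<Longrightarrow> norm (Z x - Z' x) \<le> M * exp (c * x)"
    show "\<forall>x\<in>{a..b}. norm (volterra_op L k U a Z x - volterra_op L k U a Z' x) \<le> M / 2 * exp (c * x)"
      by (rule volterra_op_contraction[OF K L l(2) k \<kappa>(2) eq_refl[OF c_def[symmetric]] c]) (rule h | assumption)+
  next
    fix Z :: "real \<Rightarrow> real^'n" assume h: "continuous_on {a..b} Z" "\<And>x. x \<in> {a..b} \<Longrightarrow> volterra_op L k U a Z x = Z x"
    show thesis by (rule that) (rule h | assumption)+
  qed
  have uniq: "w' t = w t" if w': "continuous_on {a..b} w'" "\<And>t. t \<in> {a..b} \<Longrightarrow> w' t = volterra_op L k U a w' t"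
    and t: "t \<in> {a..b}" for w' t
  proof -
    have "norm (w t - w' t) \<le> 2 * 0 * exp (c * t)"
    proof (rule weighted_contraction_stability[where \<Phi> = "volterra_op L k U a" and K = "{a..b}"
          and \<omega> = "\<lambda>t. exp (c * t)", OF compact_Icc \<omega> _ w(1) _ w'(1) _ t])
      fix Z Z' :: "real \<Rightarrow> real^'n" and M assume h: "continuous_on {a..b} Z" "continuous_on {a..b} Z'" "0 \<le> M"
        "\<And>x. x \<in> {a..b} \<Longrightarrow> norm (Z x - Z' x) \<le> M * exp (c * x)"
      show "\<forall>x\<in>{a..b}. norm (volterra_op L k U a Z x - volterra_op L k U a Z' x) \<le> M / 2 * exp (c * x)"
        by (rule volterra_op_contraction[OF K L l(2) k \<kappa>(2) eq_refl[OF c_def[symmetric]] c]) (rule h | assumption)+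
    next
      fix x assume x: "x \<in> {a..b}"
      show "norm (volterra_op L k U a w' x - w' x) \<le> 0 * exp (c * x)"
        using w'(2)[OF x] by simp
      show "volterra_op L k U a w x = w x" by (rule w(2)[OF x])
    qed
    then show ?thesis by simp
  qed
  show thesis
  proof (rule that[of w])
    show "w t = volterra_op L k U a w t" if "t \<in> {a..b}" for t using w(2)[OF that] by (rule sym)
  next
    fix w' t assume h: "continuous_on {a..b} w'" "\<And>t. t \<in> {a..b} \<Longrightarrow> w' t = volterra_op L k U a w' t" "t \<in> {a..b}"
    show "w' t = w t" by (rule uniq) (rule h | assumption)+
  qed (rule w(1))
qed

lemma inner_transpose: "(transpose X *v x) \<bullet> y = x \<bullet> (X *v y)" for X :: "real^'n^'m"
  by (simp add: transpose_matrix_vector dot_lmul_matrix)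

lemma continuous_on_compose_pair:
  assumes "continuous_on (U \<times> V) (\<lambda>(x, t). f x t)" "continuous_on X g" "continuous_on X h"
    "\<And>p. p \<in> X \<Longrightarrow> g p \<in> U" "\<And>p. p \<in> X \<Longrightarrow> h p \<in> V"
  shows "continuous_on X (\<lambda>p. f (g p) (h p))"
proof -
  have "continuous_on X (\<lambda>p. (\<lambda>(x, t). f x t) (g p, h p))"
    using assms(2-) by (intro continuous_on_compose2[OF assms(1)] continuous_intros) auto
  then show ?thesis by simp
qed

lemma continuous_on_compose_triple:
  assumes "continuous_on (U \<times> V \<times> W) (\<lambda>(x, y, t). f x y t)"
    "continuous_on X g" "continuous_on X h" "continuous_on X k"
    "\<And>p. p \<in> X \<Longrightarrow> g p \<in> U" "\<And>p. p \<in> X \<Longrightarrow> h p \<in> V" "\<And>p. p \<in> X \<Longrightarrow> k p \<in> W"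
  shows "continuous_on X (\<lambda>p. f (g p) (h p) (k p))"
proof -
  have "continuous_on X (\<lambda>p. (\<lambda>(x, y, t). f x y t) (g p, h p, k p))"
    using assms(2-) by (intro continuous_on_compose2[OF assms(1)] continuous_intros) auto
  then show ?thesis by simp
qed

subsection \<open>The state functional\<close>

text \<open>The state at time \<open>t\<close> is a vector measure on \<open>{-1} \<union> {0..T}\<close>: the point \<open>-1\<close> stands for the
  current value \<open>w t\<close> and \<open>{0..T}\<close> for the past, which besides the density \<open>\<xi>\<close> before \<open>\<tau>\<close> and \<open>w\<close>
  after \<open>\<tau>\<close> may carry atoms \<open>b k\<close> at \<open>s k\<close>. The atoms turn bounds of the value function
  into pointwise bounds of its kernel.\<close>

definition past :: "('a \<Rightarrow> 'b \<Rightarrow> 'c::euclidean_space) \<Rightarrow> nat \<Rightarrow> (nat \<Rightarrow> real) \<Rightarrow> (nat \<Rightarrow> 'b) \<Rightarrow>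
    real \<Rightarrow> (real \<Rightarrow> 'b) \<Rightarrow> (real \<Rightarrow> 'a) \<Rightarrow> 'c" where
  "past pr n s b \<tau> \<xi> F = (\<Sum>k<n. pr (F (s k)) (b k)) + integral {0..\<tau>} (\<lambda>r. pr (F r) (\<xi> r))"

definition act :: "('a \<Rightarrow> 'b \<Rightarrow> 'c::euclidean_space) \<Rightarrow> nat \<Rightarrow> (nat \<Rightarrow> real) \<Rightarrow> (nat \<Rightarrow> 'b) \<Rightarrow>
    real \<Rightarrow> (real \<Rightarrow> 'b) \<Rightarrow> (real \<Rightarrow> 'b) \<Rightarrow> real \<Rightarrow> (real \<Rightarrow> 'a) \<Rightarrow> 'c" where
  "act pr n s b \<tau> \<xi> w t F = pr (F (-1)) (w t) + past pr n s b \<tau> \<xi> F + integral {\<tau>..t} (\<lambda>r. pr (F r) (w r))"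

text \<open>Atoms may sit anywhere in \<open>{0..T}\<close>, also after \<tau>, because the kernel
  has to be bounded for all pairs of indices and not only for those below \<tau>.\<close>

locale state =
  fixes T :: real and n :: nat and s :: "nat \<Rightarrow> real" and b :: "nat \<Rightarrow> 'b::euclidean_space"
    and \<tau> :: real and \<xi> w :: "real \<Rightarrow> 'b"
  assumes tau: "0 \<le> \<tau>" "\<tau> \<le> T"
    and s: "\<And>k. k < n \<Longrightarrow> s k \<in> {0..T}"
    and xi: "\<xi> absolutely_integrable_on {0..\<tau>}"
    and w_cont: "continuous_on {\<tau>..T} w"
begin

lemma past_integrable:
  fixes pr :: "'a::euclidean_space \<Rightarrow> 'b \<Rightarrow> 'c::euclidean_space"
  assumes "bounded_bilinear pr" "continuous_on {0..T} F"
  shows "(\<lambda>r. pr (F r) (\<xi> r)) integrable_on {0..\<tau>}"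
  by (rule set_lebesgue_integral_eq_integral(1)[OF absolutely_integrable_bilinear_continuous[OF assms(1) _ xi]])
    (use tau in \<open>auto intro: continuous_on_subset[OF assms(2)]\<close>)

lemma recent_integrable:
  fixes pr :: "'a::euclidean_space \<Rightarrow> 'b \<Rightarrow> 'c::euclidean_space"
  assumes "bounded_bilinear pr" "continuous_on {0..T} F" "t \<le> T"
  shows "(\<lambda>r. pr (F r) (w r)) integrable_on {\<tau>..t}"
  using tau assms by (intro integrable_continuous_real bounded_bilinear.continuous_on[OF assms(1)]
      continuous_on_subset[OF assms(2)] continuous_on_subset[OF w_cont]) auto

lemma act_add:
  fixes pr :: "'a::euclidean_space \<Rightarrow> 'b \<Rightarrow> 'c::euclidean_space"
  assumes pr: "bounded_bilinear pr" and F: "continuous_on {0..T} F" and G: "continuous_on {0..T} G" and t: "t \<le> T"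
  shows "act pr n s b \<tau> \<xi> w t (\<lambda>i. F i + G i) = act pr n s b \<tau> \<xi> w t F + act pr n s b \<tau> \<xi> w t G"
  by (simp add: act_def past_def bounded_bilinear.add_left[OF pr] sum.distrib
      Henstock_Kurzweil_Integration.integral_add past_integrable recent_integrable assms)

text \<open>A linear map leaves the functional, and the pairing may change at the same time. This
  covers multiplication by fixed matrices, signs, the passage from the matrix action to the inner
  product by transposition, and, with \<open>h = 0\<close>, functionals that vanish.\<close>

lemma act_linear:
  fixes pr :: "'a::euclidean_space \<Rightarrow> 'b \<Rightarrow> 'c::euclidean_space"
    and pr' :: "'e \<Rightarrow> 'b \<Rightarrow> 'f::euclidean_space"
  assumes pr: "bounded_bilinear pr" and F: "continuous_on {0..T} F" and t: "t \<le> T"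
    and h: "bounded_linear h" and eq: "\<And>i v. i \<in> insert (-1) {0..T} \<Longrightarrow> pr' (F' i) v = h (pr (F i) v)"
  shows "act pr' n s b \<tau> \<xi> w t F' = h (act pr n s b \<tau> \<xi> w t F)"
proof -
  have "integral {0..\<tau>} (\<lambda>r. pr' (F' r) (\<xi> r)) = integral {0..\<tau>} (h \<circ> (\<lambda>r. pr (F r) (\<xi> r)))"
    using tau eq by (intro integral_cong) auto
  also have "\<dots> = h (integral {0..\<tau>} (\<lambda>r. pr (F r) (\<xi> r)))"
    by (rule integral_linear[OF past_integrable[OF pr F] h])
  finally have 1: "integral {0..\<tau>} (\<lambda>r. pr' (F' r) (\<xi> r)) = h (integral {0..\<tau>} (\<lambda>r. pr (F r) (\<xi> r)))" .
  have "integral {\<tau>..t} (\<lambda>r. pr' (F' r) (w r)) = integral {\<tau>..t} (h \<circ> (\<lambda>r. pr (F r) (w r)))"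
    using tau eq t by (intro integral_cong) auto
  also have "\<dots> = h (integral {\<tau>..t} (\<lambda>r. pr (F r) (w r)))"
    by (rule integral_linear[OF recent_integrable[OF pr F t] h])
  finally have 2: "integral {\<tau>..t} (\<lambda>r. pr' (F' r) (w r)) = h (integral {\<tau>..t} (\<lambda>r. pr (F r) (w r)))" .
  have 3: "(\<Sum>k<n. pr' (F' (s k)) (b k)) = h (\<Sum>k<n. pr (F (s k)) (b k))"
    using s by (simp add: linear_sum[OF bounded_linear.linear[OF h]] eq)
  show ?thesis
    by (simp add: act_def past_def 1 2 3 eq linear_add[OF bounded_linear.linear[OF h]])
qed

lemma past_has_vector_derivative:
  fixes pr :: "'a::euclidean_space \<Rightarrow> 'b \<Rightarrow> 'c::euclidean_space"
  assumes pr: "bounded_bilinear pr"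
    and F: "continuous_on ({0..T} \<times> {\<tau>..T}) (\<lambda>(i, t). F i t)"
    and F': "continuous_on ({0..T} \<times> {\<tau>..T}) (\<lambda>(i, t). F' i t)"
    and deriv: "\<And>i t. i \<in> {0..T} \<Longrightarrow> t \<in> {\<tau>..T} \<Longrightarrow> (F i has_vector_derivative F' i t) (at t within {\<tau>..T})"
    and t: "t \<in> {\<tau>..T}"
  shows "((\<lambda>t. past pr n s b \<tau> \<xi> (\<lambda>i. F i t)) has_vector_derivative past pr n s b \<tau> \<xi> (\<lambda>i. F' i t)) (at t within {\<tau>..T})"
proof -
  have sub: "{0..\<tau>} \<times> {\<tau>..T} \<subseteq> {0..T} \<times> {\<tau>..T}" using tau by auto
  have 1: "((\<lambda>t. integral {0..\<tau>} (\<lambda>r. pr (F r t) (\<xi> r))) has_vector_derivative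
      integral {0..\<tau>} (\<lambda>r. pr (F' r t) (\<xi> r))) (at t within {\<tau>..T})"
    using tau by (intro weighted_integral_has_vector_derivative[OF pr continuous_on_subset[OF F sub]
          continuous_on_subset[OF F' sub] deriv xi t]) auto
  have 2: "((\<lambda>t. pr (F (s k) t) (b k)) has_vector_derivative pr (F' (s k) t) (b k)) (at t within {\<tau>..T})" if "k < n" for k
    using bounded_linear.has_vector_derivative[OF bounded_bilinear.bounded_linear_left[OF pr] deriv[OF s[OF that] t]] .
  show ?thesis
    unfolding past_def using 2 by (intro has_vector_derivative_add has_vector_derivative_sum 1) auto
qed

text \<open>Besides the motion of the current value there is the term
  \<open>pr (F t t) (w t)\<close>: at time \<open>t\<close> the current value is deposited in the
  history at index \<open>t\<close>. This term is the origin of the diagonal values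
  \<open>P1(\<tau>,\<tau>)\<close>, \<open>P2(\<tau>,s,\<tau>)\<close> and
  \<open>d2(\<tau>,\<tau>)\<close> in the equations.\<close>

lemma act_has_vector_derivative:
  fixes pr :: "'a::euclidean_space \<Rightarrow> 'b \<Rightarrow> 'c::euclidean_space"
  assumes pr: "bounded_bilinear pr"
    and F: "continuous_on ({0..T} \<times> {\<tau>..T}) (\<lambda>(i, t). F i t)"
    and F': "continuous_on ({0..T} \<times> {\<tau>..T}) (\<lambda>(i, t). F' i t)"
    and deriv: "\<And>i t. i \<in> insert (-1) {0..T} \<Longrightarrow> t \<in> {\<tau>..T} \<Longrightarrow> (F i has_vector_derivative F' i t) (at t within {\<tau>..T})"
    and w: "(w has_vector_derivative w') (at t within {\<tau>..T})"
    and t: "t \<in> {\<tau>..T}"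
  shows "((\<lambda>t. act pr n s b \<tau> \<xi> w t (\<lambda>i. F i t)) has_vector_derivative
      (pr (F (-1) t) w' + pr (F t t) (w t) + act pr n s b \<tau> \<xi> w t (\<lambda>i. F' i t))) (at t within {\<tau>..T})"
proof -
  have sub: "{\<tau>..T} \<times> {\<tau>..T} \<subseteq> {0..T} \<times> {\<tau>..T}" using tau by auto
  have 1: "((\<lambda>t. pr (F (-1) t) (w t)) has_vector_derivative (pr (F (-1) t) w' + pr (F' (-1) t) (w t))) (at t within {\<tau>..T})"
    using bounded_bilinear.has_vector_derivative[OF pr deriv[of "-1"] w] t by simp
  have 2: "((\<lambda>t. past pr n s b \<tau> \<xi> (\<lambda>i. F i t)) has_vector_derivative past pr n s b \<tau> \<xi> (\<lambda>i. F' i t)) (at t within {\<tau>..T})"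
    by (rule past_has_vector_derivative[OF pr F F' deriv t]) auto
  have 3: "((\<lambda>t. integral {\<tau>..t} (\<lambda>r. pr (F r t) (w r))) has_vector_derivative
     (pr (F t t) (w t) + integral {\<tau>..t} (\<lambda>r. pr (F' r t) (w r)))) (at t within {\<tau>..T})"
    using tau by (intro moving_weighted_integral_has_vector_derivative[OF pr continuous_on_subset[OF F sub]
        continuous_on_subset[OF F' sub] deriv w_cont t]) auto
  show ?thesis
    using has_vector_derivative_add[OF has_vector_derivative_add[OF 1 2] 3]
    by (simp add: act_def algebra_simps)
qed

lemma past_continuous:
  fixes pr :: "'a::euclidean_space \<Rightarrow> 'b \<Rightarrow> 'c::euclidean_space"
  assumes pr: "bounded_bilinear pr"
    and F: "continuous_on ({0..T} \<times> {\<tau>..T}) (\<lambda>(i, t). F i t)"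
  shows "continuous_on {\<tau>..T} (\<lambda>t. past pr n s b \<tau> \<xi> (\<lambda>i. F i t))"
  unfolding past_def
proof (intro continuous_intros)
  have sub: "{0..\<tau>} \<times> {\<tau>..T} \<subseteq> {0..T} \<times> {\<tau>..T}" using tau by auto
  show "continuous_on {\<tau>..T} (\<lambda>t. integral {0..\<tau>} (\<lambda>r. pr (F r t) (\<xi> r)))"
    by (intro weighted_integral_continuous[OF pr compact_Icc continuous_on_subset[OF F sub] xi])
  show "continuous_on {\<tau>..T} (\<lambda>t. pr (F (s k) t) (b k))" if "k \<in> {..<n}" for k
    using s that by (intro bounded_bilinear.continuous_on[OF pr] continuous_intros continuous_on_section2[OF F]) auto
qed

end

subsection \<open>The Riccati equation as one kernel equation\<close>

locale lq =
  fixes T :: real and A :: "real^'d^'d" and B :: "real^'m^'d" and C :: "real^'d^'p"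
    and N :: "real \<Rightarrow> real^'d^'d"
  assumes T_pos: "0 < T" and N_cont: "continuous_on UNIV N"
begin

abbreviation "I \<equiv> insert (-1) {0..T}"

text \<open>The interpolation between the index \<open>-1\<close> and the past \<open>{0..T}\<close> keeps everything
  continuous on the interval \<open>{-1..T}\<close>; only indices in \<open>I\<close> have a meaning.\<close>

definition chi :: "real \<Rightarrow> real" where
  "chi i = max 0 (- i)"

text \<open>The coefficient with which mass at index \<open>i\<close> enters \<open>w' t\<close>, so
  that the state equation says that \<open>w' t\<close> is the action of \<open>G\<close> on the
  state plus \<open>B *v u t\<close>.\<close>

definition G :: "real \<Rightarrow> real \<Rightarrow> real^'d^'d" where
  "G i t = chi i *\<^sub>R A + (1 - chi i) *\<^sub>R N (t - i)"

definition S :: "real^'d^'d" where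
  "S = B ** transpose B"

text \<open>The two \<open>chi\<close> terms with index \<open>t\<close> come from the deposit of
  the current value into the history. The map \<phi> is the identity or a truncation and touches
  only the factors of the quadratic term.\<close>

definition ric :: "(real^'d^'d \<Rightarrow> real^'d^'d) \<Rightarrow> (real \<Rightarrow> real \<Rightarrow> real \<Rightarrow> real^'d^'d)
    \<Rightarrow> real \<Rightarrow> real \<Rightarrow> real \<Rightarrow> real^'d^'d" where
  "ric \<phi> Q i j t = transpose (G i t) ** Q (-1) j t + Q i (-1) t ** G j t
     + chi j *\<^sub>R Q i t t + chi i *\<^sub>R Q t j t
     - \<phi> (Q i (-1) t) ** (S ** \<phi> (Q (-1) j t)) + (chi i * chi j) *\<^sub>R (transpose C ** C)"

text \<open>The differential equation is demanded on \<open>{\<sigma>..T}\<close> only, as this is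
  what is known while the truncation is shown to be inactive step by step backwards from
  \<open>T\<close>. Continuity and symmetry hold on all of \<open>{0..T}\<close> from the
  start.\<close>

definition riccati :: "real \<Rightarrow> (real \<Rightarrow> real \<Rightarrow> real \<Rightarrow> real^'d^'d) \<Rightarrow> bool" where
  "riccati \<sigma> Q \<longleftrightarrow> continuous_on ({-1..T} \<times> {-1..T} \<times> {0..T}) (\<lambda>(i, j, t). Q i j t) \<and>
     (\<forall>i\<in>I. \<forall>j\<in>I. \<forall>t\<in>{\<sigma>..T}. (Q i j has_vector_derivative - ric (\<lambda>X. X) Q i j t) (at t within {\<sigma>..T})) \<and>
     (\<forall>i\<in>I. \<forall>j\<in>I. Q i j T = 0) \<and>
     (\<forall>i\<in>I. \<forall>j\<in>I. \<forall>t\<in>{0..T}. Q j i t = transpose (Q i j t))"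

text \<open>\<open>d (-1)\<close> plays the role of \<open>d1\<close> and \<open>d i\<close> with
  \<open>i \<ge> 0\<close> that of \<open>d2\<close>; \<open>chi\<close> switches on the terms that
  occur in the first equation only.\<close>

definition drhs :: "(real \<Rightarrow> real \<Rightarrow> real \<Rightarrow> real^'d^'d) \<Rightarrow> (real \<Rightarrow> real^'p) \<Rightarrow> (real \<Rightarrow> real \<Rightarrow> real^'d)
    \<Rightarrow> real \<Rightarrow> real \<Rightarrow> real^'d" where
  "drhs Q y d i t = transpose (G i t) *v d (-1) t + chi i *\<^sub>R d t t
     - Q i (-1) t *v (S *v d (-1) t) - chi i *\<^sub>R (transpose C *v y t)"

definition tracking :: "real \<Rightarrow> (real \<Rightarrow> real \<Rightarrow> real \<Rightarrow> real^'d^'d) \<Rightarrow> (real \<Rightarrow> real^'p) \<Rightarrow> (real \<Rightarrow> real \<Rightarrow> real^'d) \<Rightarrow> bool" where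
  "tracking \<sigma> Q y d \<longleftrightarrow> continuous_on ({-1..T} \<times> {0..T}) (\<lambda>(i, t). d i t) \<and>
     (\<forall>i\<in>I. \<forall>t\<in>{\<sigma>..T}. (d i has_vector_derivative - drhs Q y d i t) (at t within {\<sigma>..T})) \<and>
     (\<forall>i\<in>I. d i T = 0)"

lemma chi_simps [simp]: "chi (-1) = 1" "0 \<le> i \<Longrightarrow> chi i = 0"
  by (auto simp: chi_def)

lemma G_simps [simp]: "G (-1) t = A" "0 \<le> i \<Longrightarrow> G i t = N (t - i)"
  by (auto simp: G_def)

lemma chi_cont: "continuous_on X f \<Longrightarrow> continuous_on X (\<lambda>p. chi (f p))"
  unfolding chi_def by (intro continuous_intros)

lemma G_cont: "continuous_on X f \<Longrightarrow> continuous_on X g \<Longrightarrow> continuous_on X (\<lambda>p. G (f p) (g p))"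
  unfolding G_def by (intro continuous_intros chi_cont continuous_on_compose2[OF N_cont]) auto

lemma ric_cont:
  assumes Q: "continuous_on ({-1..T} \<times> {-1..T} \<times> {0..T}) (\<lambda>(i, j, t). Q i j t)"
    and \<phi>: "continuous_on UNIV \<phi>"
    and X: "continuous_on X f" "continuous_on X g" "continuous_on X h"
    and r: "\<And>p. p \<in> X \<Longrightarrow> f p \<in> {-1..T}" "\<And>p. p \<in> X \<Longrightarrow> g p \<in> {-1..T}" "\<And>p. p \<in> X \<Longrightarrow> h p \<in> {0..T}"
  shows "continuous_on X (\<lambda>p. ric \<phi> Q (f p) (g p) (h p))"
proof -
  have m1: "-1 \<in> {-1..T}" using T_pos by auto
  have h1: "\<And>p. p \<in> X \<Longrightarrow> h p \<in> {-1..T}" using r(3) by fastforce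
  note qc = continuous_on_compose_triple[OF Q]
  show ?thesis
    unfolding ric_def
    by (intro continuous_intros chi_cont G_cont X continuous_on_compose2[OF \<phi>] qc r h1 m1 subset_UNIV)
qed

lemma riccati_mono:
  assumes "riccati \<sigma> Q" "\<sigma> \<le> \<sigma>'" shows "riccati \<sigma>' Q"
proof -
  have "{\<sigma>'..T} \<subseteq> {\<sigma>..T}" using assms by auto
  then show ?thesis using assms(1) has_vector_derivative_within_subset
    unfolding riccati_def by (meson subsetD)
qed

lemma tracking_mono:
  assumes "tracking \<sigma> Q y d" "\<sigma> \<le> \<sigma>'" shows "tracking \<sigma>' Q y d"
proof -
  have "{\<sigma>'..T} \<subseteq> {\<sigma>..T}" using assms by auto
  then show ?thesis using assms(1) has_vector_derivative_within_subset
    unfolding tracking_def by (meson subsetD)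
qed

end

section \<open>Completing the square along a trajectory with an arbitrary continuous control\<close>

locale riccati_trajectory = lq T A B C N + state T n s b \<tau> \<xi> w
  for T :: real and A :: "real^'d^'d" and B :: "real^'m^'d" and C :: "real^'d^'p"
    and N :: "real \<Rightarrow> real^'d^'d" and n s and b :: "nat \<Rightarrow> real^'d" and \<tau> \<xi> w +
  fixes u :: "real \<Rightarrow> real^'m" and Q :: "real \<Rightarrow> real \<Rightarrow> real \<Rightarrow> real^'d^'d"
    and y :: "real \<Rightarrow> real^'p" and d :: "real \<Rightarrow> real \<Rightarrow> real^'d"
  assumes u_cont: "continuous_on {\<tau>..T} u"
    and w_deriv: "\<And>t. t \<in> {\<tau>..T} \<Longrightarrow>
      (w has_vector_derivative (act (*v) n s b \<tau> \<xi> w t (\<lambda>i. G i t) + B *v u t)) (at t within {\<tau>..T})"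
    and Q: "riccati \<tau> Q" and d: "tracking \<tau> Q y d"
begin

abbreviation "mact \<equiv> act (*v) n s b \<tau> \<xi> w"
abbreviation "ract \<equiv> act (\<bullet>) n s b \<tau> \<xi> w"

text \<open>Half the gradient of the value function with respect to the mass at index
  \<open>i\<close>, evaluated along the trajectory; \<open>q (-1)\<close> is the costate of the
  control problem.\<close>

definition q :: "real \<Rightarrow> real \<Rightarrow> real^'d" where
  "q i t = mact t (\<lambda>j. Q i j t) + d i t"

lemma Q_cont: "continuous_on ({-1..T} \<times> {-1..T} \<times> {0..T}) (\<lambda>(i, j, t). Q i j t)"
  and Q_deriv: "i \<in> I \<Longrightarrow> j \<in> I \<Longrightarrow> t \<in> {\<tau>..T} \<Longrightarrow> (Q i j has_vector_derivative - ric (\<lambda>X. X) Q i j t) (at t within {\<tau>..T})"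
  and Q_end: "i \<in> I \<Longrightarrow> j \<in> I \<Longrightarrow> Q i j T = 0"
  and Q_sym: "i \<in> I \<Longrightarrow> j \<in> I \<Longrightarrow> t \<in> {0..T} \<Longrightarrow> Q j i t = transpose (Q i j t)"
  using Q unfolding riccati_def by blast+

lemma d_cont: "continuous_on ({-1..T} \<times> {0..T}) (\<lambda>(i, t). d i t)"
  and d_deriv: "i \<in> I \<Longrightarrow> t \<in> {\<tau>..T} \<Longrightarrow> (d i has_vector_derivative - drhs Q y d i t) (at t within {\<tau>..T})"
  and d_end: "i \<in> I \<Longrightarrow> d i T = 0"
  using d unfolding tracking_def by blast+

lemmas Q_comp = continuous_on_compose_triple[OF Q_cont]

lemma ranges: "i \<in> I \<Longrightarrow> i \<in> {-1..T}" "t \<in> {\<tau>..T} \<Longrightarrow> t \<in> {0..T}" "t \<in> {\<tau>..T} \<Longrightarrow> t \<in> I"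
  using tau T_pos by auto

text \<open>\<open>chi\<close> is 1 at the index \<open>-1\<close> and 0 on the past, so only the
  current value is tested.\<close>

lemma w_eq: "mact t (\<lambda>i. chi i *\<^sub>R X) = X *v w t" and w_eq': "ract t (\<lambda>i. chi i *\<^sub>R x) = x \<bullet> w t" if "t \<in> {\<tau>..T}"
proof -
  have 1: "(\<Sum>k<n. (chi (s k) *\<^sub>R X) *v b k) = 0" "(\<Sum>k<n. (chi (s k) *\<^sub>R x) \<bullet> b k) = 0"
    using s by (auto intro!: sum.neutral)
  have 2: "integral {0..\<tau>} (\<lambda>i. (chi i *\<^sub>R X) *v \<xi> i) = integral {0..\<tau>} (\<lambda>_. 0)"
    "integral {0..\<tau>} (\<lambda>i. (chi i *\<^sub>R x) \<bullet> \<xi> i) = integral {0..\<tau>} (\<lambda>_. 0)"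
    "integral {\<tau>..t} (\<lambda>i. (chi i *\<^sub>R X) *v w i) = integral {\<tau>..t} (\<lambda>_. 0)"
    "integral {\<tau>..t} (\<lambda>i. (chi i *\<^sub>R x) \<bullet> w i) = integral {\<tau>..t} (\<lambda>_. 0)"
    using tau by (intro integral_cong; simp)+
  show "mact t (\<lambda>i. chi i *\<^sub>R X) = X *v w t" "ract t (\<lambda>i. chi i *\<^sub>R x) = x \<bullet> w t"
    unfolding act_def past_def 1 2 by simp_all
qed

lemma mact_ric:
  assumes i: "i \<in> I" and t: "t \<in> {\<tau>..T}"
  shows "mact t (\<lambda>j. - ric (\<lambda>X. X) Q i j t) =
    - (transpose (G i t) *v mact t (\<lambda>j. Q (-1) j t) + Q i (-1) t *v mact t (\<lambda>j. G j t)
      + Q i t t *v w t + chi i *\<^sub>R mact t (\<lambda>j. Q t j t)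
      - Q i (-1) t *v (S *v mact t (\<lambda>j. Q (-1) j t)) + chi i *\<^sub>R (transpose C *v (C *v w t)))"
proof -
  note [continuous_intros] = Q_comp chi_cont G_cont
  have t': "t \<le> T" "t \<in> {0..T}" "t \<in> {-1..T}" using t tau by auto
  have i': "i \<in> {-1..T}" "-1 \<in> {-1..T}" using i T_pos by auto
  have cQ: "continuous_on {0..T} (\<lambda>j. Q i' j t)" if "i' \<in> {-1..T}" for i'
    using that t' by (intro continuous_intros) auto
  have cG: "continuous_on {0..T} (\<lambda>j. G j t)" by (intro continuous_intros)
  have cc: "continuous_on {0..T} (\<lambda>j. chi j *\<^sub>R X)" for X :: "real^'d^'d" by (intro continuous_intros)
  note lin = act_linear[OF bounded_bilinear_matrix_vector _ t'(1)]
  let ?T1 = "\<lambda>j. transpose (G i t) ** Q (-1) j t" let ?T2 = "\<lambda>j. Q i (-1) t ** G j t"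
  let ?T3 = "\<lambda>j. chi j *\<^sub>R Q i t t" let ?T4 = "\<lambda>j. chi i *\<^sub>R Q t j t"
  let ?T5 = "\<lambda>j. - (Q i (-1) t ** (S ** Q (-1) j t))" let ?T6 = "\<lambda>j. chi j *\<^sub>R (chi i *\<^sub>R (transpose C ** C))"
  have c1: "continuous_on {0..T} ?T1" and c4: "continuous_on {0..T} ?T4" and c5: "continuous_on {0..T} ?T5"
    and c2: "continuous_on {0..T} ?T2"
    using cQ[OF i'(1)] cQ[OF i'(2)] cQ[OF t'(3)] cG by (auto intro!: continuous_intros)
  have 1: "mact t ?T1 = transpose (G i t) *v mact t (\<lambda>j. Q (-1) j t)"
    by (rule lin[OF cQ[OF i'(2)]]) (auto simp: matrix_vector_mul_assoc)
  have 2: "mact t ?T2 = Q i (-1) t *v mact t (\<lambda>j. G j t)"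
    by (rule lin[OF cG]) (auto simp: matrix_vector_mul_assoc)
  have 4: "mact t ?T4 = chi i *\<^sub>R mact t (\<lambda>j. Q t j t)"
    by (rule lin[OF cQ[OF t'(3)]]) (auto simp: scaleR_matrix_vector_assoc bounded_linear_scaleR_right)
  have 5: "mact t ?T5 = - (Q i (-1) t *v (S *v mact t (\<lambda>j. Q (-1) j t)))"
  proof (rule lin[OF cQ[OF i'(2)]])
    show "bounded_linear (\<lambda>x. - (Q i (-1) t *v (S *v x)))"
      by (intro bounded_linear_minus bounded_linear_compose[OF matrix_vector_mul_bounded_linear matrix_vector_mul_bounded_linear])
    show "- (Q i (-1) t ** (S ** Q (-1) j t)) *v v = - (Q i (-1) t *v (S *v (Q (-1) j t *v v)))" for j v
      using bounded_bilinear.minus_left[OF bounded_bilinear_matrix_vector, of "Q i (-1) t ** (S ** Q (-1) j t)" v]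
      by (simp add: matrix_vector_mul_assoc matrix_mul_assoc)
  qed
  have 7: "mact t (\<lambda>j. - F j) = - mact t F" if "continuous_on {0..T} F" for F
    by (rule lin[OF that]) (auto intro: bounded_linear_minus bounded_linear_ident
        simp: bounded_bilinear.minus_left[OF bounded_bilinear_matrix_vector])
  have eq: "(\<lambda>j. ric (\<lambda>X. X) Q i j t) = (\<lambda>j. ?T1 j + ?T2 j + ?T3 j + ?T4 j + ?T5 j + ?T6 j)"
    by (auto simp: ric_def mult.commute)
  have "mact t (\<lambda>j. ric (\<lambda>X. X) Q i j t) = mact t ?T1 + mact t ?T2 + mact t ?T3 + mact t ?T4 + mact t ?T5
      + (chi i *\<^sub>R (transpose C ** C)) *v w t"
    unfolding eq
    by (simp only: w_eq[OF t] act_add[OF bounded_bilinear_matrix_vector _ _ t'(1)] c1 c2 c4 c5 cc continuous_on_add)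
  moreover have "continuous_on {0..T} (\<lambda>j. ric (\<lambda>X. X) Q i j t)"
    unfolding eq by (intro continuous_on_add c1 c2 c4 c5 cc)
  ultimately show ?thesis
    by (simp add: 7 1 2 4 5 w_eq[OF t] scaleR_matrix_vector_assoc[symmetric] matrix_vector_mul_assoc)
qed

lemma q_end: "i \<in> I \<Longrightarrow> q i T = 0"
proof -
  assume i: "i \<in> I"
  have "mact T (\<lambda>j. Q i j T) = 0"
  proof -
    have "mact T (\<lambda>j. Q i j T) = (\<lambda>_. 0) (mact T (\<lambda>j. 0 :: real^'d^'d))"
      by (rule act_linear[OF bounded_bilinear_matrix_vector]) (use i Q_end in auto)
    then show ?thesis by simp
  qed
  then show "q i T = 0" using i d_end by (simp add: q_def)
qed

text \<open>The terms with \<open>G\<close> and with \<open>Q i t t\<close> produced by the moving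
  state cancel against those of the Riccati equation. The quadratic term joins the control into the
  defect \<open>u t + transpose B *v q (-1) t\<close>. Where the defect vanishes, \<open>q\<close>
  solves the linear adjoint equation.\<close>

lemma q_deriv:
  assumes i: "i \<in> I" and t: "t \<in> {\<tau>..T}"
  shows "(q i has_vector_derivative - (transpose (G i t) *v q (-1) t) - chi i *\<^sub>R q t t
     + Q i (-1) t *v (B *v (u t + transpose B *v q (-1) t)) - chi i *\<^sub>R (transpose C *v (C *v w t - y t)))
     (at t within {\<tau>..T})"
proof -
  have i1: "i \<in> {-1..T}" using i ranges by auto
  have "((\<lambda>t. mact t (\<lambda>j. Q i j t)) has_vector_derivative
      (Q i (-1) t *v (mact t (\<lambda>i. G i t) + B *v u t) + Q i t t *v w t + mact t (\<lambda>j. - ric (\<lambda>X. X) Q i j t)))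
      (at t within {\<tau>..T})"
  proof (rule act_has_vector_derivative[OF bounded_bilinear_matrix_vector])
    show "continuous_on ({0..T} \<times> {\<tau>..T}) (\<lambda>(j, t). Q i j t)"
      unfolding case_prod_unfold using tau i1 by (intro Q_comp continuous_intros) auto
    show "continuous_on ({0..T} \<times> {\<tau>..T}) (\<lambda>(j, t). - ric (\<lambda>X. X) Q i j t)"
      unfolding case_prod_unfold using tau i1 by (intro ric_cont[OF Q_cont] continuous_intros) auto
  qed (use Q_deriv[OF i] w_deriv[OF t] t in auto)
  from has_vector_derivative_add[OF this d_deriv[OF i t]]
  have "(q i has_vector_derivative Q i (-1) t *v (mact t (\<lambda>i. G i t) + B *v u t) + Q i t t *v w t
      + mact t (\<lambda>j. - ric (\<lambda>X. X) Q i j t) - drhs Q y d i t) (at t within {\<tau>..T})"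
    unfolding q_def by simp
  then show ?thesis
  proof (rule has_vector_derivative_eq_rhs)
    have [simp]: "mact t (\<lambda>j. Q (-1) j t) = q (-1) t - d (-1) t" "mact t (\<lambda>j. Q t j t) = q t t - d t t"
      by (simp_all add: q_def)
    show "Q i (-1) t *v (mact t (\<lambda>i. G i t) + B *v u t) + Q i t t *v w t
      + mact t (\<lambda>j. - ric (\<lambda>X. X) Q i j t) - drhs Q y d i t =
      - (transpose (G i t) *v q (-1) t) - chi i *\<^sub>R q t t
     + Q i (-1) t *v (B *v (u t + transpose B *v q (-1) t)) - chi i *\<^sub>R (transpose C *v (C *v w t - y t))"
      unfolding mact_ric[OF i t] drhs_def S_def
      by (simp add: matrix_vector_right_distrib matrix_vector_mult_diff_distrib
          matrix_vector_mul_assoc[symmetric] scaleR_diff_right scaleR_add_right del: diff_diff_eq)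
  qed
qed

lemma q_cont: "continuous_on {\<tau>..T} (q (-1))"
  and q_cont2: "continuous_on ({0..T} \<times> {\<tau>..T}) (\<lambda>(i, t). q i t)"
proof -
  show q1: "continuous_on {\<tau>..T} (q (-1))"
    using q_deriv[of "-1"] by (meson has_vector_derivative_continuous continuous_on_eq_continuous_within insertI1)
  \<comment> \<open>For \<open>i \<ge> 0\<close> the derivative of \<open>q i\<close> involves only
    \<open>q (-1)\<close>, whose continuity is already known. Joint continuity then follows by
    integrating back from the terminal value 0.\<close>
  define f where "f i t = - (transpose (N (t - i)) *v q (-1) t) + Q i (-1) t *v (B *v (u t + transpose B *v q (-1) t))" for i t
  have f: "continuous_on ({0..T} \<times> {\<tau>..T}) (\<lambda>(i, t). f i t)"
    unfolding f_def case_prod_unfold using tau T_pos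
    by (intro continuous_intros Q_comp continuous_on_compose2[OF N_cont] continuous_on_compose2[OF q1]
        continuous_on_compose2[OF u_cont]) auto
  have "q i t = - integral {t..T} (f i)" if i: "i \<in> {0..T}" and t: "t \<in> {\<tau>..T}" for i t
  proof -
    have "(f i has_integral (q i T - q i t)) {t..T}"
    proof (rule fundamental_theorem_of_calculus)
      show "(q i has_vector_derivative f i x) (at x within {t..T})" if x: "x \<in> {t..T}" for x
      proof (rule has_vector_derivative_within_subset)
        show "(q i has_vector_derivative f i x) (at x within {\<tau>..T})"
          using q_deriv[of i x] i t x by (simp add: f_def)
      qed (use t in auto)
    qed (use t in auto)
    then show ?thesis using q_end[of i] i by (auto dest: integral_unique)
  qed
  then have eq: "- integral {snd p..T} (f (fst p)) = q (fst p) (snd p)" if "p \<in> {0..T} \<times> {\<tau>..T}" for p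
    using that by (metis mem_Sigma_iff prod.collapse)
  have "continuous_on ({0..T} \<times> {\<tau>..T}) (\<lambda>p. - integral {snd p..T} (f (fst p)))"
    using continuous_on_integral_lower[OF f] by (intro continuous_intros) (simp add: case_prod_unfold)
  then show "continuous_on ({0..T} \<times> {\<tau>..T}) (\<lambda>(i, t). q i t)"
    unfolding case_prod_unfold by (rule continuous_on_eq) (rule eq)
qed

text \<open>With X the state, \<open>q\<close> represents QX + d. Pairing X with
  \<open>q + d\<close> therefore yields the quadratic part plus twice the linear part.\<close>

definition V :: "(real \<Rightarrow> real) \<Rightarrow> real \<Rightarrow> real" where
  "V M t = ract t (\<lambda>i. q i t + d i t) + M t"

text \<open>\<open>E = q + d\<close> obeys an equation of the same shape as \<open>q\<close>. Its
  \<open>G\<close> terms and its diagonal term \<open>E t t\<close> cancel against the motion of the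
  state, and the symmetry of \<open>Q\<close> lets the remaining action of \<open>Q\<close> be
  expressed by \<open>q (-1) - d (-1)\<close>. What is left involves the control and the observation
  alone.\<close>

lemma V_deriv:
  assumes t: "t \<in> {\<tau>..T}"
    and M: "(M has_vector_derivative (norm (transpose B *v d (-1) t))\<^sup>2 - (norm (y t))\<^sup>2) (at t within {\<tau>..T})"
  shows "(V M has_vector_derivative (norm (u t + transpose B *v q (-1) t))\<^sup>2 - (norm (u t))\<^sup>2
     - (norm (C *v w t - y t))\<^sup>2) (at t within {\<tau>..T})"
proof -
  note [continuous_intros] = Q_comp chi_cont G_cont
  define E where "E i t = q i t + d i t" for i t
  define v where "v t = B *v (u t + transpose B *v E (-1) t)" for t
  define z where "z t = transpose C *v (C *v w t - y t) - transpose C *v y t" for t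
  define E' where "E' i t = - (transpose (G i t) *v E (-1) t) - chi i *\<^sub>R E t t + Q i (-1) t *v v t - chi i *\<^sub>R z t" for i t
  have E: "(E i has_vector_derivative E' i t) (at t within {\<tau>..T})" if "i \<in> I" "t \<in> {\<tau>..T}" for i t
    unfolding E_def[abs_def]
    by (rule has_vector_derivative_eq_rhs[OF has_vector_derivative_add[OF q_deriv[OF that] d_deriv[OF that]]])
      (simp add: E'_def E_def v_def z_def drhs_def S_def matrix_vector_right_distrib matrix_vector_mult_diff_distrib
          matrix_vector_mul_assoc[symmetric] scaleR_diff_right scaleR_add_right)
  have sub: "{0..T} \<times> {\<tau>..T} \<subseteq> {-1..T} \<times> {0..T}" using tau by auto
  have E1: "continuous_on {\<tau>..T} (E (-1))"
    using E[of "-1"] by (meson has_vector_derivative_continuous continuous_on_eq_continuous_within insertI1)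
  have E2: "continuous_on ({0..T} \<times> {\<tau>..T}) (\<lambda>(i, t). E i t)"
    using continuous_on_add[OF q_cont2 continuous_on_subset[OF d_cont sub]]
    by (simp add: E_def case_prod_unfold)
  have v1: "continuous_on {\<tau>..T} v"
    unfolding v_def by (intro continuous_intros u_cont E1)
  have "continuous_on ({0..T} \<times> {\<tau>..T}) (\<lambda>p. - (transpose (G (fst p) (snd p)) *v E (-1) (snd p)) + Q (fst p) (-1) (snd p) *v v (snd p))"
    using tau T_pos by (intro continuous_intros continuous_on_compose2[OF E1] continuous_on_compose2[OF v1]) auto
  then have E2': "continuous_on ({0..T} \<times> {\<tau>..T}) (\<lambda>(i, t). E' i t)"
    unfolding case_prod_unfold by (rule continuous_on_eq) (auto simp: E'_def)
  have t': "t \<le> T" "t \<in> {0..T}" "t \<in> {-1..T}" "t \<in> I" using t tau by auto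
  have cG: "continuous_on {0..T} (\<lambda>j. G j t)" by (intro continuous_intros)
  have cQ: "continuous_on {0..T} (\<lambda>j. Q (-1) j t)"
    using t' T_pos by (intro continuous_intros) auto
  have cQ': "continuous_on {0..T} (\<lambda>j. Q j (-1) t *v x)" for x
    using t' T_pos by (intro continuous_intros) auto
  have cG': "continuous_on {0..T} (\<lambda>j. transpose (G j t) *v x)" for x by (intro continuous_intros)
  have cc: "continuous_on {0..T} (\<lambda>j. chi j *\<^sub>R x)" for x :: "real^'d" by (intro continuous_intros)
  have 1: "ract t (\<lambda>i. - (transpose (G i t) *v E (-1) t)) = - (E (-1) t \<bullet> mact t (\<lambda>i. G i t))"
    by (rule act_linear[OF bounded_bilinear_matrix_vector cG t'(1)])
      (auto simp: inner_transpose intro!: bounded_linear_minus bounded_linear_inner_right)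
  have 2: "ract t (\<lambda>i. Q i (-1) t *v v t) = v t \<bullet> mact t (\<lambda>i. Q (-1) i t)"
  proof (rule act_linear[OF bounded_bilinear_matrix_vector cQ t'(1) bounded_linear_inner_right])
    show "(Q i (-1) t *v v t) \<bullet> x = v t \<bullet> (Q (-1) i t *v x)" if "i \<in> I" for i x
      using Q_sym[OF _ that t'(2), of "-1"] by (simp add: inner_transpose)
  qed
  have 3: "mact t (\<lambda>i. Q (-1) i t) = q (-1) t - d (-1) t" by (simp add: q_def)
  have "(\<lambda>i. E' i t) = (\<lambda>i. - (transpose (G i t) *v E (-1) t) + Q i (-1) t *v v t + chi i *\<^sub>R (- E t t) + chi i *\<^sub>R (- z t))"
    by (auto simp: E'_def)
  then have 4: "ract t (\<lambda>i. E' i t) = - (E (-1) t \<bullet> mact t (\<lambda>i. G i t)) + v t \<bullet> (q (-1) t - d (-1) t) - E t t \<bullet> w t - z t \<bullet> w t"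
    using cQ' cG' cc
    by (simp only: act_add[OF bounded_bilinear_inner _ _ t'(1)] continuous_on_add continuous_on_minus 1 2 3 w_eq'[OF t])
      simp
  have "((\<lambda>t. ract t (\<lambda>i. E i t)) has_vector_derivative
    (E (-1) t \<bullet> (mact t (\<lambda>i. G i t) + B *v u t) + E t t \<bullet> w t + ract t (\<lambda>i. E' i t))) (at t within {\<tau>..T})"
    by (rule act_has_vector_derivative[OF bounded_bilinear_inner E2 E2' E w_deriv[OF t] t])
  from has_vector_derivative_add[OF this M]
  have "(V M has_vector_derivative E (-1) t \<bullet> (mact t (\<lambda>i. G i t) + B *v u t) + E t t \<bullet> w t + ract t (\<lambda>i. E' i t)
     + ((norm (transpose B *v d (-1) t))\<^sup>2 - (norm (y t))\<^sup>2)) (at t within {\<tau>..T})"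
    by (simp add: V_def[abs_def] E_def)
  then show ?thesis
  proof (rule has_vector_derivative_eq_rhs)
    \<comment> \<open>The gradient sum contributes \<beta> + \<delta> and the quadratic part \<beta>
      - \<delta>. The derivative of \<open>M\<close> supplies the squares of \<delta> and
      \<open>y t\<close> which turn the rest into complete squares.\<close>
    define \<beta> \<delta> c where "\<beta> = transpose B *v q (-1) t" and "\<delta> = transpose B *v d (-1) t" and "c = C *v w t"
    have a1: "E (-1) t \<bullet> (B *v u t) = (\<beta> + \<delta>) \<bullet> u t"
      by (simp add: E_def \<beta>_def \<delta>_def inner_transpose[symmetric] matrix_vector_right_distrib)
    have a2: "v t \<bullet> x = (u t + \<beta> + \<delta>) \<bullet> (transpose B *v x)" for x
      by (simp add: v_def E_def \<beta>_def \<delta>_def matrix_vector_right_distrib inner_commute[of _ x] inner_transpose[symmetric])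
        (simp add: inner_commute add.assoc)
    have a3: "transpose B *v (q (-1) t - d (-1) t) = \<beta> - \<delta>"
      by (simp add: \<beta>_def \<delta>_def matrix_vector_mult_diff_distrib)
    have a4: "z t \<bullet> w t = (c - y t) \<bullet> c - y t \<bullet> c"
      by (simp add: z_def c_def inner_transpose inner_diff_left)
    have "E (-1) t \<bullet> (mact t (\<lambda>i. G i t) + B *v u t) + E t t \<bullet> w t + ract t (\<lambda>i. E' i t)
       + ((norm \<delta>)\<^sup>2 - (norm (y t))\<^sup>2)
       = (\<beta> + \<delta>) \<bullet> u t + (u t + \<beta> + \<delta>) \<bullet> (\<beta> - \<delta>) - ((c - y t) \<bullet> c - y t \<bullet> c) + ((norm \<delta>)\<^sup>2 - (norm (y t))\<^sup>2)"
      unfolding 4 by (simp add: inner_add_right a1 a2 a3 a4)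
    also have "\<dots> = (norm (u t + \<beta>))\<^sup>2 - (norm (u t))\<^sup>2 - (norm (c - y t))\<^sup>2"
      by (simp add: power2_norm_eq_inner inner_add_left inner_add_right inner_diff_left inner_diff_right inner_commute)
    finally show "E (-1) t \<bullet> (mact t (\<lambda>i. G i t) + B *v u t) + E t t \<bullet> w t + ract t (\<lambda>i. E' i t)
       + ((norm (transpose B *v d (-1) t))\<^sup>2 - (norm (y t))\<^sup>2) = (norm (u t + transpose B *v q (-1) t))\<^sup>2
       - (norm (u t))\<^sup>2 - (norm (C *v w t - y t))\<^sup>2"
      by (simp add: \<beta>_def \<delta>_def c_def)
  qed
qed

text \<open>Cost equals value plus the integral of the squared defect. The zero control thus bounds
  the value from above, while along the feedback the defect vanishes and the value is itself a cost,
  hence nonnegative.\<close>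

theorem verification:
  assumes M: "\<And>t. t \<in> {\<tau>..T} \<Longrightarrow>
      (M has_vector_derivative (norm (transpose B *v d (-1) t))\<^sup>2 - (norm (y t))\<^sup>2) (at t within {\<tau>..T})"
    and M_end: "M T = 0"
  shows "((\<lambda>t. (norm (C *v w t - y t))\<^sup>2 + (norm (u t))\<^sup>2 - (norm (u t + transpose B *v q (-1) t))\<^sup>2)
    has_integral V M \<tau>) {\<tau>..T}"
proof -
  have 1: "((\<lambda>t. (norm (u t + transpose B *v q (-1) t))\<^sup>2 - (norm (u t))\<^sup>2 - (norm (C *v w t - y t))\<^sup>2)
     has_integral (V M T - V M \<tau>)) {\<tau>..T}"
    using tau by (intro fundamental_theorem_of_calculus V_deriv M)
  have "ract T (\<lambda>i. q i T + d i T) = (\<lambda>_. 0) (ract T (\<lambda>i. 0 :: real^'d))"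
    by (rule act_linear[OF bounded_bilinear_inner]) (use q_end d_end in auto)
  then have "V M T = 0" by (simp add: V_def M_end)
  then show ?thesis using has_integral_neg[OF 1] by (simp add: algebra_simps)
qed

end

subsection \<open>Backward equations with a Lipschitz right-hand side\<close>

text \<open>The Lipschitz hypothesis compares whole slices at time \<open>t\<close>, so
  \<open>F\<close> may couple different parameters \<open>x\<close>, as the diagonal terms of the
  Riccati equation do. The rate \<open>2 * L + 1\<close> makes \<open>L / (2 * L + 1)\<close> at
  most 1/2, and stays positive for \<open>L = 0\<close>.\<close>

lemma backward_contraction:
  fixes F :: "('a::metric_space \<Rightarrow> real \<Rightarrow> 'b::euclidean_space) \<Rightarrow> 'a \<Rightarrow> real \<Rightarrow> 'b"
  assumes L: "0 \<le> L"
    and cont: "\<And>Z. continuous_on (P \<times> {0..T}) (\<lambda>(x, t). Z x t) \<Longrightarrow> continuous_on (P \<times> {0..T}) (\<lambda>(x, t). F Z x t)"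
    and lip: "\<And>Z Z' t e x. \<lbrakk>t \<in> {0..T}; 0 \<le> e; \<And>x. x \<in> P \<Longrightarrow> norm (Z x t - Z' x t) \<le> e; x \<in> P\<rbrakk>
        \<Longrightarrow> norm (F Z x t - F Z' x t) \<le> L * e"
    and z: "continuous_on (P \<times> {0..T}) z" "continuous_on (P \<times> {0..T}) z'" "0 \<le> M"
    and le: "\<And>p. p \<in> P \<times> {0..T} \<Longrightarrow> norm (z p - z' p) \<le> M * exp ((2 * L + 1) * (T - snd p))"
  shows "\<forall>p\<in>P \<times> {0..T}. norm (integral {snd p..T} (F (curry z) (fst p)) - integral {snd p..T} (F (curry z') (fst p)))
     \<le> M / 2 * exp ((2 * L + 1) * (T - snd p))"
proof
  fix p assume "p \<in> P \<times> {0..T}"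
  then obtain x t where p: "p = (x, t)" "x \<in> P" "t \<in> {0..T}" by auto
  have c: "continuous_on {0..T} (F (curry z) x)" if "continuous_on (P \<times> {0..T}) z" for z
    by (rule continuous_on_section2[OF cont p(2)]) (use that in \<open>simp add: case_prod_unfold\<close>)
  have int: "F (curry z) x integrable_on {t..T}" if "continuous_on (P \<times> {0..T}) z" for z
    using p(3) by (intro integrable_continuous_real continuous_on_subset[OF c[OF that]]) auto
  have "integral {t..T} (F (curry z) x) - integral {t..T} (F (curry z') x)
     = integral {t..T} (\<lambda>r. F (curry z) x r - F (curry z') x r)"
    by (rule Henstock_Kurzweil_Integration.integral_diff[symmetric]) (intro int z)+
  also have "norm \<dots> \<le> L * M / (2 * L + 1) * exp ((2 * L + 1) * (T - t))"
  proof (rule norm_integral_exp_le')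
    fix r assume r: "r \<in> {t..T}"
    then have r': "r \<in> {0..T}" using p by auto
    have "norm (F (curry z) x r - F (curry z') x r) \<le> L * (M * exp ((2 * L + 1) * (T - r)))"
    proof (rule lip[OF r' _ _ p(2)])
      show "norm (curry z x r - curry z' x r) \<le> M * exp ((2 * L + 1) * (T - r))" if "x \<in> P" for x
        using le[of "(x, r)"] that r' by simp
    qed (use z in auto)
    then show "norm (F (curry z) x r - F (curry z') x r) \<le> L * M * exp ((2 * L + 1) * (T - r))" by (simp add: mult_ac)
  qed (use p L z(3) in \<open>auto intro!: integrable_diff int z\<close>)
  also have "\<dots> \<le> M / 2 * exp ((2 * L + 1) * (T - t))"
    using L z(3) by (intro mult_right_mono) (auto simp: field_simps)
  finally show "norm (integral {snd p..T} (F (curry z) (fst p)) - integral {snd p..T} (F (curry z') (fst p)))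
     \<le> M / 2 * exp ((2 * L + 1) * (T - snd p))" by (simp add: p)
qed

lemma backward_fixpoint:
  fixes F :: "('a::metric_space \<Rightarrow> real \<Rightarrow> 'b::euclidean_space) \<Rightarrow> 'a \<Rightarrow> real \<Rightarrow> 'b"
  assumes P: "compact P" and L: "0 \<le> L"
    and cont: "\<And>Z. continuous_on (P \<times> {0..T}) (\<lambda>(x, t). Z x t) \<Longrightarrow> continuous_on (P \<times> {0..T}) (\<lambda>(x, t). F Z x t)"
    and lip: "\<And>Z Z' t e x. \<lbrakk>t \<in> {0..T}; 0 \<le> e; \<And>x. x \<in> P \<Longrightarrow> norm (Z x t - Z' x t) \<le> e; x \<in> P\<rbrakk>
        \<Longrightarrow> norm (F Z x t - F Z' x t) \<le> L * e"
  shows "\<exists>Z. continuous_on (P \<times> {0..T}) (\<lambda>(x, t). Z x t) \<and> (\<forall>x\<in>P. \<forall>t\<in>{0..T}. integral {t..T} (F Z x) = Z x t)"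
proof -
  define \<Phi> where "\<Phi> z p = integral {snd p..T} (F (curry z) (fst p))" for z p
  obtain z where z: "continuous_on (P \<times> {0..T}) z" "\<And>p. p \<in> P \<times> {0..T} \<Longrightarrow> \<Phi> z p = z p"
  proof (rule weighted_contraction_fixpoint[where \<Phi> = \<Phi> and K = "P \<times> {0..T}" and \<omega> = "\<lambda>p. exp ((2 * L + 1) * (T - snd p))"])
    show "compact (P \<times> {0..T})" by (intro compact_Times P compact_Icc)
    show "continuous_on (P \<times> {0..T}) (\<Phi> z)" if "continuous_on (P \<times> {0..T}) z" for z :: "'a \<times> real \<Rightarrow> 'b"
      using continuous_on_integral_lower[OF cont[of "curry z"]] that by (simp add: case_prod_unfold \<Phi>_def[abs_def])
    fix z z' :: "'a \<times> real \<Rightarrow> 'b" and M assume h: "continuous_on (P \<times> {0..T}) z" "continuous_on (P \<times> {0..T}) z'" "0 \<le> M"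
      "\<And>p. p \<in> P \<times> {0..T} \<Longrightarrow> norm (z p - z' p) \<le> M * exp ((2 * L + 1) * (T - snd p))"
    show "\<forall>p\<in>P \<times> {0..T}. norm (\<Phi> z p - \<Phi> z' p) \<le> M / 2 * exp ((2 * L + 1) * (T - snd p))"
      unfolding \<Phi>_def by (rule backward_contraction[OF L cont lip]) (rule h | assumption)+
  qed (use that in \<open>auto intro!: continuous_intros\<close>)
  show ?thesis
  proof (intro exI[of _ "curry z"] conjI ballI)
    show "continuous_on (P \<times> {0..T}) (\<lambda>(x, t). curry z x t)" using z(1) by (simp add: case_prod_unfold)
    show "integral {t..T} (F (curry z) x) = curry z x t" if "x \<in> P" "t \<in> {0..T}" for x t
      using z(2)[of "(x, t)"] that by (simp add: \<Phi>_def)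
  qed
qed

lemma backward_unique:
  fixes F :: "('a::metric_space \<Rightarrow> real \<Rightarrow> 'b::euclidean_space) \<Rightarrow> 'a \<Rightarrow> real \<Rightarrow> 'b"
  assumes P: "compact P" and L: "0 \<le> L"
    and cont: "\<And>Z. continuous_on (P \<times> {0..T}) (\<lambda>(x, t). Z x t) \<Longrightarrow> continuous_on (P \<times> {0..T}) (\<lambda>(x, t). F Z x t)"
    and lip: "\<And>Z Z' t e x. \<lbrakk>t \<in> {0..T}; 0 \<le> e; \<And>x. x \<in> P \<Longrightarrow> norm (Z x t - Z' x t) \<le> e; x \<in> P\<rbrakk>
        \<Longrightarrow> norm (F Z x t - F Z' x t) \<le> L * e"
    and Z: "continuous_on (P \<times> {0..T}) (\<lambda>(x, t). Z x t)"
      "\<And>x t. x \<in> P \<Longrightarrow> t \<in> {0..T} \<Longrightarrow> integral {t..T} (F Z x) = Z x t"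
    and Y: "continuous_on (P \<times> {0..T}) (\<lambda>(x, t). Y x t)"
      "\<And>x t. x \<in> P \<Longrightarrow> t \<in> {0..T} \<Longrightarrow> integral {t..T} (F Y x) = Y x t"
    and xt: "x \<in> P" "t \<in> {0..T}"
  shows "Z x t = Y x t"
proof -
  define \<Phi> where "\<Phi> z p = integral {snd p..T} (F (curry z) (fst p))" for z p
  have "norm (case_prod Z (x, t) - case_prod Y (x, t)) \<le> 2 * 0 * exp ((2 * L + 1) * (T - snd (x, t)))"
  proof (rule weighted_contraction_stability[where \<Phi> = \<Phi> and K = "P \<times> {0..T}" and \<omega> = "\<lambda>p. exp ((2 * L + 1) * (T - snd p))",
        OF _ _ _ _ Z(1) _ Y(1)])
    show "compact (P \<times> {0..T})" by (intro compact_Times P compact_Icc)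
    fix z z' :: "'a \<times> real \<Rightarrow> 'b" and M assume h: "continuous_on (P \<times> {0..T}) z" "continuous_on (P \<times> {0..T}) z'" "0 \<le> M"
      "\<And>p. p \<in> P \<times> {0..T} \<Longrightarrow> norm (z p - z' p) \<le> M * exp ((2 * L + 1) * (T - snd p))"
    show "\<forall>p\<in>P \<times> {0..T}. norm (\<Phi> z p - \<Phi> z' p) \<le> M / 2 * exp ((2 * L + 1) * (T - snd p))"
      unfolding \<Phi>_def by (rule backward_contraction[OF L cont lip]) (rule h | assumption)+
  qed (use Z(2) Y(2) xt in \<open>auto simp: \<Phi>_def intro!: continuous_intros\<close>)
  then show ?thesis by simp
qed

lemma backward_has_vector_derivative:
  fixes f :: "real \<Rightarrow> 'b::euclidean_space"
  assumes "continuous_on {a..T} f" "\<And>t. t \<in> {a..T} \<Longrightarrow> integral {t..T} f = z t" "t \<in> {a..T}"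
  shows "(z has_vector_derivative - f t) (at t within {a..T})"
  by (rule has_vector_derivative_transform[OF assms(3) assms(2)[symmetric]
        integral_lower_has_vector_derivative[OF assms(1,3)]])

subsection \<open>Entrywise truncation\<close>

text \<open>Clipping each entry is nonexpansive and commutes with transposition, both visible entry
  by entry. The first gives a global Lipschitz constant, the second the symmetry of the truncated
  solution.\<close>

definition trunc :: "real \<Rightarrow> real^'n^'m \<Rightarrow> real^'n^'m" where
  "trunc R X = (\<chi> i j. max (- R) (min R (X $ i $ j)))"

lemma trunc_lipschitz: "norm (trunc R X - trunc R Y) \<le> norm (X - Y)"
proof (rule norm_le_componentwise_cart)
  show "norm ((trunc R X - trunc R Y) $ i) \<le> norm ((X - Y) $ i)" for i
    by (rule norm_le_componentwise_cart) (auto simp: trunc_def max_def min_def)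
qed

lemma trunc_norm: "0 \<le> R \<Longrightarrow> norm (trunc R X :: real^'n^'m) \<le> norm ((\<chi> i j. R) :: real^'n^'m)"
proof (rule norm_le_componentwise_cart)
  show "norm ((trunc R X :: real^'n^'m) $ i) \<le> norm (((\<chi> i j. R) :: real^'n^'m) $ i)" if "0 \<le> R" for i
    by (rule norm_le_componentwise_cart) (use that in \<open>auto simp: trunc_def max_def min_def\<close>)
qed

lemma trunc_transpose: "trunc R (transpose X) = transpose (trunc R X)"
  by (simp add: trunc_def transpose_def)

lemma trunc_id: "norm X \<le> R \<Longrightarrow> trunc R X = X"
proof -
  assume "norm X \<le> R"
  then have *: "\<bar>X $ i $ j\<bar> \<le> R" for i j
    using Finite_Cartesian_Product.norm_nth_le[of X i] component_le_norm_cart[of "X $ i" j] by linarith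
  have "max (- R) (min R (X $ i $ j)) = X $ i $ j" for i j
    using *[of i j] by (auto simp: max_def min_def abs_le_iff)
  then show ?thesis by (simp add: trunc_def vec_eq_iff)
qed

lemma trunc_cont: "continuous_on UNIV (trunc R)"
proof -
  have "1-lipschitz_on UNIV (trunc R)"
    by (rule lipschitz_onI) (simp_all add: dist_norm trunc_lipschitz)
  then show ?thesis by (rule lipschitz_on_continuous_on)
qed

section \<open>Global solvability of the truncated Riccati equation\<close>

context lq
begin

lemma chi_range: "i \<in> {-1..T} \<Longrightarrow> 0 \<le> chi i \<and> chi i \<le> 1"
  by (auto simp: chi_def)

lemma G_bounded:
  obtains g where "0 \<le> g" "\<And>i t. i \<in> {-1..T} \<Longrightarrow> t \<in> {0..T} \<Longrightarrow> norm (G i t) \<le> g"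
    "\<And>i t. i \<in> {-1..T} \<Longrightarrow> t \<in> {0..T} \<Longrightarrow> norm (transpose (G i t)) \<le> g"
proof -
  have c: "continuous_on ({-1..T} \<times> {0..T}) (\<lambda>p. G (fst p) (snd p))" "compact ({-1..T} \<times> {0..T})"
    by (intro G_cont continuous_intros compact_Times compact_Icc)+
  have c': "continuous_on ({-1..T} \<times> {0..T}) (\<lambda>p. transpose (G (fst p) (snd p)))"
    by (intro continuous_intros c)
  obtain g1 where g1: "\<And>p. p \<in> {-1..T} \<times> {0..T} \<Longrightarrow> norm (G (fst p) (snd p)) \<le> g1" "g1 > 0"
    using compact_imp_bounded[OF compact_continuous_image[OF c]] unfolding bounded_pos by blast
  obtain g2 where g2: "\<And>p. p \<in> {-1..T} \<times> {0..T} \<Longrightarrow> norm (transpose (G (fst p) (snd p))) \<le> g2" "g2 > 0"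
    using compact_imp_bounded[OF compact_continuous_image[OF c' c(2)]] unfolding bounded_pos by blast
  show thesis
  proof (rule that[of "max g1 g2"])
    fix i t :: real assume "i \<in> {-1..T}" "t \<in> {0..T}"
    then have "(i, t) \<in> {-1..T} \<times> {0..T}" by simp
    from g1(1)[OF this] g2(1)[OF this]
    show "norm (G i t) \<le> max g1 g2" "norm (transpose (G i t)) \<le> max g1 g2" by auto
  qed (use g1 in auto)
qed

text \<open>The difference of the quadratic terms is split into two products, each with one factor
  bounded through \<open>R\<close> and one nonexpansive difference. The other summands of
  \<open>L\<close> come from the two terms with \<open>G\<close> and the two \<open>chi\<close>
  terms, since \<open>chi\<close> has values in [0,1].\<close>

lemma ric_lipschitz:
  assumes R: "\<And>X. norm (\<phi> X) \<le> R" and \<phi>: "\<And>X Y. norm (\<phi> X - \<phi> Y) \<le> norm (X - Y)"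
  shows "\<exists>L\<ge>0. \<forall>Q Q' i j t e. i \<in> {-1..T} \<longrightarrow> j \<in> {-1..T} \<longrightarrow> t \<in> {0..T} \<longrightarrow> 0 \<le> e \<longrightarrow>
      (\<forall>i\<in>{-1..T}. \<forall>j\<in>{-1..T}. norm (Q i j t - Q' i j t) \<le> e) \<longrightarrow>
      norm (ric \<phi> Q i j t - ric \<phi> Q' i j t) \<le> L * e"
proof -
  obtain K where K: "0 < K" "\<And>(X :: real^'d^'d) (Y :: real^'d^'d). norm (X ** Y) \<le> K * norm X * norm Y"
    by (rule matrix_matrix_norm_bound[where 'n = 'd and 'm = 'd and 'k = 'd]) (rule that)
  obtain g where g: "0 \<le> g" "\<And>i t. i \<in> {-1..T} \<Longrightarrow> t \<in> {0..T} \<Longrightarrow> norm (G i t) \<le> g"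
    "\<And>i t. i \<in> {-1..T} \<Longrightarrow> t \<in> {0..T} \<Longrightarrow> norm (transpose (G i t)) \<le> g"
    by (rule G_bounded) (rule that)
  have R0: "0 \<le> R" using R[of 0] norm_ge_zero order_trans by blast
  have K': "norm (X ** Y) \<le> K * a * c" if "norm X \<le> a" "norm Y \<le> c" for X Y :: "real^'d^'d" and a c
  proof -
    have a: "0 \<le> a" using that(1) norm_ge_zero order_trans by blast
    have "K * norm X * norm Y \<le> K * a * c"
      using that K(1) a by (intro mult_mono) auto
    then show ?thesis using K(2)[of X Y] by linarith
  qed
  define L where "L = K * g + K * g + 1 + 1 + (K * 1 * (K * norm S * R) + K * R * (K * norm S * 1))"
  show ?thesis
  proof (intro exI[of _ L] conjI allI impI)
    show "0 \<le> L" unfolding L_def using K g R0 by (intro add_nonneg_nonneg mult_nonneg_nonneg) auto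
    fix Q Q' :: "real \<Rightarrow> real \<Rightarrow> real \<Rightarrow> real^'d^'d" and i j t e
    assume i: "i \<in> {-1..T}" and j: "j \<in> {-1..T}" and t: "t \<in> {0..T}" and e: "0 \<le> (e::real)"
      and le': "\<forall>i\<in>{-1..T}. \<forall>j\<in>{-1..T}. norm (Q i j t - Q' i j t) \<le> e"
    have le: "norm (Q i j t - Q' i j t) \<le> e" if "i \<in> {-1..T}" "j \<in> {-1..T}" for i j
      using le' that by blast
    have m: "-1 \<in> {-1..T}" "t \<in> {-1..T}" using T_pos t by auto
    have sc: "norm (c *\<^sub>R X) \<le> 1 * e" if "0 \<le> c \<and> c \<le> 1" "norm X \<le> e" for c and X :: "real^'d^'d"
      using mult_mono[of c 1 "norm X" e] that by simp
    note le1 = le[OF m(1) j] and le2 = le[OF i m(1)]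
    have eq: "ric \<phi> Q i j t - ric \<phi> Q' i j t = transpose (G i t) ** (Q (-1) j t - Q' (-1) j t)
       + (Q i (-1) t - Q' i (-1) t) ** G j t + chi j *\<^sub>R (Q i t t - Q' i t t) + chi i *\<^sub>R (Q t j t - Q' t j t)
       - ((\<phi> (Q i (-1) t) - \<phi> (Q' i (-1) t)) ** (S ** \<phi> (Q (-1) j t))
          + \<phi> (Q' i (-1) t) ** (S ** (\<phi> (Q (-1) j t) - \<phi> (Q' (-1) j t))))"
      by (simp add: ric_def scaleR_diff_right bounded_bilinear.diff_left[OF bounded_bilinear_matrix_matrix]
          bounded_bilinear.diff_right[OF bounded_bilinear_matrix_matrix])
    have 1: "norm (transpose (G i t) ** (Q (-1) j t - Q' (-1) j t)) \<le> K * g * e"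
      by (rule K'[OF g(3)[OF i t] le1])
    have 2: "norm ((Q i (-1) t - Q' i (-1) t) ** G j t) \<le> K * e * g"
      by (rule K'[OF le2 g(2)[OF j t]])
    have 3: "norm (chi j *\<^sub>R (Q i t t - Q' i t t)) \<le> 1 * e" by (rule sc[OF chi_range[OF j] le[OF i m(2)]])
    have 4: "norm (chi i *\<^sub>R (Q t j t - Q' t j t)) \<le> 1 * e" by (rule sc[OF chi_range[OF i] le[OF m(2) j]])
    have 5: "norm ((\<phi> (Q i (-1) t) - \<phi> (Q' i (-1) t)) ** (S ** \<phi> (Q (-1) j t))) \<le> K * e * (K * norm S * R)"
      by (rule K'[OF order_trans[OF \<phi> le2] K'[OF order_refl R]])
    have 6: "norm (\<phi> (Q' i (-1) t) ** (S ** (\<phi> (Q (-1) j t) - \<phi> (Q' (-1) j t)))) \<le> K * R * (K * norm S * e)"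
      by (rule K'[OF R K'[OF order_refl order_trans[OF \<phi> le1]]])
    have tri: "norm (a1 + a2 + a3 + a4 - (a5 + a6)) \<le> norm a1 + norm a2 + norm a3 + norm a4 + (norm a5 + norm a6)"
      for a1 a2 a3 a4 a5 a6 :: "real^'d^'d"
      by (intro order_trans[OF norm_triangle_ineq4] add_mono norm_triangle_le order_refl)
    have "norm (ric \<phi> Q i j t - ric \<phi> Q' i j t) \<le> K * g * e + K * e * g + 1 * e + 1 * e
        + (K * e * (K * norm S * R) + K * R * (K * norm S * e))"
      unfolding eq by (rule order_trans[OF tri]) (intro add_mono 1 2 3 4 5 6)
    then show "norm (ric \<phi> Q i j t - ric \<phi> Q' i j t) \<le> L * e"
      by (simp add: L_def algebra_simps)
  qed
qed

lemma transpose_S: "transpose S = S"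
  by (simp add: S_def matrix_transpose_mul)

text \<open>Swapping the indices and transposing maps solutions to solutions, so uniqueness forces
  the solution to be symmetric.\<close>

lemma ric_transpose:
  assumes \<phi>: "\<And>X. \<phi> (transpose X) = transpose (\<phi> X)"
  shows "ric \<phi> (\<lambda>i j t. transpose (Q j i t)) i j t = transpose (ric \<phi> Q j i t)"
proof -
  have add: "transpose (X + Y) = transpose X + transpose Y" and diff: "transpose (X - Y) = transpose X - transpose Y"
    for X Y :: "real^'d^'d"
    by (simp_all add: transpose_def vec_eq_iff)
  show ?thesis
    unfolding ric_def \<phi>
    by (simp add: add diff transpose_scalar matrix_transpose_mul transpose_S matrix_mul_assoc mult.commute)
qed

lemma truncated_riccati_exists:
  assumes R: "\<And>X. norm (\<phi> X) \<le> R" and \<phi>: "\<And>X Y. norm (\<phi> X - \<phi> Y) \<le> norm (X - Y)"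
    and \<phi>_transpose: "\<And>X. \<phi> (transpose X) = transpose (\<phi> X)" and \<phi>_cont: "continuous_on UNIV \<phi>"
  obtains Q where "continuous_on ({-1..T} \<times> {-1..T} \<times> {0..T}) (\<lambda>(i, j, t). Q i j t)"
    "\<And>i j t. \<lbrakk>i \<in> {-1..T}; j \<in> {-1..T}; t \<in> {0..T}\<rbrakk> \<Longrightarrow>
      (Q i j has_vector_derivative - ric \<phi> Q i j t) (at t within {0..T})"
    "\<And>i j. \<lbrakk>i \<in> {-1..T}; j \<in> {-1..T}\<rbrakk> \<Longrightarrow> Q i j T = 0"
    "\<And>i j t. \<lbrakk>i \<in> {-1..T}; j \<in> {-1..T}; t \<in> {0..T}\<rbrakk> \<Longrightarrow> Q j i t = transpose (Q i j t)"
proof -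
  obtain L where L: "0 \<le> L" "\<forall>Q Q' i j t e. i \<in> {-1..T} \<longrightarrow> j \<in> {-1..T} \<longrightarrow> t \<in> {0..T} \<longrightarrow> 0 \<le> e \<longrightarrow>
      (\<forall>i\<in>{-1..T}. \<forall>j\<in>{-1..T}. norm (Q i j t - Q' i j t) \<le> e) \<longrightarrow>
      norm (ric \<phi> Q i j t - ric \<phi> Q' i j t) \<le> L * e"
    using ric_lipschitz[of \<phi> R, OF R \<phi>] by blast
  define P :: "(real \<times> real) set" where "P = {-1..T} \<times> {-1..T}"
  define F where "F Z p t = ric \<phi> (\<lambda>i j. Z (i, j)) (fst p) (snd p) t" for Z p t
  have P: "compact P" unfolding P_def by (intro compact_Times compact_Icc)
  have conv: "continuous_on ({-1..T} \<times> {-1..T} \<times> {0..T}) (\<lambda>(i, j, t). Z (i, j) t)"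
    if "continuous_on (P \<times> {0..T}) (\<lambda>(x, t). Z x t)" for Z :: "real \<times> real \<Rightarrow> real \<Rightarrow> real^'d^'d"
    unfolding case_prod_unfold
    by (rule continuous_on_compose_pair[OF that]) (auto simp: P_def intro!: continuous_intros)
  have cont: "continuous_on (P \<times> {0..T}) (\<lambda>(x, t). F Z x t)"
    if "continuous_on (P \<times> {0..T}) (\<lambda>(x, t). Z x t)" for Z
    unfolding F_def case_prod_unfold
    by (rule ric_cont[OF conv[OF that] \<phi>_cont]) (auto simp: P_def intro!: continuous_intros)
  have lip: "norm (F Z x t - F Z' x t) \<le> L * e"
    if "t \<in> {0..T}" "0 \<le> e" "\<And>x. x \<in> P \<Longrightarrow> norm (Z x t - Z' x t) \<le> e" "x \<in> P" for Z Z' t e x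
    unfolding F_def by (rule L(2)[rule_format]) (use that in \<open>auto simp: P_def\<close>)
  have "\<exists>Z. continuous_on (P \<times> {0..T}) (\<lambda>(x, t). Z x t) \<and> (\<forall>x\<in>P. \<forall>t\<in>{0..T}. integral {t..T} (F Z x) = Z x t)"
    by (rule backward_fixpoint[OF P L(1) cont lip])
  then obtain Z where Z: "continuous_on (P \<times> {0..T}) (\<lambda>(x, t). Z x t)"
      "\<And>x t. x \<in> P \<Longrightarrow> t \<in> {0..T} \<Longrightarrow> integral {t..T} (F Z x) = Z x t"
    by blast
  define Q where "Q = (\<lambda>i j. Z (i, j))"
  have QF: "F Z (i, j) = ric \<phi> Q i j" for i j
    by (auto simp: F_def Q_def)
  have QP: "integral {t..T} (ric \<phi> Q i j) = Q i j t" if "i \<in> {-1..T}" "j \<in> {-1..T}" "t \<in> {0..T}" for i j t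
    using Z(2)[of "(i, j)" t] that by (simp add: QF P_def Q_def)
  have Qc: "continuous_on ({-1..T} \<times> {-1..T} \<times> {0..T}) (\<lambda>(i, j, t). Q i j t)"
    unfolding Q_def by (rule conv[OF Z(1)])
  have Rc: "continuous_on {0..T} (ric \<phi> Q i j)" if "i \<in> {-1..T}" "j \<in> {-1..T}" for i j
    by (rule ric_cont[OF Qc \<phi>_cont]) (use that in \<open>auto intro!: continuous_intros\<close>)
  define Y where "Y p t = transpose (Q (snd p) (fst p) t)" for p t
  have "Z x t = Y x t" if xt: "x \<in> P" "t \<in> {0..T}" for x t
  proof (rule backward_unique[where F = F and P = P and T = T and L = L and Z = Z and Y = Y])
    show "continuous_on (P \<times> {0..T}) (\<lambda>(x, t). Y x t)"
      unfolding Y_def case_prod_unfold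
      by (intro continuous_intros continuous_on_compose_triple[OF Qc]) (auto simp: P_def)
    show "integral {t..T} (F Y x) = Y x t" if "x \<in> P" "t \<in> {0..T}" for x t
    proof -
      obtain i j where x: "x = (i, j)" "i \<in> {-1..T}" "j \<in> {-1..T}" using \<open>x \<in> P\<close> by (cases x) (simp add: P_def)
      have Y_eq: "(\<lambda>i j. Y (i, j)) = (\<lambda>i j t. transpose (Q j i t))"
        by (intro ext) (simp add: Y_def)
      have "F Y x = transpose \<circ> ric \<phi> Q j i"
        unfolding F_def x fst_conv snd_conv Y_eq o_def
        using ric_transpose[of \<phi> Q i j, OF \<phi>_transpose] by (intro ext)
      moreover have "ric \<phi> Q j i integrable_on {t..T}"
        using that x by (intro integrable_continuous_real continuous_on_subset[OF Rc]) auto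
      ultimately show ?thesis
        using integral_linear[OF _ bounded_linear_transpose, of "ric \<phi> Q j i" "{t..T}"] QP[of j i t] \<open>t \<in> {0..T}\<close> x
        by (simp add: Y_def del: o_apply)
    qed
  qed (assumption | rule P L(1) cont lip Z xt)+
  note sym = this
  show thesis
  proof (rule that[of Q])
    show "(Q i j has_vector_derivative - ric \<phi> Q i j t) (at t within {0..T})"
      if "i \<in> {-1..T}" "j \<in> {-1..T}" "t \<in> {0..T}" for i j t
      by (rule backward_has_vector_derivative[OF Rc QP]) (use that in auto)
    show "Q i j T = 0" if "i \<in> {-1..T}" "j \<in> {-1..T}" for i j
      using QP[OF that, of T] T_pos by simp
    show "Q j i t = transpose (Q i j t)" if "i \<in> {-1..T}" "j \<in> {-1..T}" "t \<in> {0..T}" for i j t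
      using sym[of "(j, i)" t] that by (simp add: P_def Y_def Q_def)
  qed (rule Qc)
qed

end

subsection \<open>The state equation\<close>

text \<open>The past does not depend on the unknown \<open>w\<close>. Moved into the free term, it
  leaves a Volterra equation with kernel \<open>H i r\<close>.\<close>

lemma state_equation_volterra:
  fixes H :: "real \<Rightarrow> real \<Rightarrow> real^'d^'d" and b :: "nat \<Rightarrow> real^'d"
  assumes st: "state T n s \<tau> \<xi> w"
    and H1: "continuous_on {\<tau>..T} (H (-1))" and H: "continuous_on ({0..T} \<times> {\<tau>..T}) (\<lambda>(i, t). H i t)"
    and t: "t \<in> {\<tau>..T}"
  shows "volterra_op (H (-1)) (\<lambda>r i. H i r) (\<lambda>t. U t + integral {\<tau>..t} (\<lambda>r. past (*v) n s b \<tau> \<xi> (\<lambda>i. H i r))) \<tau> w t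
    = U t + integral {\<tau>..t} (\<lambda>r. act (*v) n s b \<tau> \<xi> w r (\<lambda>i. H i r))"
proof -
  interpret state T n s b \<tau> \<xi> w by (rule st)
  have k: "continuous_on ({\<tau>..T} \<times> {\<tau>..T}) (\<lambda>(r, i). H i r)"
    unfolding case_prod_unfold using tau
    by (intro continuous_on_compose_pair[OF H] continuous_intros) auto
  have p: "continuous_on {\<tau>..T} (\<lambda>r. past (*v) n s b \<tau> \<xi> (\<lambda>i. H i r))"
    by (rule past_continuous[OF bounded_bilinear_matrix_vector H])
  have v: "continuous_on {\<tau>..T} (\<lambda>r. H (-1) r *v w r + integral {\<tau>..r} (\<lambda>i. H i r *v w i))"
    by (rule volterra_integrand_continuous[OF H1 k w_cont])
  have sub: "{\<tau>..t} \<subseteq> {\<tau>..T}" using t by auto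
  have "integral {\<tau>..t} (\<lambda>r. act (*v) n s b \<tau> \<xi> w r (\<lambda>i. H i r))
      = integral {\<tau>..t} (\<lambda>r. past (*v) n s b \<tau> \<xi> (\<lambda>i. H i r) + (H (-1) r *v w r + integral {\<tau>..r} (\<lambda>i. H i r *v w i)))"
    by (simp add: act_def algebra_simps)
  also have "\<dots> = integral {\<tau>..t} (\<lambda>r. past (*v) n s b \<tau> \<xi> (\<lambda>i. H i r))
      + integral {\<tau>..t} (\<lambda>r. H (-1) r *v w r + integral {\<tau>..r} (\<lambda>i. H i r *v w i))"
    by (intro Henstock_Kurzweil_Integration.integral_add integrable_continuous_real
        continuous_on_subset[OF p sub] continuous_on_subset[OF v sub])
  finally show ?thesis by (simp add: volterra_op_def algebra_simps)
qed

lemma act_state_continuous: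
  fixes H :: "real \<Rightarrow> real \<Rightarrow> real^'d^'d" and b :: "nat \<Rightarrow> real^'d"
  assumes st: "state T n s \<tau> \<xi> w"
    and H1: "continuous_on {\<tau>..T} (H (-1))" and H: "continuous_on ({0..T} \<times> {\<tau>..T}) (\<lambda>(i, t). H i t)"
  shows "continuous_on {\<tau>..T} (\<lambda>r. act (*v) n s b \<tau> \<xi> w r (\<lambda>i. H i r))"
proof -
  interpret state T n s b \<tau> \<xi> w by (rule st)
  have k: "continuous_on ({\<tau>..T} \<times> {\<tau>..T}) (\<lambda>(r, i). H i r)"
    unfolding case_prod_unfold using tau
    by (intro continuous_on_compose_pair[OF H] continuous_intros) auto
  have p: "continuous_on {\<tau>..T} (\<lambda>r. past (*v) n s b \<tau> \<xi> (\<lambda>i. H i r))"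
    by (rule past_continuous[OF bounded_bilinear_matrix_vector H])
  have v: "continuous_on {\<tau>..T} (\<lambda>r. H (-1) r *v w r + integral {\<tau>..r} (\<lambda>i. H i r *v w i))"
    by (rule volterra_integrand_continuous[OF H1 k w_cont])
  show ?thesis
    using continuous_on_add[OF p v] by (simp add: act_def algebra_simps)
qed

lemma state_equation_exists_unique:
  fixes H :: "real \<Rightarrow> real \<Rightarrow> real^'d^'d" and b :: "nat \<Rightarrow> real^'d"
  assumes st: "state T n s \<tau> \<xi> (\<lambda>_. 0)"
    and H1: "continuous_on {\<tau>..T} (H (-1))" and H: "continuous_on ({0..T} \<times> {\<tau>..T}) (\<lambda>(i, t). H i t)"
    and U: "continuous_on {\<tau>..T} U"
  shows "\<exists>w. continuous_on {\<tau>..T} w \<and>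
    (\<forall>t\<in>{\<tau>..T}. w t = U t + integral {\<tau>..t} (\<lambda>r. act (*v) n s b \<tau> \<xi> w r (\<lambda>i. H i r))) \<and>
    (\<forall>w'. continuous_on {\<tau>..T} w' \<longrightarrow>
      (\<forall>t\<in>{\<tau>..T}. w' t = U t + integral {\<tau>..t} (\<lambda>r. act (*v) n s b \<tau> \<xi> w' r (\<lambda>i. H i r))) \<longrightarrow>
      (\<forall>t\<in>{\<tau>..T}. w' t = w t))"
proof -
  interpret s0: state T n s b \<tau> \<xi> "\<lambda>_. 0" by (rule st)
  define U' where "U' t = U t + integral {\<tau>..t} (\<lambda>r. past (*v) n s b \<tau> \<xi> (\<lambda>i. H i r))" for t
  have st': "state T n s \<tau> \<xi> w" if "continuous_on {\<tau>..T} w" for w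
    using s0.tau s0.s s0.xi that by unfold_locales
  have eq: "volterra_op (H (-1)) (\<lambda>r i. H i r) U' \<tau> w t = U t + integral {\<tau>..t} (\<lambda>r. act (*v) n s b \<tau> \<xi> w r (\<lambda>i. H i r))"
    if "continuous_on {\<tau>..T} w" "t \<in> {\<tau>..T}" for w t
    unfolding U'_def[abs_def] by (rule state_equation_volterra[OF st'[OF that(1)] H1 H that(2)])
  have k: "continuous_on ({\<tau>..T} \<times> {\<tau>..T}) (\<lambda>(r, i). H i r)"
    unfolding case_prod_unfold using s0.tau
    by (intro continuous_on_compose_pair[OF H] continuous_intros) auto
  have U': "continuous_on {\<tau>..T} U'"
    unfolding U'_def by (intro continuous_on_add U indefinite_integral_continuous_1 integrable_continuous_real
        s0.past_continuous[OF bounded_bilinear_matrix_vector H])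
  show ?thesis
  proof (rule volterra_exists_unique[OF s0.tau(2) H1 k U'])
    fix w assume w: "continuous_on {\<tau>..T} w"
      "\<And>t. t \<in> {\<tau>..T} \<Longrightarrow> w t = volterra_op (H (-1)) (\<lambda>r i. H i r) U' \<tau> w t"
      "\<And>w' t. continuous_on {\<tau>..T} w' \<Longrightarrow> (\<And>t. t \<in> {\<tau>..T} \<Longrightarrow> w' t = volterra_op (H (-1)) (\<lambda>r i. H i r) U' \<tau> w' t)
        \<Longrightarrow> t \<in> {\<tau>..T} \<Longrightarrow> w' t = w t"
    show ?thesis
    proof (intro exI[of _ w] conjI allI impI ballI)
      show "w t = U t + integral {\<tau>..t} (\<lambda>r. act (*v) n s b \<tau> \<xi> w r (\<lambda>i. H i r))" if "t \<in> {\<tau>..T}" for t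
        using w(2)[OF that] eq[OF w(1) that] by (rule trans)
      show "w' t = w t" if "continuous_on {\<tau>..T} w'"
        "\<forall>t\<in>{\<tau>..T}. w' t = U t + integral {\<tau>..t} (\<lambda>r. act (*v) n s b \<tau> \<xi> w' r (\<lambda>i. H i r))"
        "t \<in> {\<tau>..T}" for w' t
      proof (rule w(3)[OF that(1) _ that(3)])
        fix t assume t: "t \<in> {\<tau>..T}"
        show "w' t = volterra_op (H (-1)) (\<lambda>r i. H i r) U' \<tau> w' t"
          using bspec[OF that(2) t] eq[OF that(1) t, symmetric] by (rule trans)
      qed
    qed (rule w(1))
  qed
qed

lemma state_equation_exists:
  fixes H :: "real \<Rightarrow> real \<Rightarrow> real^'d^'d" and b :: "nat \<Rightarrow> real^'d"
  assumes st: "state T n s \<tau> \<xi> (\<lambda>_. 0)"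
    and H1: "continuous_on {\<tau>..T} (H (-1))" and H: "continuous_on ({0..T} \<times> {\<tau>..T}) (\<lambda>(i, t). H i t)"
    and f: "continuous_on {\<tau>..T} f"
  shows "\<exists>w. continuous_on {\<tau>..T} w \<and> w \<tau> = w0 \<and>
    (\<forall>t\<in>{\<tau>..T}. (w has_vector_derivative act (*v) n s b \<tau> \<xi> w t (\<lambda>i. H i t) + f t) (at t within {\<tau>..T}))"
proof -
  interpret s0: state T n s b \<tau> \<xi> "\<lambda>_. 0" by (rule st)
  have "continuous_on {\<tau>..T} (\<lambda>t. w0 + integral {\<tau>..t} f)"
    by (intro continuous_intros indefinite_integral_continuous_1 integrable_continuous_real f)
  from state_equation_exists_unique[OF st H1 H this] obtain w where w: "continuous_on {\<tau>..T} w"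
    "\<forall>t\<in>{\<tau>..T}. w t = w0 + integral {\<tau>..t} f + integral {\<tau>..t} (\<lambda>r. act (*v) n s b \<tau> \<xi> w r (\<lambda>i. H i r))"
    by blast
  interpret state T n s b \<tau> \<xi> w using s0.tau s0.s s0.xi w(1) by unfold_locales
  have ac: "continuous_on {\<tau>..T} (\<lambda>r. act (*v) n s b \<tau> \<xi> w r (\<lambda>i. H i r))"
    by (rule act_state_continuous[OF state_axioms H1 H])
  have "(w has_vector_derivative act (*v) n s b \<tau> \<xi> w t (\<lambda>i. H i t) + f t) (at t within {\<tau>..T})" if t: "t \<in> {\<tau>..T}" for t
  proof (rule has_vector_derivative_transform[OF t])
    show "((\<lambda>t. w0 + integral {\<tau>..t} f + integral {\<tau>..t} (\<lambda>r. act (*v) n s b \<tau> \<xi> w r (\<lambda>i. H i r))) has_vector_derivative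
        act (*v) n s b \<tau> \<xi> w t (\<lambda>i. H i t) + f t) (at t within {\<tau>..T})"
      using has_vector_derivative_add[OF has_vector_derivative_add[OF has_vector_derivative_const
          integral_has_vector_derivative[OF f t]] integral_has_vector_derivative[OF ac t]]
      by (simp add: add.commute)
  qed (use w(2) in blast)
  moreover have "w \<tau> = w0" using bspec[OF w(2), of \<tau>] tau by simp
  ultimately show ?thesis using w(1) by blast
qed

section \<open>The closed loop and a priori bounds of the kernel\<close>

context lq
begin

lemma tracking_zero: "tracking \<sigma> Q (\<lambda>_. 0) (\<lambda>_ _. 0)"
  unfolding tracking_def by (auto simp: drhs_def case_prod_unfold)

lemma Gs_cont:
  "continuous_on {\<tau>..T} (G (-1))" "continuous_on ({0..T} \<times> {\<tau>..T}) (\<lambda>(i, t). G i t)"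
proof -
  show "continuous_on {\<tau>..T} (G (-1))"
    using G_cont[of "{\<tau>..T}" "\<lambda>_. -1" "\<lambda>t. t"] by (simp add: continuous_on_const)
  show "continuous_on ({0..T} \<times> {\<tau>..T}) (\<lambda>(i, t). G i t)"
    unfolding case_prod_unfold by (intro G_cont continuous_intros)
qed

text \<open>The feedback acts linearly on the state with kernel \<open>Q (-1)\<close>, apart from
  \<open>d (-1)\<close>. The closed loop is therefore again a state equation, with \<open>G\<close>
  replaced by \<open>G - S ** Q (-1)\<close>.\<close>

lemma closed_loop_exists:
  assumes st: "state T n s \<tau> \<xi> (\<lambda>_. 0)" and Q: "riccati \<tau> Q" and d: "tracking \<tau> Q y d"
  shows "\<exists>w. w \<tau> = w0 \<and> riccati_trajectory T A B C N n s b \<tau> \<xi> w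
     (\<lambda>t. - (transpose B *v (act (*v) n s b \<tau> \<xi> w t (\<lambda>j. Q (-1) j t) + d (-1) t))) Q y d"
proof -
  interpret s0: state T n s b \<tau> \<xi> "\<lambda>_. 0" by (rule st)
  have Qc: "continuous_on ({-1..T} \<times> {-1..T} \<times> {0..T}) (\<lambda>(i, j, t). Q i j t)"
    using Q unfolding riccati_def by blast
  have dc: "continuous_on ({-1..T} \<times> {0..T}) (\<lambda>(i, t). d i t)"
    using d unfolding tracking_def by blast
  have d1: "continuous_on {\<tau>..T} (d (-1))"
    using s0.tau T_pos by (intro continuous_on_subset[OF continuous_on_section2[OF dc]]) auto
  have Q1: "continuous_on {\<tau>..T} (Q (-1) (-1))"
    using s0.tau T_pos by (intro continuous_on_compose_triple[OF Qc] continuous_intros) auto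
  have Q2: "continuous_on ({0..T} \<times> {\<tau>..T}) (\<lambda>(i, t). Q (-1) i t)"
    unfolding case_prod_unfold using s0.tau T_pos
    by (intro continuous_on_compose_triple[OF Qc] continuous_intros) auto
  define H where "H i t = G i t - S ** Q (-1) i t" for i t
  have H1: "continuous_on {\<tau>..T} (H (-1))"
    unfolding H_def by (intro continuous_intros Gs_cont Q1)
  have H2: "continuous_on ({0..T} \<times> {\<tau>..T}) (\<lambda>(i, t). H i t)"
    using Gs_cont(2) Q2 unfolding H_def case_prod_unfold by (intro continuous_intros)
  have "continuous_on {\<tau>..T} (\<lambda>t. - (S *v d (-1) t))" by (intro continuous_intros d1)
  from state_equation_exists[OF st H1 H2 this, of w0 b] obtain w where w: "continuous_on {\<tau>..T} w" "w \<tau> = w0"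
    "\<And>t. t \<in> {\<tau>..T} \<Longrightarrow> (w has_vector_derivative act (*v) n s b \<tau> \<xi> w t (\<lambda>i. H i t) + - (S *v d (-1) t)) (at t within {\<tau>..T})"
    by blast
  interpret state T n s b \<tau> \<xi> w using s0.tau s0.s s0.xi w(1) by unfold_locales
  define u where "u t = - (transpose B *v (act (*v) n s b \<tau> \<xi> w t (\<lambda>j. Q (-1) j t) + d (-1) t))" for t
  have "riccati_trajectory T A B C N n s b \<tau> \<xi> w u Q y d"
  proof unfold_locales
    show "continuous_on {\<tau>..T} u"
      unfolding u_def by (intro continuous_intros d1 act_state_continuous[OF state_axioms Q1 Q2])
    fix t assume t: "t \<in> {\<tau>..T}"
    have cG: "continuous_on {0..T} (\<lambda>i. G i t)" and cQ: "continuous_on {0..T} (\<lambda>i. Q (-1) i t)"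
      using continuous_on_section1[OF Gs_cont(2) t] continuous_on_section1[OF Q2 t] by auto
    have tT: "t \<le> T" using t by simp
    have 1: "act (*v) n s b \<tau> \<xi> w t (\<lambda>i. (- S) ** Q (-1) i t) = - S *v act (*v) n s b \<tau> \<xi> w t (\<lambda>i. Q (-1) i t)"
      by (rule act_linear[OF bounded_bilinear_matrix_vector cQ tT]) (auto simp: matrix_vector_mul_assoc)
    have mm: "(- S) ** X = - (S ** X)" for X :: "real^'d^'d"
      by (rule bounded_bilinear.minus_left[OF bounded_bilinear_matrix_matrix])
    have "(\<lambda>i. H i t) = (\<lambda>i. G i t + (- S) ** Q (-1) i t)"
      by (simp add: H_def mm)
    then have "act (*v) n s b \<tau> \<xi> w t (\<lambda>i. H i t) = act (*v) n s b \<tau> \<xi> w t (\<lambda>i. G i t) + - S *v act (*v) n s b \<tau> \<xi> w t (\<lambda>i. Q (-1) i t)"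
      using act_add[OF bounded_bilinear_matrix_vector cG _ tT, of "\<lambda>i. (- S) ** Q (-1) i t"]
      by (simp add: 1 cQ continuous_intros)
    moreover have "- S *v x = - (B *v (transpose B *v x))" for x
      using bounded_bilinear.minus_left[OF bounded_bilinear_matrix_vector, of S x]
      by (simp add: S_def matrix_vector_mul_assoc)
    moreover have "B *v - x = - (B *v x)" for x
      by (rule bounded_bilinear.minus_right[OF bounded_bilinear_matrix_vector])
    ultimately have "act (*v) n s b \<tau> \<xi> w t (\<lambda>i. H i t) + - (S *v d (-1) t) = act (*v) n s b \<tau> \<xi> w t (\<lambda>i. G i t) + B *v u t"
      by (simp add: u_def S_def matrix_vector_mul_assoc[symmetric] matrix_vector_right_distrib
          matrix_vector_mult_diff_distrib)
    then show "(w has_vector_derivative act (*v) n s b \<tau> \<xi> w t (\<lambda>i. G i t) + B *v u t) (at t within {\<tau>..T})"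
      using w(3)[OF t] by simp
  qed (use Q d in auto)
  then show ?thesis using w(2) unfolding u_def by blast
qed

text \<open>The value function for zero reference signal, current value \<open>x\<close> and a
  history consisting of the atoms \<open>b k\<close> at \<open>s k\<close>.\<close>

definition quad :: "(real \<Rightarrow> real \<Rightarrow> real \<Rightarrow> real^'d^'d) \<Rightarrow> nat \<Rightarrow> (nat \<Rightarrow> real) \<Rightarrow> (nat \<Rightarrow> real^'d) \<Rightarrow> real \<Rightarrow> real^'d \<Rightarrow> real" where
  "quad Q n s b \<tau> x = (Q (-1) (-1) \<tau> *v x + (\<Sum>l<n. Q (-1) (s l) \<tau> *v b l)) \<bullet> x
     + (\<Sum>k<n. (Q (s k) (-1) \<tau> *v x + (\<Sum>l<n. Q (s k) (s l) \<tau> *v b l)) \<bullet> b k)"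

text \<open>Along the closed loop the defect vanishes, and the form becomes the integral of a sum of
  squares.\<close>

lemma quad_nonneg:
  assumes Q: "riccati \<tau> Q" and \<tau>: "0 \<le> \<tau>" "\<tau> \<le> T" and s: "\<And>k. k < n \<Longrightarrow> s k \<in> {0..T}"
  shows "0 \<le> quad Q n s b \<tau> x"
proof -
  have st: "state T n s \<tau> (\<lambda>_. 0 :: real^'d) (\<lambda>_. 0 :: real^'d)"
    using \<tau> s by unfold_locales auto
  from closed_loop_exists[OF st Q tracking_zero, of x b] obtain w where w: "w \<tau> = x"
    and R: "riccati_trajectory T A B C N n s b \<tau> (\<lambda>_. 0) w
     (\<lambda>t. - (transpose B *v (act (*v) n s b \<tau> (\<lambda>_. 0) w t (\<lambda>j. Q (-1) j t) + 0))) Q (\<lambda>_. 0) (\<lambda>_ _. 0)"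
    by blast
  interpret R: riccati_trajectory T A B C N n s b \<tau> "\<lambda>_. 0" w
     "\<lambda>t. - (transpose B *v (act (*v) n s b \<tau> (\<lambda>_. 0) w t (\<lambda>j. Q (-1) j t) + 0))" Q "\<lambda>_. 0" "\<lambda>_ _. 0"
    by (rule R)
  have "R.V (\<lambda>_. 0) \<tau> = quad Q n s b \<tau> x"
    by (simp add: R.V_def R.q_def act_def past_def quad_def w)
  moreover have "0 \<le> R.V (\<lambda>_. 0) \<tau>"
    using R.verification[of "\<lambda>_. 0"] by (rule has_integral_nonneg) (auto simp: R.q_def)
  ultimately show ?thesis by simp
qed

text \<open>The form is at most the cost of the zero control. That trajectory depends on
  \<open>A\<close>, \<open>N\<close> and the initial data but not on \<open>Q\<close>, so the
  constant is uniform in \<open>Q\<close>, in the initial time and in the number and position of the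
  atoms.\<close>

lemma quad_bounded:
  "\<exists>K\<ge>0. \<forall>\<tau> Q n s b x. 0 \<le> \<tau> \<longrightarrow> \<tau> \<le> T \<longrightarrow> riccati \<tau> Q \<longrightarrow> (\<forall>k<n. s k \<in> {0..T}) \<longrightarrow>
     quad Q n s b \<tau> x \<le> K * (norm x + (\<Sum>k<n. norm (b k)))\<^sup>2"
proof -
  obtain K where K: "0 < K" "\<And>(X :: real^'d^'d) x. norm (X *v x) \<le> K * norm X * norm x"
    by (rule matrix_vector_norm_bound[where 'n = 'd and 'm = 'd]) (rule that)
  obtain K2 where K2: "0 < K2" "\<And>(X :: real^'d^'p) x. norm (X *v x) \<le> K2 * norm X * norm x"
    by (rule matrix_vector_norm_bound[where 'n = 'd and 'm = 'p]) (rule that)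
  obtain g where g: "0 \<le> g" "\<And>i t. i \<in> {-1..T} \<Longrightarrow> t \<in> {0..T} \<Longrightarrow> norm (G i t) \<le> g"
    using G_bounded by metis
  \<comment> \<open>The rate required by \<open>volterra_stability\<close> with \<open>g\<close>
    bounding both coefficients; the summand 1 keeps it positive even for
    \<open>g = 0\<close>.\<close>
  define c where "c = 2 * K * (g + g * T) + 1"
  \<comment> \<open>\<open>D\<close> bounds the output per unit of initial mass: the free term is at
    most \<open>1 + T * (K * g)\<close> times the mass, and stability adds the factor
    \<open>2 * exp (c * T)\<close>.\<close>
  define D where "D = K2 * norm C * (2 * (1 + T * (K * g)) * exp (c * T))"
  have D0: "0 \<le> D" unfolding D_def using K K2 g T_pos by (intro mult_nonneg_nonneg add_nonneg_nonneg) auto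
  have "quad Q n s b \<tau> x \<le> T * D\<^sup>2 * (norm x + (\<Sum>k<n. norm (b k)))\<^sup>2"
    if \<tau>: "0 \<le> \<tau>" "\<tau> \<le> T" and Q: "riccati \<tau> Q" and s: "\<forall>k<n. s k \<in> {0..T}" for \<tau> Q n s b x
  proof -
    define m where "m = norm x + (\<Sum>k<n. norm (b k))"
    have m: "0 \<le> m" "norm x \<le> m" "(\<Sum>k<n. norm (b k)) \<le> m" by (auto simp: m_def sum_nonneg)
    have st: "state T n s \<tau> (\<lambda>_. 0 :: real^'d) (\<lambda>_. 0 :: real^'d)"
      using \<tau> s by unfold_locales auto
    from state_equation_exists[OF st Gs_cont continuous_on_const, of x b 0]
    obtain w where w: "continuous_on {\<tau>..T} w" "w \<tau> = x"
      "\<And>t. t \<in> {\<tau>..T} \<Longrightarrow> (w has_vector_derivative act (*v) n s b \<tau> (\<lambda>_. 0) w t (\<lambda>i. G i t) + 0) (at t within {\<tau>..T})"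
      by blast
    interpret R: riccati_trajectory T A B C N n s b \<tau> "\<lambda>_. 0" w "\<lambda>_. 0" Q "\<lambda>_. 0" "\<lambda>_ _. 0"
      using \<tau> s w Q tracking_zero by unfold_locales auto
    define P where "P t = past (*v) n s b \<tau> (\<lambda>_. 0) (\<lambda>i. G i t)" for t
    have P: "norm (P t) \<le> K * g * m" if "t \<in> {\<tau>..T}" for t
    proof -
      have "norm (P t) \<le> (\<Sum>k<n. norm (G (s k) t *v b k))"
        unfolding P_def past_def by (simp add: norm_sum)
      also have "\<dots> \<le> (\<Sum>k<n. K * g * norm (b k))"
      proof (rule sum_mono)
        fix k assume "k \<in> {..<n}"
        then have "norm (G (s k) t) \<le> g" using s that \<tau> by (intro g(2)) auto
        then have "K * norm (G (s k) t) * norm (b k) \<le> K * g * norm (b k)"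
          using K(1) by (intro mult_right_mono mult_left_mono) auto
        then show "norm (G (s k) t *v b k) \<le> K * g * norm (b k)" using K(2)[of "G (s k) t" "b k"] by linarith
      qed
      also have "\<dots> = K * g * (\<Sum>k<n. norm (b k))" by (simp add: sum_distrib_left)
      also have "\<dots> \<le> K * g * m" using m K(1) g(1) by (intro mult_left_mono) auto
      finally show ?thesis .
    qed
    have Pc: "continuous_on {\<tau>..T} P"
      unfolding P_def by (rule R.past_continuous[OF bounded_bilinear_matrix_vector Gs_cont(2)])
    have k: "continuous_on ({\<tau>..T} \<times> {\<tau>..T}) (\<lambda>(r, i). G i r)"
      unfolding case_prod_unfold by (intro G_cont continuous_intros)
    have wV: "w t = volterra_op (G (-1)) (\<lambda>r i. G i r) (\<lambda>t. x + integral {\<tau>..t} P) \<tau> w t" if t: "t \<in> {\<tau>..T}" for t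
    proof -
      have "((\<lambda>t. act (*v) n s b \<tau> (\<lambda>_. 0) w t (\<lambda>i. G i t)) has_integral (w t - w \<tau>)) {\<tau>..t}"
      proof (rule fundamental_theorem_of_calculus)
        show "(w has_vector_derivative act (*v) n s b \<tau> (\<lambda>_. 0) w r (\<lambda>i. G i r)) (at r within {\<tau>..t})"
          if "r \<in> {\<tau>..t}" for r
          using has_vector_derivative_within_subset[OF w(3), of r "{\<tau>..t}"] that t by auto
      qed (use t in auto)
      then have "w t = x + integral {\<tau>..t} (\<lambda>t. act (*v) n s b \<tau> (\<lambda>_. 0) w t (\<lambda>i. G i t))"
        using w(2) by (auto dest: integral_unique)
      then show ?thesis
        unfolding P_def by (rule trans[OF _ state_equation_volterra[OF R.state_axioms Gs_cont t, symmetric]])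
    qed
    have U: "norm (x + integral {\<tau>..t} P) \<le> (1 + T * (K * g)) * m" if t: "t \<in> {\<tau>..T}" for t
    proof -
      have "norm (integral {\<tau>..t} P) \<le> integral {\<tau>..t} (\<lambda>_. K * g * m)"
        using t P by (intro integral_norm_bound_integral integrable_continuous_real continuous_on_subset[OF Pc]) auto
      also have "\<dots> = (t - \<tau>) * (K * g * m)" using t by simp
      also have "\<dots> \<le> T * (K * g * m)" using t \<tau> K(1) g(1) m(1) by (intro mult_right_mono) auto
      finally show ?thesis using norm_triangle_ineq[of x "integral {\<tau>..t} P"] m(2) by (simp add: algebra_simps)
    qed
    have wb: "norm (w t) \<le> 2 * ((1 + T * (K * g)) * m) * exp (c * T)" if t: "t \<in> {\<tau>..T}" for t
    proof -
      have "norm (w t) \<le> 2 * ((1 + T * (K * g)) * m) * exp (c * (T - \<tau>))"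
      proof (rule volterra_stability[where l = g and \<kappa> = g and k = "\<lambda>r i. G i r"
            and U = "\<lambda>t. x + integral {\<tau>..t} P", OF K(1) K(2) Gs_cont(1) _ k _ _ _ w(1) wV U t])
        show "2 * K * (g + g * (T - \<tau>)) \<le> c"
        proof -
          have "K * (g * (T - \<tau>)) \<le> K * (g * T)" using K(1) g(1) \<tau> by (intro mult_left_mono) auto
          then show ?thesis by (simp add: c_def algebra_simps)
        qed
        show "0 < c" unfolding c_def using K(1) g(1) T_pos
          by (intro add_nonneg_pos mult_nonneg_nonneg add_nonneg_nonneg) auto
        show "norm (G (- 1) r) \<le> g" if "r \<in> {\<tau>..T}" for r
          using that \<tau> T_pos by (intro g(2)) auto
        show "norm (G i r) \<le> g" if "r \<in> {\<tau>..T}" "i \<in> {\<tau>..T}" for r i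
          using that \<tau> T_pos by (intro g(2)) auto
      qed
      also have "\<dots> \<le> 2 * ((1 + T * (K * g)) * m) * exp (c * T)"
      proof -
        have "0 < c" unfolding c_def using K(1) g(1) T_pos
          by (intro add_nonneg_pos mult_nonneg_nonneg add_nonneg_nonneg) auto
        then show ?thesis using m(1) K(1) g(1) T_pos \<tau>
          by (intro mult_left_mono) (auto intro!: mult_nonneg_nonneg add_nonneg_nonneg)
      qed
      finally show ?thesis .
    qed
    have Cw: "(norm (C *v w t))\<^sup>2 \<le> (D * m)\<^sup>2" if t: "t \<in> {\<tau>..T}" for t
    proof (rule power_mono)
      have "K2 * norm C * norm (w t) \<le> K2 * norm C * (2 * ((1 + T * (K * g)) * m) * exp (c * T))"
        using wb[OF t] K2(1) by (intro mult_left_mono) auto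
      then show "norm (C *v w t) \<le> D * m" using K2(2)[of C "w t"] by (simp add: D_def algebra_simps)
    qed simp
    have "R.V (\<lambda>_. 0) \<tau> = quad Q n s b \<tau> x"
      by (simp add: R.V_def R.q_def act_def past_def quad_def w)
    moreover have "R.V (\<lambda>_. 0) \<tau> \<le> (T - \<tau>) * (D * m)\<^sup>2"
    proof (rule has_integral_le)
      show "((\<lambda>t. (norm (C *v w t - 0))\<^sup>2 + (norm (0 :: real^'m))\<^sup>2 - (norm (0 + transpose B *v R.q (-1) t))\<^sup>2)
         has_integral R.V (\<lambda>_. 0) \<tau>) {\<tau>..T}"
        by (rule R.verification) auto
      show "((\<lambda>_. (D * m)\<^sup>2) has_integral (T - \<tau>) * (D * m)\<^sup>2) {\<tau>..T}"
        using has_integral_const_real[of "(D * m)\<^sup>2" \<tau> T] \<tau> by simp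
      show "(norm (C *v w t - 0))\<^sup>2 + (norm (0 :: real^'m))\<^sup>2 - (norm (0 + transpose B *v R.q (-1) t))\<^sup>2 \<le> (D * m)\<^sup>2"
        if "t \<in> {\<tau>..T}" for t
        using Cw[OF that] by (simp add: add_increasing2 diff_le_eq)
    qed
    moreover have "(T - \<tau>) * (D * m)\<^sup>2 \<le> T * (D * m)\<^sup>2"
      using \<tau> by (intro mult_right_mono) auto
    ultimately show ?thesis by (simp add: m_def power_mult_distrib mult_ac)
  qed
  then show ?thesis using D0 T_pos by (intro exI[of _ "T * D\<^sup>2"]) simp
qed

text \<open>The form is realized by concrete data. Two past indices give two atoms, which may
  coincide; one index \<open>-1\<close> gives a current value and one atom; if both are
  \<open>-1\<close>, the vectors merge into the current value \<open>x + y\<close>, since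
  \<open>-1\<close> is no place for an atom.\<close>

lemma kernel_form_bounds:
  assumes K: "\<forall>n s b x. (\<forall>k<n. s k \<in> {0..T}) \<longrightarrow> quad Q n s b \<tau> x \<le> K * (norm x + (\<Sum>k<n. norm (b k)))\<^sup>2"
    and K0: "0 \<le> K"
    and \<tau>: "0 \<le> \<tau>" "\<tau> \<le> T" and Q: "riccati \<tau> Q" and i: "i \<in> I" and j: "j \<in> I"
  shows "0 \<le> x \<bullet> (Q i i \<tau> *v x) + 2 * (x \<bullet> (Q i j \<tau> *v y)) + y \<bullet> (Q j j \<tau> *v y) \<and>
    x \<bullet> (Q i i \<tau> *v x) + 2 * (x \<bullet> (Q i j \<tau> *v y)) + y \<bullet> (Q j j \<tau> *v y) \<le> K * (norm x + norm y)\<^sup>2"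
    (is "0 \<le> ?E i j x y \<and> ?E i j x y \<le> _")
proof -
  have sym: "(Q j i \<tau> *v x) \<bullet> y = x \<bullet> (Q i j \<tau> *v y)" if "i \<in> I" "j \<in> I" for i j x y
  proof -
    have "\<tau> \<in> {0..T}" using \<tau> by simp
    then have "Q j i \<tau> = transpose (Q i j \<tau>)" using Q that unfolding riccati_def by blast
    then show ?thesis by (simp add: inner_transpose)
  qed
  have flip: "a \<bullet> c = c \<bullet> a" for a c :: "real^'d" by (rule inner_commute)
  have bounds: "0 \<le> quad Q n s b \<tau> x \<and> quad Q n s b \<tau> x \<le> K * (norm x + (\<Sum>k<n. norm (b k)))\<^sup>2"
    if "\<forall>k<n. s k \<in> {0..T}" for n s b x
    using quad_nonneg[OF Q \<tau>, of n s b x] K that by blast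
  have star: "0 \<le> ?E (-1) j x y \<and> ?E (-1) j x y \<le> K * (norm x + norm y)\<^sup>2" if j: "j \<in> I" for j x y
  proof (cases "j = -1")
    case True
    have "quad Q 0 (\<lambda>_. 0) (\<lambda>_. 0) \<tau> (x + y) = ?E (-1) j x y"
    proof -
      have "quad Q 0 (\<lambda>_. 0) (\<lambda>_. 0) \<tau> (x + y) = (Q (-1) (-1) \<tau> *v x) \<bullet> x + (Q (-1) (-1) \<tau> *v x) \<bullet> y
          + (Q (-1) (-1) \<tau> *v y) \<bullet> x + (Q (-1) (-1) \<tau> *v y) \<bullet> y"
        by (simp add: quad_def matrix_vector_right_distrib inner_add_left inner_add_right)
      moreover have "(Q (-1) (-1) \<tau> *v x) \<bullet> y = x \<bullet> (Q (-1) (-1) \<tau> *v y)"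
        by (rule sym) auto
      ultimately show ?thesis
        unfolding True using flip[of "Q (-1) (-1) \<tau> *v x" x] flip[of "Q (-1) (-1) \<tau> *v y" x]
          flip[of "Q (-1) (-1) \<tau> *v y" y] by linarith
    qed
    moreover have "(norm (x + y))\<^sup>2 \<le> (norm x + norm y)\<^sup>2"
      by (intro power_mono norm_triangle_ineq) auto
    then have "K * (norm (x + y))\<^sup>2 \<le> K * (norm x + norm y)\<^sup>2" using K0 by (rule mult_left_mono)
    ultimately show ?thesis using bounds[of 0 "\<lambda>_. 0" "\<lambda>_. 0" "x + y"] by simp
  next
    case False
    then have j': "j \<in> {0..T}" using j by simp
    have "quad Q 1 (\<lambda>_. j) (\<lambda>_. y) \<tau> x = ?E (-1) j x y"
    proof -
      have "quad Q 1 (\<lambda>_. j) (\<lambda>_. y) \<tau> x = (Q (-1) (-1) \<tau> *v x) \<bullet> x + (Q (-1) j \<tau> *v y) \<bullet> x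
          + ((Q j (-1) \<tau> *v x) \<bullet> y + (Q j j \<tau> *v y) \<bullet> y)"
        by (simp add: quad_def inner_add_left)
      moreover have "(Q j (-1) \<tau> *v x) \<bullet> y = x \<bullet> (Q (-1) j \<tau> *v y)"
        by (rule sym) (use j in auto)
      ultimately show ?thesis
        using flip[of "Q (-1) (-1) \<tau> *v x" x] flip[of "Q (-1) j \<tau> *v y" x]
          flip[of "Q j j \<tau> *v y" y] by linarith
    qed
    then show ?thesis using bounds[of 1 "\<lambda>_. j" "\<lambda>_. y" x] j' by simp
  qed
  consider "i = -1" | "j = -1" | "i \<in> {0..T}" "j \<in> {0..T}" using i j by auto
  then show ?thesis
  proof cases
    case 1
    then show ?thesis using star[OF j] by simp
  next
    case 2
    have "?E i j x y = ?E (-1) i y x"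
    proof -
      have "(Q (-1) i \<tau> *v x) \<bullet> y = x \<bullet> (Q i (-1) \<tau> *v y)"
        by (rule sym) (use i in auto)
      then show ?thesis unfolding 2 using flip[of "Q (-1) i \<tau> *v x" y] by linarith
    qed
    then show ?thesis using star[OF i, of y x] by (simp add: add.commute)
  next
    case 3
    let ?s = "\<lambda>k::nat. if k = 0 then i else j" and ?b = "\<lambda>k::nat. if k = 0 then x else y"
    have "quad Q 2 ?s ?b \<tau> 0 = ?E i j x y"
    proof -
      have "quad Q 2 ?s ?b \<tau> 0 = (Q i i \<tau> *v x) \<bullet> x + (Q i j \<tau> *v y) \<bullet> x
          + ((Q j i \<tau> *v x) \<bullet> y + (Q j j \<tau> *v y) \<bullet> y)"
        by (simp add: quad_def numeral_2_eq_2 inner_add_left)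
      then show ?thesis
        using sym[OF i j, of x y] flip[of "Q i i \<tau> *v x" x] flip[of "Q i j \<tau> *v y" x]
          flip[of "Q j j \<tau> *v y" y] by linarith
    qed
    moreover have "(\<Sum>k<2. norm (?b k)) = norm x + norm y" by (simp add: numeral_2_eq_2)
    ultimately show ?thesis using bounds[of 2 ?s ?b 0] 3 by simp
  qed
qed

lemma kernel_bounded:
  "\<exists>K\<ge>0. \<forall>\<tau> Q i j. 0 \<le> \<tau> \<longrightarrow> \<tau> \<le> T \<longrightarrow> riccati \<tau> Q \<longrightarrow> i \<in> I \<longrightarrow> j \<in> I \<longrightarrow> norm (Q i j \<tau>) \<le> K"
proof -
  obtain K where K0: "0 \<le> K" and K: "\<forall>\<tau> Q n s b x. 0 \<le> \<tau> \<longrightarrow> \<tau> \<le> T \<longrightarrow> riccati \<tau> Q \<longrightarrow> (\<forall>k<n. s k \<in> {0..T}) \<longrightarrow>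
     quad Q n s b \<tau> x \<le> K * (norm x + (\<Sum>k<n. norm (b k)))\<^sup>2"
    using quad_bounded by blast
  have "norm (Q i j \<tau>) \<le> norm ((\<chi> i j. 2 * K) :: real^'d^'d)"
    if \<tau>: "0 \<le> \<tau>" "\<tau> \<le> T" and Q: "riccati \<tau> Q" and i: "i \<in> I" and j: "j \<in> I" for \<tau> Q i j
  proof -
    have Kq: "\<forall>n s b x. (\<forall>k<n. s k \<in> {0..T}) \<longrightarrow> quad Q n s b \<tau> x \<le> K * (norm x + (\<Sum>k<n. norm (b k)))\<^sup>2"
      using K \<tau> Q by blast
    note form = kernel_form_bounds[OF Kq K0 \<tau> Q]
    \<comment> \<open>Polarization with unit vectors: the full form lies in [0, 4K] and the two
      diagonal terms in [0, K]. So twice the entry lies between -2K and 4K.\<close>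
    have entry: "\<bar>Q i j \<tau> $ a $ c\<bar> \<le> 2 * K" for a c
    proof -
      let ?x = "axis a 1 :: real^'d" and ?y = "axis c 1 :: real^'d"
      have eq: "?x \<bullet> (Q i j \<tau> *v ?y) = Q i j \<tau> $ a $ c"
        by (simp add: matrix_vector_mult_basis column_def inner_axis')
      have f1: "0 \<le> ?x \<bullet> (Q i i \<tau> *v ?x) \<and> ?x \<bullet> (Q i i \<tau> *v ?x) \<le> K"
        using form[OF i j, of ?x 0] by simp
      have f2: "0 \<le> ?y \<bullet> (Q j j \<tau> *v ?y) \<and> ?y \<bullet> (Q j j \<tau> *v ?y) \<le> K"
        using form[OF i j, of 0 ?y] by simp
      show ?thesis
        using form[OF i j, of ?x ?y] f1 f2 unfolding eq by (simp add: abs_le_iff)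
    qed
    \<comment> \<open>An entrywise bound says that truncation at \<open>2 * K\<close> does nothing,
      and the norm bound for truncated matrices applies.\<close>
    have "max (- (2 * K)) (min (2 * K) (Q i j \<tau> $ a $ c)) = Q i j \<tau> $ a $ c" for a c
      using entry[of a c] by (auto simp: max_def min_def abs_le_iff)
    then have "trunc (2 * K) (Q i j \<tau>) = Q i j \<tau>"
      by (simp add: trunc_def vec_eq_iff)
    then show ?thesis using trunc_norm[of "2 * K" "Q i j \<tau>"] K0 by simp
  qed
  then show ?thesis by (intro exI[of _ "norm ((\<chi> i j. 2 * K) :: real^'d^'d)"]) simp
qed

text \<open>The truncated equation has a global solution. As long as the truncation is inactive, the
  solution is the kernel of a value function and hence satisfies the a priori bound, which is
  smaller than the truncation level by 1; so by uniform continuity the truncation stays inactive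
  on a further time interval of fixed length.\<close>

theorem riccati_exists: "\<exists>Q. riccati 0 Q"
proof -
  obtain K where K0: "0 \<le> K" and K: "\<And>\<tau> Q i j. 0 \<le> \<tau> \<Longrightarrow> \<tau> \<le> T \<Longrightarrow> riccati \<tau> Q \<Longrightarrow> i \<in> I \<Longrightarrow> j \<in> I \<Longrightarrow> norm (Q i j \<tau>) \<le> K"
    using kernel_bounded by blast
  define R where "R = K + 1"
  have R0: "0 \<le> R" using K0 by (simp add: R_def)
  obtain Q where Qc: "continuous_on ({-1..T} \<times> {-1..T} \<times> {0..T}) (\<lambda>(i, j, t). Q i j t)"
    and Qd: "\<And>i j t. \<lbrakk>i \<in> {-1..T}; j \<in> {-1..T}; t \<in> {0..T}\<rbrakk> \<Longrightarrow>
      (Q i j has_vector_derivative - ric (trunc R) Q i j t) (at t within {0..T})"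
    and Qe: "\<And>i j. \<lbrakk>i \<in> {-1..T}; j \<in> {-1..T}\<rbrakk> \<Longrightarrow> Q i j T = 0"
    and Qs: "\<And>i j t. \<lbrakk>i \<in> {-1..T}; j \<in> {-1..T}; t \<in> {0..T}\<rbrakk> \<Longrightarrow> Q j i t = transpose (Q i j t)"
    using truncated_riccati_exists[OF trunc_norm[OF R0] trunc_lipschitz trunc_transpose trunc_cont] by blast
  have I_sub: "i \<in> {-1..T}" if "i \<in> I" for i using that T_pos by auto
  have inactive: "riccati \<sigma> Q" if \<sigma>: "0 \<le> \<sigma>" and le: "\<And>i j t. i \<in> I \<Longrightarrow> j \<in> I \<Longrightarrow> t \<in> {\<sigma>..T} \<Longrightarrow> norm (Q i j t) \<le> R" for \<sigma>
    unfolding riccati_def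
  proof (intro conjI ballI)
    fix i j t assume i: "i \<in> I" and j: "j \<in> I" and t: "t \<in> {\<sigma>..T}"
    have "ric (trunc R) Q i j t = ric (\<lambda>X. X) Q i j t"
      unfolding ric_def using le[OF i _ t, of "-1"] le[OF _ j t, of "-1"] by (simp add: trunc_id)
    moreover have "(Q i j has_vector_derivative - ric (trunc R) Q i j t) (at t within {\<sigma>..T})"
      using Qd[OF I_sub[OF i] I_sub[OF j], of t] \<sigma> t by (auto intro: has_vector_derivative_within_subset)
    ultimately show "(Q i j has_vector_derivative - ric (\<lambda>X. X) Q i j t) (at t within {\<sigma>..T})" by simp
  next
    fix i j t assume i: "i \<in> I" and j: "j \<in> I"
    show "Q i j T = 0" by (rule Qe[OF I_sub[OF i] I_sub[OF j]])
    show "Q j i t = transpose (Q i j t)" if "t \<in> {0..T}" by (rule Qs[OF I_sub[OF i] I_sub[OF j] that])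
  qed (rule Qc)
  have "uniformly_continuous_on ({-1..T} \<times> {-1..T} \<times> {0..T}) (\<lambda>(i, j, t). Q i j t)"
    by (intro compact_uniformly_continuous Qc compact_Times compact_Icc)
  then obtain \<delta> where \<delta>: "0 < \<delta>" "\<And>p p'. p \<in> {-1..T} \<times> {-1..T} \<times> {0..T} \<Longrightarrow> p' \<in> {-1..T} \<times> {-1..T} \<times> {0..T} \<Longrightarrow>
      dist p' p < \<delta> \<Longrightarrow> dist ((\<lambda>(i, j, t). Q i j t) p') ((\<lambda>(i, j, t). Q i j t) p) < 1"
    unfolding uniformly_continuous_on_def by (metis zero_less_one)
  have near: "norm (Q i j t' - Q i j t) < 1" if "i \<in> I" "j \<in> I" "t \<in> {0..T}" "t' \<in> {0..T}" "\<bar>t' - t\<bar> < \<delta>" for i j t t'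
    using \<delta>(2)[of "(i, j, t)" "(i, j, t')"] that(3-) I_sub[OF that(1)] I_sub[OF that(2)] by (simp add: dist_Pair_Pair dist_norm)
  \<comment> \<open>Each step goes back by \<open>\<delta> / 2\<close>, as uniform continuity asks
    for a distance strictly below \<delta>. The a priori bound \<open>K\<close> holds at the left
    end \<sigma> of the interval already reached, and the kernel moves by less than 1 from
    there.\<close>
  have step: "\<forall>i\<in>I. \<forall>j\<in>I. \<forall>t\<in>{max 0 (T - real n * (\<delta> / 2))..T}. norm (Q i j t) \<le> R" for n
  proof (induction n)
    case 0
    then show ?case using Qe I_sub T_pos R0 by auto
  next
    case (Suc n)
    define \<sigma> where "\<sigma> = max 0 (T - real n * (\<delta> / 2))"
    have \<sigma>: "0 \<le> \<sigma>" "\<sigma> \<le> T" using T_pos \<delta>(1) by (auto simp: \<sigma>_def)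
    have le: "norm (Q i j t) \<le> R" if "i \<in> I" "j \<in> I" "t \<in> {\<sigma>..T}" for i j t
      using Suc that unfolding \<sigma>_def by blast
    have ric: "riccati \<sigma> Q" by (rule inactive[OF \<sigma>(1) le])
    show ?case
    proof (intro ballI)
      fix i j t assume i: "i \<in> I" and j: "j \<in> I" and t: "t \<in> {max 0 (T - real (Suc n) * (\<delta> / 2))..T}"
      show "norm (Q i j t) \<le> R"
      proof (cases "\<sigma> \<le> t")
        case True
        then show ?thesis using le[OF i j, of t] t by simp
      next
        case False
        have "\<sigma> = T - real n * (\<delta> / 2)" using t False by (auto simp: \<sigma>_def max_def split: if_splits)
        moreover have "T - (real n * (\<delta> / 2) + \<delta> / 2) \<le> t" using t by (simp add: distrib_right add_divide_distrib add.commute)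
        ultimately have "\<sigma> - t \<le> \<delta> / 2" by linarith
        then have "norm (Q i j t - Q i j \<sigma>) < 1"
          using near[OF i j, of \<sigma> t] t False \<sigma> \<delta>(1) by auto
        moreover have "norm (Q i j \<sigma>) \<le> K" by (rule K[OF \<sigma> ric i j])
        ultimately show ?thesis
          using norm_triangle_ineq[of "Q i j t - Q i j \<sigma>" "Q i j \<sigma>"] by (simp add: R_def)
      qed
    qed
  qed
  obtain n where "T / (\<delta> / 2) \<le> real n" using real_arch_simple by blast
  then have "max 0 (T - real n * (\<delta> / 2)) = 0" using \<delta>(1) by (simp add: field_simps)
  then have "riccati 0 Q" using step[of n] by (intro inactive) auto
  then show ?thesis by blast
qed

section \<open>The equations for the tracking terms\<close>

lemma drhs_lipschitz:
  assumes Qc: "continuous_on ({-1..T} \<times> {-1..T} \<times> {0..T}) (\<lambda>(i, j, t). Q i j t)"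
  shows "\<exists>L\<ge>0. \<forall>d d' i t e. i \<in> {-1..T} \<longrightarrow> t \<in> {0..T} \<longrightarrow> 0 \<le> e \<longrightarrow>
      (\<forall>i\<in>{-1..T}. norm (d i t - d' i t) \<le> e) \<longrightarrow> norm (drhs Q y d i t - drhs Q y d' i t) \<le> L * e"
proof -
  obtain K where K: "0 < K" "\<And>(X :: real^'d^'d) x. norm (X *v x) \<le> K * norm X * norm x"
    by (rule matrix_vector_norm_bound[where 'n = 'd and 'm = 'd]) (rule that)
  obtain g where g: "0 \<le> g" "\<And>i t. i \<in> {-1..T} \<Longrightarrow> t \<in> {0..T} \<Longrightarrow> norm (transpose (G i t)) \<le> g"
    using G_bounded by metis
  have "compact ({-1..T} \<times> {-1..T} \<times> {0..T})" by (intro compact_Times compact_Icc)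
  from compact_imp_bounded[OF compact_continuous_image[OF Qc this]]
  obtain R where R: "0 < R" "\<And>p. p \<in> {-1..T} \<times> {-1..T} \<times> {0..T} \<Longrightarrow> norm ((\<lambda>(i, j, t). Q i j t) p) \<le> R"
    unfolding bounded_pos by blast
  have K': "norm (X *v x) \<le> K * a * c" if "norm X \<le> a" "norm x \<le> c" for X :: "real^'d^'d" and x a c
  proof -
    have a: "0 \<le> a" using that(1) norm_ge_zero order_trans by blast
    have "K * norm X * norm x \<le> K * a * c"
      using that K(1) a by (intro mult_mono) auto
    then show ?thesis using K(2)[of X x] by linarith
  qed
  define L where "L = K * g + 1 + K * R * (K * norm S)"
  show ?thesis
  proof (intro exI[of _ L] conjI allI impI)
    show "0 \<le> L" unfolding L_def using K g R by (intro add_nonneg_nonneg mult_nonneg_nonneg) auto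
    fix d d' :: "real \<Rightarrow> real \<Rightarrow> real^'d" and i t e
    assume i: "i \<in> {-1..T}" and t: "t \<in> {0..T}" and e: "0 \<le> (e::real)"
      and le': "\<forall>i\<in>{-1..T}. norm (d i t - d' i t) \<le> e"
    have m: "-1 \<in> {-1..T}" "t \<in> {-1..T}" using T_pos t by auto
    have eq: "drhs Q y d i t - drhs Q y d' i t = transpose (G i t) *v (d (-1) t - d' (-1) t)
      + chi i *\<^sub>R (d t t - d' t t) - Q i (-1) t *v (S *v (d (-1) t - d' (-1) t))"
      by (simp add: drhs_def scaleR_diff_right matrix_vector_mult_diff_distrib)
    have 1: "norm (transpose (G i t) *v (d (-1) t - d' (-1) t)) \<le> K * g * e"
      using le' m by (intro K' g(2) i t) auto
    have 2: "norm (chi i *\<^sub>R (d t t - d' t t)) \<le> 1 * e"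
      using mult_mono[of "chi i" 1 "norm (d t t - d' t t)" e] chi_range[OF i] le' m by simp
    have 3: "norm (Q i (-1) t *v (S *v (d (-1) t - d' (-1) t))) \<le> K * R * (K * norm S * e)"
      using R(2)[of "(i, -1, t)"] i t m le' by (intro K') auto
    have "norm (drhs Q y d i t - drhs Q y d' i t) \<le> K * g * e + 1 * e + K * R * (K * norm S * e)"
      unfolding eq by (intro order_trans[OF norm_triangle_ineq4] add_mono norm_triangle_le 1 2 3)
    then show "norm (drhs Q y d i t - drhs Q y d' i t) \<le> L * e" by (simp add: L_def algebra_simps)
  qed
qed

lemma drhs_cont:
  assumes Qc: "continuous_on ({-1..T} \<times> {-1..T} \<times> {0..T}) (\<lambda>(i, j, t). Q i j t)"
    and dc: "continuous_on ({-1..T} \<times> {0..T}) (\<lambda>(i, t). d i t)" and y: "continuous_on {0..T} y"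
  shows "continuous_on ({-1..T} \<times> {0..T}) (\<lambda>(i, t). drhs Q y d i t)"
  unfolding drhs_def case_prod_unfold using T_pos
  by (intro continuous_intros chi_cont G_cont continuous_on_compose_triple[OF Qc]
      continuous_on_compose_pair[OF dc] continuous_on_compose2[OF y]) auto

text \<open>The right-hand side is affine in \<open>d\<close> with coefficients bounded by
  compactness, hence globally Lipschitz. For vanishing \<open>y\<close> the zero function is a
  solution too, and uniqueness applies.\<close>

theorem tracking_exists:
  assumes Q: "riccati 0 Q" and y: "continuous_on {0..T} y"
  shows "\<exists>d. tracking 0 Q y d \<and> ((\<forall>t\<in>{0..T}. y t = 0) \<longrightarrow> (\<forall>i\<in>{-1..T}. \<forall>t\<in>{0..T}. d i t = 0))"
proof -
  have Qc: "continuous_on ({-1..T} \<times> {-1..T} \<times> {0..T}) (\<lambda>(i, j, t). Q i j t)"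
    using Q unfolding riccati_def by blast
  obtain L where L: "0 \<le> L" "\<forall>d d' i t e. i \<in> {-1..T} \<longrightarrow> t \<in> {0..T} \<longrightarrow> 0 \<le> e \<longrightarrow>
      (\<forall>i\<in>{-1..T}. norm (d i t - d' i t) \<le> e) \<longrightarrow> norm (drhs Q y d i t - drhs Q y d' i t) \<le> L * e"
    using drhs_lipschitz[OF Qc, of y] by blast
  have lip: "norm (drhs Q y d x t - drhs Q y d' x t) \<le> L * e"
    if "t \<in> {0..T}" "0 \<le> e" "\<And>x. x \<in> {-1..T} \<Longrightarrow> norm (d x t - d' x t) \<le> e" "x \<in> {-1..T}" for d d' t e x
    using L(2) that by blast
  note cont = drhs_cont[OF Qc _ y]
  have "\<exists>d. continuous_on ({-1..T} \<times> {0..T}) (\<lambda>(x, t). d x t) \<and> (\<forall>x\<in>{-1..T}. \<forall>t\<in>{0..T}. integral {t..T} (drhs Q y d x) = d x t)"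
    by (rule backward_fixpoint[OF compact_Icc L(1) cont lip])
  then obtain d where d: "continuous_on ({-1..T} \<times> {0..T}) (\<lambda>(x, t). d x t)"
    "\<And>x t. x \<in> {-1..T} \<Longrightarrow> t \<in> {0..T} \<Longrightarrow> integral {t..T} (drhs Q y d x) = d x t"
    by blast
  have I_sub: "i \<in> {-1..T}" if "i \<in> I" for i using that T_pos by auto
  have "tracking 0 Q y d"
    unfolding tracking_def
  proof (intro conjI ballI)
    fix i assume i: "i \<in> I"
    show "d i T = 0" using d(2)[OF I_sub[OF i], of T] T_pos by simp
    fix t assume t: "t \<in> {0..T}"
    show "(d i has_vector_derivative - drhs Q y d i t) (at t within {0..T})"
      by (rule backward_has_vector_derivative[OF continuous_on_section2[OF cont[OF d(1)] I_sub[OF i]] d(2)[OF I_sub[OF i]] t])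
  qed (rule d(1))
  moreover have "d i t = 0" if y0: "\<forall>t\<in>{0..T}. y t = 0" and it: "i \<in> {-1..T}" "t \<in> {0..T}" for i t
  proof (rule backward_unique[where F = "drhs Q y" and P = "{-1..T}" and T = T and L = L and Z = d and Y = "\<lambda>_ _. 0"])
    show "integral {t..T} (drhs Q y (\<lambda>_ _. 0) x) = 0" if "x \<in> {-1..T}" "t \<in> {0..T}" for x t
    proof -
      have "integral {t..T} (drhs Q y (\<lambda>_ _. 0) x) = integral {t..T} (\<lambda>_. 0)"
        using that y0 by (intro integral_cong) (auto simp: drhs_def)
      then show ?thesis by simp
    qed
    show "continuous_on ({-1..T} \<times> {0..T}) (\<lambda>(x, t). 0 :: real^'d)" by (simp add: case_prod_unfold)
  qed (assumption | rule compact_Icc L(1) cont lip d it)+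
  ultimately show ?thesis by blast
qed

end

subsection \<open>Square integrable controls\<close>

lemma L2_absolutely_integrable:
  fixes f :: "real \<Rightarrow> 'a::euclidean_space"
  assumes "f \<in> L2_on {a..b}"
  shows "f absolutely_integrable_on {a..b}" "(\<lambda>t. (norm (f t))\<^sup>2) integrable_on {a..b}"
proof -
  show sq: "(\<lambda>t. (norm (f t))\<^sup>2) integrable_on {a..b}"
    using assms by (intro integrable_on_lebesgue_on) (auto simp: L2_on_def)
  show "f absolutely_integrable_on {a..b}"
  proof (rule measurable_bounded_by_integrable_imp_absolutely_integrable)
    show "(\<lambda>t. 1 + (norm (f t))\<^sup>2) integrable_on {a..b}"
      by (intro integrable_add sq) auto
    show "norm (f x) \<le> 1 + (norm (f x))\<^sup>2" for x
    proof -
      have "2 * norm (f x) \<le> 1 + (norm (f x))\<^sup>2"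
        using zero_le_power2[of "norm (f x) - 1"] by (simp add: power2_eq_square algebra_simps)
      then show ?thesis using norm_ge_zero[of "f x"] by linarith
    qed
  qed (use assms in \<open>auto simp: L2_on_def\<close>)
qed

lemma L2_on_continuous:
  fixes f :: "real \<Rightarrow> 'a::euclidean_space"
  assumes "continuous_on {a..b} f" shows "f \<in> L2_on {a..b}"
proof -
  have "(\<lambda>t. (norm (f t))\<^sup>2) absolutely_integrable_on {a..b}"
    by (intro absolutely_integrable_continuous_real continuous_intros assms)
  then show ?thesis
    using assms unfolding L2_on_def
    by (auto intro: absolutely_integrable_imp_integrable continuous_imp_measurable_on_sets_lebesgue)
qed

text \<open>\<open>N0\<close> is the given kernel and \<open>N\<close> a continuous extension of it.
  The state equation evaluates the kernel only at differences in \<open>{0..T}\<close>, so both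
  describe the same dynamics.\<close>

locale tracking_problem = lq T A B C N
  for T :: real and A :: "real^'d^'d" and B :: "real^'m^'d" and C :: "real^'d^'p"
    and N :: "real \<Rightarrow> real^'d^'d" +
  fixes N0 :: "real \<Rightarrow> real^'d^'d" and Q :: "real \<Rightarrow> real \<Rightarrow> real \<Rightarrow> real^'d^'d"
    and y :: "real \<Rightarrow> real^'p" and d :: "real \<Rightarrow> real \<Rightarrow> real^'d"
    and \<tau> :: real and \<xi>h :: "real^'d" and \<xi>t :: "real \<Rightarrow> real^'d"
  assumes N0: "\<And>x. x \<in> {0..T} \<Longrightarrow> N0 x = N x" and y: "continuous_on {0..T} y"
    and Q: "riccati 0 Q" and d: "tracking 0 Q y d"
    and tau: "0 \<le> \<tau>" "\<tau> < T" and xi: "\<xi>t absolutely_integrable_on {0..\<tau>}"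
begin

abbreviation "m \<equiv> act (*v) 0 (\<lambda>_. 0) (\<lambda>_. 0) \<tau> \<xi>t"
abbreviation "Sol u w \<equiv> is_solution T A B N0 \<tau> \<xi>h \<xi>t u w"

lemma state0: "continuous_on {\<tau>..T} w \<Longrightarrow> state T 0 (\<lambda>_. 0) \<tau> \<xi>t w"
  using tau xi by unfold_locales auto

lemma rhs_eq:
  assumes t: "t \<in> {\<tau>..T}"
  shows "volterra_rhs A B N0 \<tau> \<xi>t u w t = m w t (\<lambda>i. G i t) + B *v u t"
proof -
  have 1: "integral {\<tau>..t} (\<lambda>s. N0 (t - s) *v w s) = integral {\<tau>..t} (\<lambda>i. G i t *v w i)"
    using t tau by (intro integral_cong) (auto simp: N0)
  have 2: "integral {0..\<tau>} (\<lambda>s. N0 (t - s) *v \<xi>t s) = integral {0..\<tau>} (\<lambda>i. G i t *v \<xi>t i)"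
    using t tau by (intro integral_cong) (auto simp: N0)
  show ?thesis by (simp add: volterra_rhs_def act_def past_def 1 2)
qed

lemma Bu_integrable:
  assumes "u \<in> L2_on {\<tau>..T}"
  shows "(\<lambda>t. B *v u t) absolutely_integrable_on {\<tau>..T}"
  by (rule absolutely_integrable_bilinear_continuous[OF bounded_bilinear_matrix_vector continuous_on_const
        L2_absolutely_integrable(1)[OF assms]])

text \<open>Splitting off the control as a continuous free term makes the Volterra theory applicable
  to square integrable controls.\<close>

lemma is_solution_iff:
  assumes u: "u \<in> L2_on {\<tau>..T}"
  shows "Sol u w \<longleftrightarrow> continuous_on {\<tau>..T} w \<and>
    (\<forall>t\<in>{\<tau>..T}. w t = \<xi>h + integral {\<tau>..t} (\<lambda>t. B *v u t) + integral {\<tau>..t} (\<lambda>r. m w r (\<lambda>i. G i r)))"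
    (is "_ \<longleftrightarrow> _ \<and> (\<forall>t\<in>_. ?E t)")
proof (cases "continuous_on {\<tau>..T} w")
  case True
  have mc: "continuous_on {\<tau>..T} (\<lambda>r. m w r (\<lambda>i. G i r))"
    by (rule act_state_continuous[OF state0[OF True] Gs_cont])
  have I: "((\<lambda>r. volterra_rhs A B N0 \<tau> \<xi>t u w r) has_integral
      integral {\<tau>..t} (\<lambda>r. m w r (\<lambda>i. G i r)) + integral {\<tau>..t} (\<lambda>t. B *v u t)) {\<tau>..t}" if t: "t \<in> {\<tau>..T}" for t
  proof -
    have "((\<lambda>r. m w r (\<lambda>i. G i r) + B *v u r) has_integral
      integral {\<tau>..t} (\<lambda>r. m w r (\<lambda>i. G i r)) + integral {\<tau>..t} (\<lambda>t. B *v u t)) {\<tau>..t}"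
    proof (intro has_integral_add integrable_integral)
      show "(\<lambda>r. m w r (\<lambda>i. G i r)) integrable_on {\<tau>..t}"
        using t by (intro integrable_continuous_real continuous_on_subset[OF mc]) auto
      show "(\<lambda>r. B *v u r) integrable_on {\<tau>..t}"
        by (rule integrable_on_subinterval[OF set_lebesgue_integral_eq_integral(1)[OF Bu_integrable[OF u]]])
          (use t in auto)
    qed
    then show ?thesis by (rule has_integral_eq[rotated]) (use t in \<open>simp add: rhs_eq\<close>)
  qed
  have eq: "?E t \<longleftrightarrow> (volterra_rhs A B N0 \<tau> \<xi>t u w has_integral (w t - \<xi>h)) {\<tau>..t}" if t: "t \<in> {\<tau>..T}" for t
  proof
    assume "?E t"
    then have "w t - \<xi>h = integral {\<tau>..t} (\<lambda>r. m w r (\<lambda>i. G i r)) + integral {\<tau>..t} (\<lambda>t. B *v u t)"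
      by (simp add: algebra_simps)
    then show "(volterra_rhs A B N0 \<tau> \<xi>t u w has_integral (w t - \<xi>h)) {\<tau>..t}" using I[OF t] by simp
  next
    assume "(volterra_rhs A B N0 \<tau> \<xi>t u w has_integral (w t - \<xi>h)) {\<tau>..t}"
    from has_integral_unique[OF this I[OF t]] show "?E t" by (simp add: algebra_simps)
  qed
  have tt: "\<tau> \<in> {\<tau>..T}" using tau by simp
  have "w \<tau> = \<xi>h" if "?E \<tau>" using that by simp
  then show ?thesis using True eq tt unfolding is_solution_def by blast
next
  case False
  then show ?thesis by (simp add: is_solution_def)
qed

lemma solution_exists_unique:
  assumes u: "u \<in> L2_on {\<tau>..T}"
  shows "\<exists>w. Sol u w \<and> (\<forall>w'. Sol u w' \<longrightarrow> (\<forall>t\<in>{\<tau>..T}. w' t = w t))"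
proof -
  have "continuous_on {\<tau>..T} (\<lambda>t. \<xi>h + integral {\<tau>..t} (\<lambda>t. B *v u t))"
    by (intro continuous_intros indefinite_integral_continuous_1
        set_lebesgue_integral_eq_integral(1)[OF Bu_integrable[OF u]])
  from state_equation_exists_unique[where b = "\<lambda>_. 0", OF state0[OF continuous_on_const] Gs_cont this]
  obtain w where w: "continuous_on {\<tau>..T} w"
    "\<forall>t\<in>{\<tau>..T}. w t = \<xi>h + integral {\<tau>..t} (\<lambda>t. B *v u t) + integral {\<tau>..t} (\<lambda>r. m w r (\<lambda>i. G i r))"
    and uniq: "\<forall>w'. continuous_on {\<tau>..T} w' \<longrightarrow>
      (\<forall>t\<in>{\<tau>..T}. w' t = \<xi>h + integral {\<tau>..t} (\<lambda>t. B *v u t) + integral {\<tau>..t} (\<lambda>r. m w' r (\<lambda>i. G i r))) \<longrightarrow>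
      (\<forall>t\<in>{\<tau>..T}. w' t = w t)"
    by (elim exE conjE)
  show ?thesis
  proof (intro exI[of _ w] conjI allI impI)
    show "Sol u w" unfolding is_solution_iff[OF u] by (intro conjI w)
    fix w' assume "Sol u w'"
    then show "\<forall>t\<in>{\<tau>..T}. w' t = w t"
      using uniq[THEN spec, of w'] unfolding is_solution_iff[OF u] by satx
  qed
qed

lemma sol_is_solution:
  assumes "u \<in> L2_on {\<tau>..T}" shows "Sol u (sol T A B N0 \<tau> \<xi>h \<xi>t u)"
proof -
  obtain w where "Sol u w" using solution_exists_unique[OF assms] by blast
  then show ?thesis unfolding sol_def by (rule someI[where P = "Sol u"])
qed

lemma solution_unique:
  assumes "u \<in> L2_on {\<tau>..T}" "Sol u w" "Sol u w'" "t \<in> {\<tau>..T}"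
  shows "w t = w' t"
proof -
  obtain w0 where w0: "\<forall>w'. Sol u w' \<longrightarrow> (\<forall>t\<in>{\<tau>..T}. w' t = w0 t)"
    using solution_exists_unique[OF assms(1)] by blast
  have "w t = w0 t" "w' t = w0 t" using w0 assms(2-) by blast+
  then show ?thesis by simp
qed

end

section \<open>Optimality of the closed loop\<close>

locale closed_loop = tracking_problem T A B C N N0 Q y d \<tau> \<xi>h \<xi>t
  for T :: real and A :: "real^'d^'d" and B :: "real^'m^'d" and C :: "real^'d^'p"
    and N N0 Q y d \<tau> \<xi>h \<xi>t +
  fixes w :: "real \<Rightarrow> real^'d" and u :: "real \<Rightarrow> real^'m"
  assumes w_init: "w \<tau> = \<xi>h"
    and traj: "riccati_trajectory T A B C N 0 (\<lambda>_. 0) (\<lambda>_. 0) \<tau> \<xi>t w u Q y d"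
    and u_eq: "\<And>t. u t = - (transpose B *v (m w t (\<lambda>j. Q (-1) j t) + d (-1) t))"
begin

sublocale R: riccati_trajectory T A B C N 0 "\<lambda>_. 0" "\<lambda>_. 0" \<tau> \<xi>t w u Q y d
  by (rule traj)

lemma u_q: "u t = - (transpose B *v R.q (-1) t)"
  by (simp add: u_eq R.q_def)

lemma u_L2: "u \<in> L2_on {\<tau>..T}"
  by (rule L2_on_continuous[OF R.u_cont])

lemma w_solution: "Sol u w"
  unfolding is_solution_def
proof (intro conjI ballI)
  fix t assume t: "t \<in> {\<tau>..T}"
  show "(volterra_rhs A B N0 \<tau> \<xi>t u w has_integral (w t - w \<tau>)) {\<tau>..t}"
  proof (rule has_integral_eq[rotated])
    show "((\<lambda>r. m w r (\<lambda>i. G i r) + B *v u r) has_integral (w t - w \<tau>)) {\<tau>..t}"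
    proof (rule fundamental_theorem_of_calculus)
      show "(w has_vector_derivative m w r (\<lambda>i. G i r) + B *v u r) (at r within {\<tau>..t})" if "r \<in> {\<tau>..t}" for r
        using has_vector_derivative_within_subset[OF R.w_deriv, of r "{\<tau>..t}"] that t by auto
    qed (use t in auto)
    show "m w r (\<lambda>i. G i r) + B *v u r = volterra_rhs A B N0 \<tau> \<xi>t u w r" if "r \<in> {\<tau>..t}" for r
      using that t by (simp add: rhs_eq)
  qed
qed (auto simp: w_init R.w_cont)

text \<open>The closed loop satisfies the first-order condition: its costate \<open>q (-1)\<close> solves the adjoint
  equation, which is tested here against the response \<open>z\<close> to a variation \<open>v\<close> of the control.\<close>

lemma first_order_condition:
  assumes v: "v \<in> L2_on {\<tau>..T}" and z: "continuous_on {\<tau>..T} z"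
    and z_eq: "\<And>t. t \<in> {\<tau>..T} \<Longrightarrow> z t = integral {\<tau>..t} (\<lambda>r. A *v z r + integral {\<tau>..r} (\<lambda>i. N (r - i) *v z i) + B *v v r)"
  shows "((\<lambda>t. (C *v w t - y t) \<bullet> (C *v z t) + u t \<bullet> v t) has_integral 0) {\<tau>..T}"
proof -
  define k where "k r = integral {\<tau>..r} (\<lambda>i. N (r - i) *v z i)" for r
  define g where "g r = A *v z r + k r + B *v v r" for r
  define p where "p = R.q (-1)"
  define p' where "p' t = - (transpose A *v p t) - R.q t t - transpose C *v (C *v w t - y t)" for t
  have u0: "u t + transpose B *v R.q (-1) t = 0" for t by (simp add: u_q)
  have p: "(p has_vector_derivative p' t) (at t within {\<tau>..T})" if "t \<in> {\<tau>..T}" for t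
    using R.q_deriv[of "-1" t] that unfolding u0 by (simp add: p_def p'_def)
  have qd: "continuous_on {\<tau>..T} (\<lambda>t. R.q t t)"
    using tau by (intro continuous_on_compose_pair[OF R.q_cont2] continuous_intros) auto
  have y': "continuous_on {\<tau>..T} y" using tau by (intro continuous_on_subset[OF y]) auto
  have p1: "continuous_on {\<tau>..T} p" unfolding p_def by (rule R.q_cont)
  have p'_cont: "continuous_on {\<tau>..T} p'"
    unfolding p'_def by (intro continuous_intros p1 qd R.w_cont y')
  have "continuous_on ({\<tau>..T} \<times> {\<tau>..T}) (\<lambda>(r, i). N (r - i) *v z i)"
    unfolding case_prod_unfold
    by (intro continuous_intros continuous_on_compose2[OF N_cont] continuous_on_compose2[OF z]) auto
  then have k: "continuous_on {\<tau>..T} k"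
    unfolding k_def by (rule continuous_on_integral_diagonal)
  have g_int: "g absolutely_integrable_on {\<tau>..T}"
    unfolding g_def
    by (intro set_integral_add(1) Bu_integrable[OF v] absolutely_integrable_continuous_real continuous_intros z k)
  have zg: "integral {\<tau>..t} g = z t" if "t \<in> {\<tau>..T}" for t
    using z_eq[OF that] by (simp add: g_def[abs_def] k_def)
  have "p T = 0" unfolding p_def by (rule R.q_end) simp
  then have "((\<lambda>t. p' t \<bullet> integral {\<tau>..t} g + p t \<bullet> g t) has_integral 0) {\<tau>..T}"
    using integration_by_parts_indefinite[OF _ p p'_cont g_int] tau by simp
  then have 1: "((\<lambda>t. p' t \<bullet> z t + p t \<bullet> g t) has_integral 0) {\<tau>..T}"
    by (rule has_integral_eq[rotated]) (simp add: zg)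
  \<comment> \<open>The identity just proved still contains \<open>R.q t t \<bullet> z t\<close> and
    the memory of \<open>z\<close> tested with \<open>p\<close>. Both are removed by the integrated
    derivative of the pairing of \<open>R.q i t\<close> with \<open>z i\<close> over the recent
    past: the moving end point yields the first, and \<open>f\<close> the second with opposite
    sign.\<close>
  define f where "f i t = - (transpose (N (t - i)) *v p t)" for i t
  have sub: "{\<tau>..T} \<times> {\<tau>..T} \<subseteq> {0..T} \<times> {\<tau>..T}" using tau by auto
  have "((\<lambda>t. integral {\<tau>..t} (\<lambda>i. R.q i t \<bullet> z i)) has_vector_derivative
      (R.q t t \<bullet> z t + integral {\<tau>..t} (\<lambda>i. f i t \<bullet> z i))) (at t within {\<tau>..T})" if t: "t \<in> {\<tau>..T}" for t
  proof (rule moving_weighted_integral_has_vector_derivative[OF bounded_bilinear_inner])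
    show "continuous_on ({\<tau>..T} \<times> {\<tau>..T}) (\<lambda>(i, t). R.q i t)"
      by (rule continuous_on_subset[OF R.q_cont2 sub])
    show "continuous_on ({\<tau>..T} \<times> {\<tau>..T}) (\<lambda>(i, t). f i t)"
      unfolding f_def case_prod_unfold
      by (intro continuous_intros continuous_on_compose2[OF N_cont] continuous_on_compose2[OF p1]) auto
    show "(R.q i has_vector_derivative f i t) (at t within {\<tau>..T})" if "i \<in> {\<tau>..T}" "t \<in> {\<tau>..T}" for i t
      using R.q_deriv[of i t] that tau unfolding u0 by (simp add: f_def p_def)
  qed (use z t in auto)
  then have "((\<lambda>t. R.q t t \<bullet> z t + integral {\<tau>..t} (\<lambda>i. f i t \<bullet> z i)) has_integral
      integral {\<tau>..T} (\<lambda>i. R.q i T \<bullet> z i) - integral {\<tau>..\<tau>} (\<lambda>i. R.q i \<tau> \<bullet> z i)) {\<tau>..T}"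
    using tau by (intro fundamental_theorem_of_calculus) auto
  moreover have "integral {\<tau>..T} (\<lambda>i. R.q i T \<bullet> z i) = integral {\<tau>..T} (\<lambda>_. 0)"
    using tau R.q_end by (intro integral_cong) auto
  ultimately have 2: "((\<lambda>t. R.q t t \<bullet> z t + integral {\<tau>..t} (\<lambda>i. f i t \<bullet> z i)) has_integral 0) {\<tau>..T}" by simp
  have f: "integral {\<tau>..t} (\<lambda>i. f i t \<bullet> z i) = - (p t \<bullet> k t)" if t: "t \<in> {\<tau>..T}" for t
  proof -
    have "continuous_on {\<tau>..t} (\<lambda>i. N (t - i) *v z i)"
      using t by (intro continuous_intros continuous_on_compose2[OF N_cont] continuous_on_subset[OF z]) auto
    then have "integral {\<tau>..t} ((\<lambda>x. - (p t \<bullet> x)) \<circ> (\<lambda>i. N (t - i) *v z i)) = - (p t \<bullet> k t)"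
      unfolding k_def by (intro integral_linear integrable_continuous_real bounded_linear_minus bounded_linear_inner_right)
    then show ?thesis by (simp add: f_def o_def inner_transpose)
  qed
  have "((\<lambda>t. - ((p' t \<bullet> z t + p t \<bullet> g t) + (R.q t t \<bullet> z t + integral {\<tau>..t} (\<lambda>i. f i t \<bullet> z i)))) has_integral - (0 + 0)) {\<tau>..T}"
    by (intro has_integral_neg has_integral_add 1 2)
  then have "((\<lambda>t. - ((p' t \<bullet> z t + p t \<bullet> g t) + (R.q t t \<bullet> z t + integral {\<tau>..t} (\<lambda>i. f i t \<bullet> z i)))) has_integral 0) {\<tau>..T}"
    by simp
  then show ?thesis
  proof (rule has_integral_eq[rotated])
    fix t assume t: "t \<in> {\<tau>..T}"
    have "u t \<bullet> v t = - (p t \<bullet> (B *v v t))" by (simp add: u_q p_def inner_transpose)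
    then show "- ((p' t \<bullet> z t + p t \<bullet> g t) + (R.q t t \<bullet> z t + integral {\<tau>..t} (\<lambda>i. f i t \<bullet> z i)))
       = (C *v w t - y t) \<bullet> (C *v z t) + u t \<bullet> v t"
      unfolding f[OF t] p'_def g_def by (simp add: inner_add_right inner_diff_left inner_transpose)
  qed
qed

text \<open>The state depends affinely on the control, so the cost is an exact second-order
  polynomial around the closed loop. The cross term vanishes by the first-order condition, and the
  excess cost is an integral of squares, which yields both minimality and uniqueness.\<close>

lemma cost_expansion:
  assumes v: "v \<in> L2_on {\<tau>..T}"
    and M: "\<And>t. t \<in> {\<tau>..T} \<Longrightarrow>
      (M has_vector_derivative (norm (transpose B *v d (-1) t))\<^sup>2 - (norm (y t))\<^sup>2) (at t within {\<tau>..T})"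
    and M_end: "M T = 0"
  defines "z \<equiv> \<lambda>t. sol T A B N0 \<tau> \<xi>h \<xi>t v t - w t"
  shows "((\<lambda>t. (norm (C *v z t))\<^sup>2 + (norm (v t - u t))\<^sup>2) has_integral (cost T A B C N0 y \<tau> \<xi>h \<xi>t v - R.V M \<tau>)) {\<tau>..T}"
    and "continuous_on {\<tau>..T} z"
proof -
  define x where "x = sol T A B N0 \<tau> \<xi>h \<xi>t v"
  have x: "continuous_on {\<tau>..T} x"
    "\<And>t. t \<in> {\<tau>..T} \<Longrightarrow> x t = \<xi>h + integral {\<tau>..t} (\<lambda>t. B *v v t) + integral {\<tau>..t} (\<lambda>r. m x r (\<lambda>i. G i r))"
    using sol_is_solution[OF v] unfolding is_solution_iff[OF v] x_def by blast+
  have w: "\<And>t. t \<in> {\<tau>..T} \<Longrightarrow> w t = \<xi>h + integral {\<tau>..t} (\<lambda>t. B *v u t) + integral {\<tau>..t} (\<lambda>r. m w r (\<lambda>i. G i r))"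
    using w_solution unfolding is_solution_iff[OF u_L2] by blast
  have z_def: "z t = x t - w t" for t by (simp add: z_def x_def)
  show zc: "continuous_on {\<tau>..T} z"
    unfolding z_def by (intro continuous_intros x R.w_cont)
  define \<delta> where "\<delta> t = v t - u t" for t
  have vi: "v absolutely_integrable_on {\<tau>..T}" and v2: "(\<lambda>t. (norm (v t))\<^sup>2) integrable_on {\<tau>..T}"
    by (rule L2_absolutely_integrable[OF v])+
  have ui: "u absolutely_integrable_on {\<tau>..T}" by (rule L2_absolutely_integrable[OF u_L2])
  have \<delta>_L2: "\<delta> \<in> L2_on {\<tau>..T}"
  proof -
    have "\<delta> absolutely_integrable_on {\<tau>..T}"
      unfolding \<delta>_def by (intro set_integral_diff(1) vi ui)
    then have meas: "\<delta> \<in> borel_measurable (lebesgue_on {\<tau>..T})"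
      by (simp add: absolutely_integrable_measurable)
    have "(\<lambda>t. (norm (\<delta> t))\<^sup>2) absolutely_integrable_on {\<tau>..T}"
    proof (rule measurable_bounded_by_integrable_imp_absolutely_integrable)
      show "(\<lambda>t. (norm (\<delta> t))\<^sup>2) \<in> borel_measurable (lebesgue_on {\<tau>..T})" using meas by measurable
      show "(\<lambda>t. 2 * (norm (v t))\<^sup>2 + 2 * (norm (u t))\<^sup>2) integrable_on {\<tau>..T}"
        by (intro integrable_add integrable_on_mult_right v2 integrable_continuous_real continuous_intros R.u_cont)
      show "norm ((norm (\<delta> t))\<^sup>2) \<le> 2 * (norm (v t))\<^sup>2 + 2 * (norm (u t))\<^sup>2" for t
      proof -
        have "0 \<le> (norm (v t + u t))\<^sup>2" by simp
        then have "(norm (\<delta> t))\<^sup>2 \<le> 2 * (norm (v t))\<^sup>2 + 2 * (norm (u t))\<^sup>2"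
          by (simp add: \<delta>_def power2_norm_eq_inner inner_add_left inner_add_right inner_diff_left inner_diff_right inner_commute)
        then show ?thesis by simp
      qed
    qed auto
    then show ?thesis using meas by (auto simp: L2_on_def intro: absolutely_integrable_imp_integrable)
  qed
  have z_eq: "z t = integral {\<tau>..t} (\<lambda>r. A *v z r + integral {\<tau>..r} (\<lambda>i. N (r - i) *v z i) + B *v \<delta> r)"
    if t: "t \<in> {\<tau>..T}" for t
  proof -
    have mi: "(\<lambda>r. m x r (\<lambda>i. G i r)) integrable_on {\<tau>..t}" if "continuous_on {\<tau>..T} x" for x
      using t by (intro integrable_continuous_real
          continuous_on_subset[OF act_state_continuous[OF state0[OF that] Gs_cont]]) auto
    have Bi: "(\<lambda>r. B *v v r) integrable_on {\<tau>..t}" if "v \<in> L2_on {\<tau>..T}" for v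
      using t by (intro integrable_on_subinterval[OF set_lebesgue_integral_eq_integral(1)[OF Bu_integrable[OF that]]]) auto
    have "((\<lambda>r. m x r (\<lambda>i. G i r) - m w r (\<lambda>i. G i r) + (B *v v r - B *v u r)) has_integral
       (integral {\<tau>..t} (\<lambda>r. m x r (\<lambda>i. G i r)) - integral {\<tau>..t} (\<lambda>r. m w r (\<lambda>i. G i r))
        + (integral {\<tau>..t} (\<lambda>r. B *v v r) - integral {\<tau>..t} (\<lambda>r. B *v u r)))) {\<tau>..t}"
      by (intro has_integral_add has_integral_diff integrable_integral mi Bi x R.w_cont v u_L2)
    moreover have "integral {\<tau>..t} (\<lambda>r. m x r (\<lambda>i. G i r)) - integral {\<tau>..t} (\<lambda>r. m w r (\<lambda>i. G i r))
        + (integral {\<tau>..t} (\<lambda>r. B *v v r) - integral {\<tau>..t} (\<lambda>r. B *v u r)) = z t"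
      unfolding z_def using x(2)[OF t] w[OF t] by (simp add: algebra_simps)
    ultimately have 1: "((\<lambda>r. m x r (\<lambda>i. G i r) - m w r (\<lambda>i. G i r) + (B *v v r - B *v u r)) has_integral z t) {\<tau>..t}"
      by simp
    have "((\<lambda>r. A *v z r + integral {\<tau>..r} (\<lambda>i. N (r - i) *v z i) + B *v \<delta> r) has_integral z t) {\<tau>..t}"
    proof (rule has_integral_eq[OF _ 1])
      fix r assume r: "r \<in> {\<tau>..t}"
      have int: "(\<lambda>i. G i r *v x i) integrable_on {\<tau>..r}" if "continuous_on {\<tau>..T} x" for x
        using r t by (intro integrable_continuous_real continuous_intros G_cont continuous_on_subset[OF that]) auto
      have "integral {\<tau>..r} (\<lambda>i. N (r - i) *v z i) = integral {\<tau>..r} (\<lambda>i. G i r *v x i - G i r *v w i)"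
        using tau by (intro integral_cong) (auto simp: z_def matrix_vector_mult_diff_distrib)
      also have "\<dots> = integral {\<tau>..r} (\<lambda>i. G i r *v x i) - integral {\<tau>..r} (\<lambda>i. G i r *v w i)"
        by (intro Henstock_Kurzweil_Integration.integral_diff int x R.w_cont)
      finally show "m x r (\<lambda>i. G i r) - m w r (\<lambda>i. G i r) + (B *v v r - B *v u r)
         = A *v z r + integral {\<tau>..r} (\<lambda>i. N (r - i) *v z i) + B *v \<delta> r"
        by (simp add: act_def z_def \<delta>_def matrix_vector_mult_diff_distrib)
    qed
    then show ?thesis by (simp add: integral_unique)
  qed
  have cross: "((\<lambda>t. (C *v w t - y t) \<bullet> (C *v z t) + u t \<bullet> \<delta> t) has_integral 0) {\<tau>..T}"
    by (rule first_order_condition[OF \<delta>_L2 zc z_eq])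
  have u0: "u t + transpose B *v R.q (-1) t = 0" for t by (simp add: u_q)
  have ver: "((\<lambda>t. (norm (C *v w t - y t))\<^sup>2 + (norm (u t))\<^sup>2) has_integral R.V M \<tau>) {\<tau>..T}"
    using R.verification[OF M M_end] unfolding u0 by simp
  have "(\<lambda>t. (norm (C *v z t))\<^sup>2 + (norm (\<delta> t))\<^sup>2) integrable_on {\<tau>..T}"
    by (intro integrable_add L2_absolutely_integrable(2)[OF \<delta>_L2] integrable_continuous_real continuous_intros zc)
  then have rest: "((\<lambda>t. (norm (C *v z t))\<^sup>2 + (norm (\<delta> t))\<^sup>2) has_integral
      integral {\<tau>..T} (\<lambda>t. (norm (C *v z t))\<^sup>2 + (norm (\<delta> t))\<^sup>2)) {\<tau>..T}"
    by (rule integrable_integral)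
  have "((\<lambda>t. ((norm (C *v w t - y t))\<^sup>2 + (norm (u t))\<^sup>2) + ((norm (C *v z t))\<^sup>2 + (norm (\<delta> t))\<^sup>2)
      + 2 * ((C *v w t - y t) \<bullet> (C *v z t) + u t \<bullet> \<delta> t)) has_integral
      R.V M \<tau> + integral {\<tau>..T} (\<lambda>t. (norm (C *v z t))\<^sup>2 + (norm (\<delta> t))\<^sup>2) + 2 * 0) {\<tau>..T}"
    by (intro has_integral_add has_integral_mult_right ver rest cross)
  moreover have "((norm (C *v w t - y t))\<^sup>2 + (norm (u t))\<^sup>2) + ((norm (C *v z t))\<^sup>2 + (norm (\<delta> t))\<^sup>2)
      + 2 * ((C *v w t - y t) \<bullet> (C *v z t) + u t \<bullet> \<delta> t) = (norm (C *v x t - y t))\<^sup>2 + (norm (v t))\<^sup>2" for t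
  proof -
    have "C *v x t - y t = (C *v w t - y t) + C *v z t" and "v t = u t + \<delta> t"
      by (simp_all add: z_def \<delta>_def matrix_vector_mult_diff_distrib)
    then show ?thesis
      by (simp only: power2_norm_eq_inner inner_add_left inner_add_right) (simp add: inner_commute)
  qed
  ultimately have "((\<lambda>t. (norm (C *v x t - y t))\<^sup>2 + (norm (v t))\<^sup>2) has_integral
      R.V M \<tau> + integral {\<tau>..T} (\<lambda>t. (norm (C *v z t))\<^sup>2 + (norm (\<delta> t))\<^sup>2) + 2 * 0) {\<tau>..T}" by simp
  then have "cost T A B C N0 y \<tau> \<xi>h \<xi>t v = R.V M \<tau> + integral {\<tau>..T} (\<lambda>t. (norm (C *v z t))\<^sup>2 + (norm (\<delta> t))\<^sup>2)"
    by (simp add: cost_def x_def integral_unique)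
  then show "((\<lambda>t. (norm (C *v z t))\<^sup>2 + (norm (v t - u t))\<^sup>2) has_integral (cost T A B C N0 y \<tau> \<xi>h \<xi>t v - R.V M \<tau>)) {\<tau>..T}"
    using rest by (simp add: \<delta>_def)
qed

context
  fixes M :: "real \<Rightarrow> real"
  assumes M: "\<And>t. t \<in> {\<tau>..T} \<Longrightarrow>
      (M has_vector_derivative (norm (transpose B *v d (-1) t))\<^sup>2 - (norm (y t))\<^sup>2) (at t within {\<tau>..T})"
    and M_end: "M T = 0"
begin

lemma cost_ge: "v \<in> L2_on {\<tau>..T} \<Longrightarrow> R.V M \<tau> \<le> cost T A B C N0 y \<tau> \<xi>h \<xi>t v"
  using has_integral_nonneg[OF cost_expansion(1)[OF _ M M_end]] by simp

lemma cost_u: "cost T A B C N0 y \<tau> \<xi>h \<xi>t u = R.V M \<tau>"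
proof -
  have "sol T A B N0 \<tau> \<xi>h \<xi>t u t = w t" if "t \<in> {\<tau>..T}" for t
    by (rule solution_unique[OF u_L2 sol_is_solution[OF u_L2] w_solution that])
  then have "((\<lambda>t. 0) has_integral (cost T A B C N0 y \<tau> \<xi>h \<xi>t u - R.V M \<tau>)) {\<tau>..T}"
    by (intro has_integral_eq[OF _ cost_expansion(1)[OF u_L2 M M_end]]) simp
  from has_integral_unique[OF this has_integral_0] show ?thesis by simp
qed

lemma u_optimal: "is_optimal_control T A B C N0 y \<tau> \<xi>h \<xi>t u"
  unfolding is_optimal_control_def using u_L2 cost_ge cost_u by simp

lemma value_fn_eq: "value_fn T A B C N0 y \<tau> \<xi>h \<xi>t = R.V M \<tau>"
  unfolding value_fn_def
proof (rule Least_equality)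
  show "R.V M \<tau> \<in> cost T A B C N0 y \<tau> \<xi>h \<xi>t ` L2_on {\<tau>..T}"
    using cost_u u_L2 by (metis image_eqI)
qed (use cost_ge in auto)

text \<open>The selected control is a continuous minimizer. Its excess cost is zero and is the
  integral of a continuous nonnegative function over a nondegenerate interval, so it agrees with the
  feedback at every point, in particular at \<tau>.\<close>

lemma opt_control_properties:
  shows opt_control_L2: "opt_control T A B C N0 y \<tau> \<xi>h \<xi>t \<in> L2_on {\<tau>..T}"
    and opt_control_eq: "t \<in> {\<tau>..T} \<Longrightarrow> opt_control T A B C N0 y \<tau> \<xi>h \<xi>t t = u t"
proof -
  define v where "v = opt_control T A B C N0 y \<tau> \<xi>h \<xi>t"
  have "is_optimal_control T A B C N0 y \<tau> \<xi>h \<xi>t v \<and> continuous_on {\<tau>..T} v"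
    unfolding v_def opt_control_def by (rule someI[of _ u]) (intro conjI u_optimal R.u_cont)
  then have v: "v \<in> L2_on {\<tau>..T}" "cost T A B C N0 y \<tau> \<xi>h \<xi>t v \<le> R.V M \<tau>" and vc: "continuous_on {\<tau>..T} v"
    using cost_u u_L2 unfolding is_optimal_control_def by auto
  show "opt_control T A B C N0 y \<tau> \<xi>h \<xi>t \<in> L2_on {\<tau>..T}" using v(1) by (simp add: v_def)
  define z where "z = (\<lambda>t. sol T A B N0 \<tau> \<xi>h \<xi>t v t - w t)"
  have zc: "continuous_on {\<tau>..T} z" unfolding z_def by (rule cost_expansion(2)[OF v(1) M M_end])
  have "cost T A B C N0 y \<tau> \<xi>h \<xi>t v - R.V M \<tau> = 0" using v(2) cost_ge[OF v(1)] by simp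
  then have "((\<lambda>t. (norm (C *v z t))\<^sup>2 + (norm (v t - u t))\<^sup>2) has_integral 0) {\<tau>..T}"
    using cost_expansion(1)[OF v(1) M M_end] by (simp add: z_def)
  moreover have "continuous_on {\<tau>..T} (\<lambda>t. (norm (C *v z t))\<^sup>2 + (norm (v t - u t))\<^sup>2)"
    by (intro continuous_intros zc vc R.u_cont)
  ultimately have "\<forall>t\<in>{\<tau>..T}. (norm (C *v z t))\<^sup>2 + (norm (v t - u t))\<^sup>2 = 0"
    using integral_eq_0_iff[of \<tau> T "\<lambda>t. (norm (C *v z t))\<^sup>2 + (norm (v t - u t))\<^sup>2"] tau(2)
    by (simp add: integral_unique)
  then show "opt_control T A B C N0 y \<tau> \<xi>h \<xi>t t = u t" if "t \<in> {\<tau>..T}" for t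
    using that by (simp add: v_def add_nonneg_eq_0_iff)
qed

lemma opt_state_eq:
  assumes t: "t \<in> {\<tau>..T}"
  shows "opt_state T A B C N0 y \<tau> \<xi>h \<xi>t t = w t"
proof -
  define v where "v = opt_control T A B C N0 y \<tau> \<xi>h \<xi>t"
  have v: "v \<in> L2_on {\<tau>..T}" "\<And>t. t \<in> {\<tau>..T} \<Longrightarrow> v t = u t"
    unfolding v_def by (rule opt_control_L2, rule opt_control_eq)
  have "integral {\<tau>..t} (\<lambda>t. B *v v t) = integral {\<tau>..t} (\<lambda>t. B *v u t)" if "t \<in> {\<tau>..T}" for t
    using that by (intro integral_cong) (simp add: v)
  then have "Sol v w"
    using w_solution unfolding is_solution_iff[OF u_L2] is_solution_iff[OF v(1)] by simp
  then show ?thesis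
    unfolding opt_state_def v_def[symmetric]
    using solution_unique[OF v(1) sol_is_solution[OF v(1)] _ t] by blast
qed

end

lemma q_init:
  "R.q i \<tau> = Q i (-1) \<tau> *v \<xi>h + integral {0..\<tau>} (\<lambda>s. Q i s \<tau> *v \<xi>t s) + d i \<tau>"
  by (simp add: R.q_def act_def past_def w_init)

text \<open>The factor 2 of the mixed term arises from two equal halves, one from
  \<open>R.q (-1) \<tau>\<close> paired with the current value and one from
  \<open>R.q s \<tau>\<close> paired with the density, which coincide by the symmetry of
  \<open>Q\<close>.\<close>

lemma V_init:
  "R.V M \<tau> = \<xi>h \<bullet> (Q (-1) (-1) \<tau> *v \<xi>h)
     + 2 * (\<xi>h \<bullet> integral {0..\<tau>} (\<lambda>s. Q (-1) s \<tau> *v \<xi>t s))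
     + integral {0..\<tau>} (\<lambda>s. integral {0..\<tau>} (\<lambda>\<nu>. \<xi>t s \<bullet> (Q s \<nu> \<tau> *v \<xi>t \<nu>)))
     + 2 * (\<xi>h \<bullet> d (-1) \<tau>)
     + 2 * integral {0..\<tau>} (\<lambda>s. \<xi>t s \<bullet> d s \<tau>) + M \<tau>"
proof -
  have t: "\<tau> \<in> {0..T}" "\<tau> \<in> {\<tau>..T}" using tau by auto
  have Qs: "continuous_on {0..\<tau>} (\<lambda>s. Q (-1) s \<tau>)"
    using tau T_pos by (intro R.Q_comp continuous_intros) auto
  have Qs': "continuous_on ({0..\<tau>} \<times> {0..\<tau>}) (\<lambda>(\<nu>, s). Q s \<nu> \<tau>)"
    unfolding case_prod_unfold using tau T_pos by (intro R.Q_comp continuous_intros) auto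
  have ds: "continuous_on {0..\<tau>} (\<lambda>s. d s \<tau>)"
    using tau T_pos by (intro continuous_on_compose_pair[OF R.d_cont] continuous_intros) auto
  define k where "k s = integral {0..\<tau>} (\<lambda>\<nu>. Q s \<nu> \<tau> *v \<xi>t \<nu>)" for s
  have Qi: "(\<lambda>\<nu>. Q s \<nu> \<tau> *v \<xi>t \<nu>) integrable_on {0..\<tau>}" if "continuous_on {0..\<tau>} (\<lambda>\<nu>. Q s \<nu> \<tau>)" for s
    by (rule set_lebesgue_integral_eq_integral(1)[OF
        absolutely_integrable_bilinear_continuous[OF bounded_bilinear_matrix_vector that xi]])
  have kc: "continuous_on {0..\<tau>} k"
    unfolding k_def by (rule weighted_integral_continuous[OF bounded_bilinear_matrix_vector compact_Icc Qs' xi])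
  have ri: "(\<lambda>s. f s \<bullet> \<xi>t s) integrable_on {0..\<tau>}" if "continuous_on {0..\<tau>} f" for f
    by (rule set_lebesgue_integral_eq_integral(1)[OF
        absolutely_integrable_bilinear_continuous[OF bounded_bilinear_inner that xi]])
  have lin: "((\<lambda>s. \<xi>h \<bullet> (Q (-1) s \<tau> *v \<xi>t s)) has_integral \<xi>h \<bullet> integral {0..\<tau>} (\<lambda>s. Q (-1) s \<tau> *v \<xi>t s)) {0..\<tau>}"
    using has_integral_linear[OF integrable_integral[OF Qi[OF Qs]] bounded_linear_inner_right[of \<xi>h]]
    by (simp add: o_def)
  have kk: "k s \<bullet> \<xi>t s = integral {0..\<tau>} (\<lambda>\<nu>. \<xi>t s \<bullet> (Q s \<nu> \<tau> *v \<xi>t \<nu>))" if "s \<in> {0..\<tau>}" for s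
  proof -
    have "integral {0..\<tau>} ((\<bullet>) (\<xi>t s) \<circ> (\<lambda>\<nu>. Q s \<nu> \<tau> *v \<xi>t \<nu>)) = \<xi>t s \<bullet> k s"
      unfolding k_def
      by (rule integral_linear[OF Qi bounded_linear_inner_right]) (use continuous_on_section1[OF Qs' that] in simp)
    then show ?thesis by (simp add: o_def inner_commute)
  qed
  have "((\<lambda>s. \<xi>h \<bullet> (Q (-1) s \<tau> *v \<xi>t s) + k s \<bullet> \<xi>t s + 2 * (d s \<tau> \<bullet> \<xi>t s)) has_integral
      \<xi>h \<bullet> integral {0..\<tau>} (\<lambda>s. Q (-1) s \<tau> *v \<xi>t s) + integral {0..\<tau>} (\<lambda>s. k s \<bullet> \<xi>t s)
      + 2 * integral {0..\<tau>} (\<lambda>s. d s \<tau> \<bullet> \<xi>t s)) {0..\<tau>}"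
    by (intro has_integral_add has_integral_mult_right lin integrable_integral ri kc ds)
  note I = this
  have pointwise: "\<xi>h \<bullet> (Q (-1) s \<tau> *v \<xi>t s) + k s \<bullet> \<xi>t s + 2 * (d s \<tau> \<bullet> \<xi>t s) = (R.q s \<tau> + d s \<tau>) \<bullet> \<xi>t s"
    if s: "s \<in> {0..\<tau>}" for s
  proof -
    have "Q s (-1) \<tau> = transpose (Q (-1) s \<tau>)" using s t tau by (intro R.Q_sym) auto
    then have "(Q s (-1) \<tau> *v \<xi>h) \<bullet> \<xi>t s = \<xi>h \<bullet> (Q (-1) s \<tau> *v \<xi>t s)" by (simp add: inner_transpose)
    then show ?thesis unfolding q_init k_def inner_add_left by simp
  qed
  have "((\<lambda>s. (R.q s \<tau> + d s \<tau>) \<bullet> \<xi>t s) has_integral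
      \<xi>h \<bullet> integral {0..\<tau>} (\<lambda>s. Q (-1) s \<tau> *v \<xi>t s) + integral {0..\<tau>} (\<lambda>s. k s \<bullet> \<xi>t s)
      + 2 * integral {0..\<tau>} (\<lambda>s. d s \<tau> \<bullet> \<xi>t s)) {0..\<tau>}"
    by (rule has_integral_eq[OF pointwise I])
  note 1 = integral_unique[OF this]
  have 2: "integral {0..\<tau>} (\<lambda>s. k s \<bullet> \<xi>t s) = integral {0..\<tau>} (\<lambda>s. integral {0..\<tau>} (\<lambda>\<nu>. \<xi>t s \<bullet> (Q s \<nu> \<tau> *v \<xi>t \<nu>)))"
    by (rule integral_cong) (rule kk)
  have 3: "integral {0..\<tau>} (\<lambda>s. d s \<tau> \<bullet> \<xi>t s) = integral {0..\<tau>} (\<lambda>s. \<xi>t s \<bullet> d s \<tau>)"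
    by (simp add: inner_commute)
  have "R.V M \<tau> = (R.q (-1) \<tau> + d (-1) \<tau>) \<bullet> \<xi>h + integral {0..\<tau>} (\<lambda>s. (R.q s \<tau> + d s \<tau>) \<bullet> \<xi>t s) + M \<tau>"
    by (simp add: R.V_def act_def past_def w_init)
  also have "\<dots> = \<xi>h \<bullet> (Q (-1) (-1) \<tau> *v \<xi>h) + \<xi>h \<bullet> integral {0..\<tau>} (\<lambda>s. Q (-1) s \<tau> *v \<xi>t s) + 2 * (\<xi>h \<bullet> d (-1) \<tau>)
      + integral {0..\<tau>} (\<lambda>s. (R.q s \<tau> + d s \<tau>) \<bullet> \<xi>t s) + M \<tau>"
    unfolding q_init inner_add_left by (simp add: inner_commute[of _ \<xi>h])
  finally show ?thesis unfolding 1 2 3 by simp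
qed

end

lemma (in tracking_problem) closed_loop_obtain: "\<exists>w. closed_loop T A B C N N0 Q y d \<tau> \<xi>h \<xi>t w
    (\<lambda>t. - (transpose B *v (m w t (\<lambda>j. Q (-1) j t) + d (-1) t)))"
proof -
  from closed_loop_exists[OF state0[OF continuous_on_const] riccati_mono[OF Q tau(1)] tracking_mono[OF d tau(1)], of \<xi>h "\<lambda>_. 0"]
  obtain w where w: "w \<tau> = \<xi>h" "riccati_trajectory T A B C N 0 (\<lambda>_. 0) (\<lambda>_. 0) \<tau> \<xi>t w
     (\<lambda>t. - (transpose B *v (m w t (\<lambda>j. Q (-1) j t) + d (-1) t))) Q y d" by blast
  have "closed_loop T A B C N N0 Q y d \<tau> \<xi>h \<xi>t w (\<lambda>t. - (transpose B *v (m w t (\<lambda>j. Q (-1) j t) + d (-1) t)))"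
    by (intro closed_loop.intro closed_loop_axioms.intro tracking_problem_axioms w refl)
  then show ?thesis by blast
qed

section \<open>Regularity of the blocks on the triangular domains\<close>

context lq
begin

lemma dom_ranges:
  "p \<in> dom2 T \<Longrightarrow> fst p \<in> {-1..T}" "p \<in> dom2 T \<Longrightarrow> snd p \<in> {0..T}"
  "r \<in> dom3 T \<Longrightarrow> fst r \<in> {-1..T}" "r \<in> dom3 T \<Longrightarrow> fst (snd r) \<in> {-1..T}" "r \<in> dom3 T \<Longrightarrow> snd (snd r) \<in> {0..T}"
  by (auto simp: dom2_def dom3_def)

lemma kernel_regularity:
  assumes Q: "riccati 0 Q"
  shows "C1_on {0..T} (Q (-1) (-1)) (\<lambda>t. - ric (\<lambda>X. X) Q (-1) (-1) t)"
    and "C1_tau2 T (Q (-1)) (\<lambda>s t. - ric (\<lambda>X. X) Q (-1) s t)"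
    and "C1_tau3 T Q (\<lambda>s \<nu> t. - ric (\<lambda>X. X) Q s \<nu> t)"
proof -
  have Qc: "continuous_on ({-1..T} \<times> {-1..T} \<times> {0..T}) (\<lambda>(i, j, t). Q i j t)"
    and Qd: "\<And>i j t. i \<in> I \<Longrightarrow> j \<in> I \<Longrightarrow> t \<in> {0..T} \<Longrightarrow> (Q i j has_vector_derivative - ric (\<lambda>X. X) Q i j t) (at t within {0..T})"
    using Q unfolding riccati_def by blast+
  have m: "-1 \<in> {-1..T}" using T_pos by simp
  note rc = ric_cont[OF Qc continuous_on_id]
  have sub: "(Q i j has_vector_derivative - ric (\<lambda>X. X) Q i j t) (at t within S)"
    if "i \<in> I" "j \<in> I" "t \<in> {0..T}" "S \<subseteq> {0..T}" for i j t S
    using has_vector_derivative_within_subset[OF Qd] that by blast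
  show "C1_on {0..T} (Q (-1) (-1)) (\<lambda>t. - ric (\<lambda>X. X) Q (-1) (-1) t)"
    unfolding C1_on_def
  proof (intro conjI ballI)
    show "continuous_on {0..T} (\<lambda>t. - ric (\<lambda>X. X) Q (-1) (-1) t)"
      by (intro continuous_on_minus rc continuous_intros m)
  qed (use Qd in auto)
  show "C1_tau2 T (Q (-1)) (\<lambda>s t. - ric (\<lambda>X. X) Q (-1) s t)"
    unfolding C1_tau2_def
  proof (intro conjI)
    show "continuous_on (dom2 T) (\<lambda>(s, \<tau>). Q (-1) s \<tau>)"
      unfolding case_prod_unfold by (intro continuous_on_compose_triple[OF Qc] continuous_intros m dom_ranges)
    show "continuous_on (dom2 T) (\<lambda>(s, \<tau>). - ric (\<lambda>X. X) Q (-1) s \<tau>)"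
      unfolding case_prod_unfold by (intro continuous_on_minus rc continuous_intros m dom_ranges)
    show "\<forall>(s, \<tau>)\<in>dom2 T. ((\<lambda>\<sigma>. Q (-1) s \<sigma>) has_vector_derivative - ric (\<lambda>X. X) Q (-1) s \<tau>) (at \<tau> within {s..T})"
    proof clarify
      fix s \<tau> assume "(s, \<tau>) \<in> dom2 T"
      then show "(Q (-1) s has_vector_derivative - ric (\<lambda>X. X) Q (-1) s \<tau>) (at \<tau> within {s..T})"
        by (intro sub) (auto simp: dom2_def)
    qed
  qed
  show "C1_tau3 T Q (\<lambda>s \<nu> t. - ric (\<lambda>X. X) Q s \<nu> t)"
    unfolding C1_tau3_def
  proof (intro conjI)
    show "continuous_on (dom3 T) (\<lambda>(s, \<nu>, \<tau>). Q s \<nu> \<tau>)"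
      unfolding case_prod_unfold by (intro continuous_on_compose_triple[OF Qc] continuous_intros dom_ranges)
    show "continuous_on (dom3 T) (\<lambda>(s, \<nu>, \<tau>). - ric (\<lambda>X. X) Q s \<nu> \<tau>)"
      unfolding case_prod_unfold by (intro continuous_on_minus rc continuous_intros dom_ranges)
    show "\<forall>(s, \<nu>, \<tau>)\<in>dom3 T. ((\<lambda>\<sigma>. Q s \<nu> \<sigma>) has_vector_derivative - ric (\<lambda>X. X) Q s \<nu> \<tau>) (at \<tau> within {max s \<nu>..T})"
    proof clarify
      fix s \<nu> \<tau> assume "(s, \<nu>, \<tau>) \<in> dom3 T"
      then show "(Q s \<nu> has_vector_derivative - ric (\<lambda>X. X) Q s \<nu> \<tau>) (at \<tau> within {max s \<nu>..T})"
        by (intro sub) (auto simp: dom3_def)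
    qed
  qed
qed

lemma tracking_regularity:
  assumes Q: "riccati 0 Q" and d: "tracking 0 Q y d" and y: "continuous_on {0..T} y"
  shows "C1_on {0..T} (d (-1)) (\<lambda>t. - drhs Q y d (-1) t)"
    and "C1_tau2 T d (\<lambda>s t. - drhs Q y d s t)"
proof -
  have Qc: "continuous_on ({-1..T} \<times> {-1..T} \<times> {0..T}) (\<lambda>(i, j, t). Q i j t)"
    using Q unfolding riccati_def by blast
  have dc: "continuous_on ({-1..T} \<times> {0..T}) (\<lambda>(i, t). d i t)"
    and dd: "\<And>i t. i \<in> I \<Longrightarrow> t \<in> {0..T} \<Longrightarrow> (d i has_vector_derivative - drhs Q y d i t) (at t within {0..T})"
    using d unfolding tracking_def by blast+
  have m: "-1 \<in> {-1..T}" using T_pos by simp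
  note rc = drhs_cont[OF Qc dc y]
  show "C1_on {0..T} (d (-1)) (\<lambda>t. - drhs Q y d (-1) t)"
    unfolding C1_on_def
  proof (intro conjI ballI)
    show "continuous_on {0..T} (\<lambda>t. - drhs Q y d (-1) t)"
      by (intro continuous_on_minus continuous_on_section2[OF rc m])
  qed (use dd in auto)
  show "C1_tau2 T d (\<lambda>s t. - drhs Q y d s t)"
    unfolding C1_tau2_def
  proof (intro conjI)
    show "continuous_on (dom2 T) (\<lambda>(s, \<tau>). d s \<tau>)"
      unfolding case_prod_unfold by (intro continuous_on_compose_pair[OF dc] continuous_intros dom_ranges)
    show "continuous_on (dom2 T) (\<lambda>(s, \<tau>). - drhs Q y d s \<tau>)"
      unfolding case_prod_unfold
      by (intro continuous_on_minus continuous_on_compose_pair[OF rc] continuous_intros dom_ranges)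
    show "\<forall>(s, \<tau>)\<in>dom2 T. ((\<lambda>\<sigma>. d s \<sigma>) has_vector_derivative - drhs Q y d s \<tau>) (at \<tau> within {s..T})"
    proof clarify
      fix s \<tau> assume st: "(s, \<tau>) \<in> dom2 T"
      show "(d s has_vector_derivative - drhs Q y d s \<tau>) (at \<tau> within {s..T})"
      proof (rule has_vector_derivative_within_subset)
        show "(d s has_vector_derivative - drhs Q y d s \<tau>) (at \<tau> within {0..T})"
          using st by (intro dd) (auto simp: dom2_def)
      qed (use st in \<open>auto simp: dom2_def\<close>)
    qed
  qed
qed

end

section \<open>Reading off the blocks and their equations from the symmetric kernel\<close>

theorem mainTheorem1:
  fixes T :: real
    and A :: "real^'d^'d" and B :: "real^'m^'d" and C :: "real^'d^'p"
    and N :: "real \<Rightarrow> real^'d^'d"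
  assumes T_pos: "0 < T"
    and N_cont: "continuous_on {0..T} N"
  shows "\<exists>(P0 :: real \<Rightarrow> real^'d^'d) P0'
          (P1 :: real \<Rightarrow> real \<Rightarrow> real^'d^'d) P1'
          (P2 :: real \<Rightarrow> real \<Rightarrow> real \<Rightarrow> real^'d^'d) P2'.
    C1_on {0..T} P0 P0' \<and> C1_tau2 T P1 P1' \<and> C1_tau3 T P2 P2' \<and>
    (\<forall>\<tau>\<in>{0..T}. P0 \<tau> = transpose (P0 \<tau>)) \<and>
    (\<forall>(s, \<nu>, \<tau>)\<in>dom3 T. P2 s \<nu> \<tau> = transpose (P2 \<nu> s \<tau>)) \<and>
    (\<forall>\<tau>\<in>{0..T}.
       P0' \<tau> + transpose A ** P0 \<tau> + P0 \<tau> ** A + P1 \<tau> \<tau> + transpose (P1 \<tau> \<tau>)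
       - P0 \<tau> ** B ** transpose B ** P0 \<tau> + transpose C ** C = 0) \<and>
    (\<forall>(s, \<tau>)\<in>dom2 T.
       P1' s \<tau> + transpose A ** P1 s \<tau> + P0 \<tau> ** N (\<tau> - s) + P2 \<tau> s \<tau>
       - P0 \<tau> ** B ** transpose B ** P1 s \<tau> = 0) \<and>
    (\<forall>(s, \<nu>, \<tau>)\<in>dom3 T.
       P2' s \<nu> \<tau> + transpose (N (\<tau> - s)) ** P1 \<nu> \<tau> + transpose (P1 s \<tau>) ** N (\<tau> - \<nu>)
       - transpose (P1 s \<tau>) ** B ** transpose B ** P1 \<nu> \<tau> = 0) \<and>
    P0 T = 0 \<and> (\<forall>s\<in>{0..T}. P1 s T = 0) \<and> (\<forall>s\<in>{0..T}. \<forall>\<nu>\<in>{0..T}. P2 s \<nu> T = 0) \<and>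
    (\<forall>y :: real \<Rightarrow> real^'p. continuous_on {0..T} y \<longrightarrow>
      (\<exists>(d1 :: real \<Rightarrow> real^'d) d1' (d2 :: real \<Rightarrow> real \<Rightarrow> real^'d) d2' (M :: real \<Rightarrow> real) M'.
        C1_on {0..T} d1 d1' \<and> C1_tau2 T d2 d2' \<and> C1_on {0..T} M M' \<and>
        ((\<forall>t\<in>{0..T}. y t = 0) \<longrightarrow>
           (\<forall>\<tau>\<in>{0..T}. d1 \<tau> = 0) \<and> (\<forall>(s, \<tau>)\<in>dom2 T. d2 s \<tau> = 0) \<and> (\<forall>\<tau>\<in>{0..T}. M \<tau> = 0)) \<and>
        (\<forall>\<tau>\<in>{0..<T}. \<forall>\<xi>h. \<forall>\<xi>t\<in>L2_on {0..\<tau>}.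
           value_fn T A B C N y \<tau> \<xi>h \<xi>t =
             \<xi>h \<bullet> (P0 \<tau> *v \<xi>h)
             + 2 * (\<xi>h \<bullet> integral {0..\<tau>} (\<lambda>s. P1 s \<tau> *v \<xi>t s))
             + integral {0..\<tau>} (\<lambda>s. integral {0..\<tau>} (\<lambda>\<nu>. \<xi>t s \<bullet> (P2 s \<nu> \<tau> *v \<xi>t \<nu>)))
             + 2 * (\<xi>h \<bullet> d1 \<tau>)
             + 2 * integral {0..\<tau>} (\<lambda>s. \<xi>t s \<bullet> d2 s \<tau>)
             + M \<tau>) \<and>
        (\<forall>\<tau>\<in>{0..<T}. \<forall>\<xi>h. \<forall>\<xi>t\<in>L2_on {0..\<tau>}.
           opt_control T A B C N y \<tau> \<xi>h \<xi>t \<tau> =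
             - (transpose B *v
                (P0 \<tau> *v \<xi>h + integral {0..\<tau>} (\<lambda>s. P1 s \<tau> *v \<xi>t s) + d1 \<tau>))) \<and>
        (\<forall>\<xi>h. \<forall>\<tau>\<in>{0..<T}.
           opt_control T A B C N y 0 \<xi>h (\<lambda>_. 0) \<tau> =
             - (transpose B *v
                (P0 \<tau> *v opt_state T A B C N y 0 \<xi>h (\<lambda>_. 0) \<tau>
                 + integral {0..\<tau>} (\<lambda>s. P1 s \<tau> *v opt_state T A B C N y 0 \<xi>h (\<lambda>_. 0) s)
                 + d1 \<tau>))) \<and>
        (\<forall>\<tau>\<in>{0..T}.
           d1' \<tau> + (transpose A - P0 \<tau> ** B ** transpose B) *v d1 \<tau> + d2 \<tau> \<tau>
           - transpose C *v y \<tau> = 0) \<and>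
        d1 T = 0 \<and>
        (\<forall>(s, \<tau>)\<in>dom2 T.
           d2' s \<tau> + transpose (N (\<tau> - s)) *v d1 \<tau>
           - (transpose (P1 s \<tau>) ** B ** transpose B) *v d1 \<tau> = 0) \<and>
        (\<forall>s\<in>{0..T}. d2 s T = 0) \<and>
        (\<forall>\<tau>\<in>{0..T}. M' \<tau> = (norm (transpose B *v d1 \<tau>))\<^sup>2 - (norm (y \<tau>))\<^sup>2) \<and>
        M T = 0))"
proof -
  \<comment> \<open>Extension by the end values, which is continuous on the whole line.\<close>
  define N' where "N' t = N (max 0 (min T t))" for t
  have N'_cont: "continuous_on UNIV N'"
    unfolding N'_def using T_pos by (intro continuous_on_compose2[OF N_cont] continuous_intros) auto
  have N': "N t = N' t" if "t \<in> {0..T}" for t using that by (simp add: N'_def)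
  interpret L: lq T A B C N' by unfold_locales (rule T_pos, rule N'_cont)
  obtain Q where Q: "L.riccati 0 Q" using L.riccati_exists by blast
  have Q_sym: "\<And>i j t. i \<in> L.I \<Longrightarrow> j \<in> L.I \<Longrightarrow> t \<in> {0..T} \<Longrightarrow> Q j i t = transpose (Q i j t)"
    and Q_end: "\<And>i j. i \<in> L.I \<Longrightarrow> j \<in> L.I \<Longrightarrow> Q i j T = 0"
    using Q unfolding L.riccati_def by blast+
  have star: "-1 \<in> L.I" by simp
  have S: "X ** (L.S ** Y) = X ** B ** transpose B ** Y" for X Y :: "real^'d^'d"
    by (simp add: L.S_def matrix_mul_assoc)
  have Sv: "X *v (L.S *v x) = (X ** B ** transpose B) *v x" for X :: "real^'d^'d" and x
    by (simp add: L.S_def matrix_vector_mul_assoc matrix_mul_assoc)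
  have part_y: "\<exists>(d1 :: real \<Rightarrow> real^'d) d1' (d2 :: real \<Rightarrow> real \<Rightarrow> real^'d) d2' (M :: real \<Rightarrow> real) M'.
        C1_on {0..T} d1 d1' \<and> C1_tau2 T d2 d2' \<and> C1_on {0..T} M M' \<and>
        ((\<forall>t\<in>{0..T}. y t = 0) \<longrightarrow>
           (\<forall>\<tau>\<in>{0..T}. d1 \<tau> = 0) \<and> (\<forall>(s, \<tau>)\<in>dom2 T. d2 s \<tau> = 0) \<and> (\<forall>\<tau>\<in>{0..T}. M \<tau> = 0)) \<and>
        (\<forall>\<tau>\<in>{0..<T}. \<forall>\<xi>h. \<forall>\<xi>t\<in>L2_on {0..\<tau>}.
           value_fn T A B C N y \<tau> \<xi>h \<xi>t =
             \<xi>h \<bullet> (Q (-1) (-1) \<tau> *v \<xi>h)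
             + 2 * (\<xi>h \<bullet> integral {0..\<tau>} (\<lambda>s. Q (-1) s \<tau> *v \<xi>t s))
             + integral {0..\<tau>} (\<lambda>s. integral {0..\<tau>} (\<lambda>\<nu>. \<xi>t s \<bullet> (Q s \<nu> \<tau> *v \<xi>t \<nu>)))
             + 2 * (\<xi>h \<bullet> d1 \<tau>)
             + 2 * integral {0..\<tau>} (\<lambda>s. \<xi>t s \<bullet> d2 s \<tau>)
             + M \<tau>) \<and>
        (\<forall>\<tau>\<in>{0..<T}. \<forall>\<xi>h. \<forall>\<xi>t\<in>L2_on {0..\<tau>}.
           opt_control T A B C N y \<tau> \<xi>h \<xi>t \<tau> =
             - (transpose B *v
                (Q (-1) (-1) \<tau> *v \<xi>h + integral {0..\<tau>} (\<lambda>s. Q (-1) s \<tau> *v \<xi>t s) + d1 \<tau>))) \<and>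
        (\<forall>\<xi>h. \<forall>\<tau>\<in>{0..<T}.
           opt_control T A B C N y 0 \<xi>h (\<lambda>_. 0) \<tau> =
             - (transpose B *v
                (Q (-1) (-1) \<tau> *v opt_state T A B C N y 0 \<xi>h (\<lambda>_. 0) \<tau>
                 + integral {0..\<tau>} (\<lambda>s. Q (-1) s \<tau> *v opt_state T A B C N y 0 \<xi>h (\<lambda>_. 0) s)
                 + d1 \<tau>))) \<and>
        (\<forall>\<tau>\<in>{0..T}.
           d1' \<tau> + (transpose A - Q (-1) (-1) \<tau> ** B ** transpose B) *v d1 \<tau> + d2 \<tau> \<tau>
           - transpose C *v y \<tau> = 0) \<and>
        d1 T = 0 \<and>
        (\<forall>(s, \<tau>)\<in>dom2 T.
           d2' s \<tau> + transpose (N (\<tau> - s)) *v d1 \<tau>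
           - (transpose (Q (-1) s \<tau>) ** B ** transpose B) *v d1 \<tau> = 0) \<and>
        (\<forall>s\<in>{0..T}. d2 s T = 0) \<and>
        (\<forall>\<tau>\<in>{0..T}. M' \<tau> = (norm (transpose B *v d1 \<tau>))\<^sup>2 - (norm (y \<tau>))\<^sup>2) \<and>
        M T = 0" (is "?Y y")
    if y: "continuous_on {0..T} y" for y :: "real \<Rightarrow> real^'p"
  proof -
    obtain d where d: "L.tracking 0 Q y d"
      and d0: "(\<forall>t\<in>{0..T}. y t = 0) \<longrightarrow> (\<forall>i\<in>{-1..T}. \<forall>t\<in>{0..T}. d i t = 0)"
      using L.tracking_exists[OF Q y] by blast
    have d_end: "\<And>i. i \<in> L.I \<Longrightarrow> d i T = 0"
      and dc: "continuous_on ({-1..T} \<times> {0..T}) (\<lambda>(i, t). d i t)"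
      using d unfolding L.tracking_def by blast+
    have d1: "continuous_on {0..T} (d (-1))"
      using T_pos by (intro continuous_on_section2[OF dc]) auto
    define f where "f t = (norm (y t))\<^sup>2 - (norm (transpose B *v d (-1) t))\<^sup>2" for t
    \<comment> \<open>The equation for \<open>M\<close> contains no \<open>M\<close> on the right,
      so it is solved by a single integration from \<open>T\<close>.\<close>
    define M where "M t = integral {t..T} f" for t
    have fc: "continuous_on {0..T} f" unfolding f_def by (intro continuous_intros y d1)
    have M_deriv: "(M has_vector_derivative (norm (transpose B *v d (-1) t))\<^sup>2 - (norm (y t))\<^sup>2) (at t within {0..T})"
      if "t \<in> {0..T}" for t
      using backward_has_vector_derivative[OF fc _ that, of M] by (simp add: M_def f_def)
    have M_end: "M T = 0" by (simp add: M_def)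
    have M_deriv': "(M has_vector_derivative (norm (transpose B *v d (-1) t))\<^sup>2 - (norm (y t))\<^sup>2) (at t within {\<tau>..T})"
      if "0 \<le> \<tau>" "t \<in> {\<tau>..T}" for t \<tau>
      using has_vector_derivative_within_subset[OF M_deriv, of t "{\<tau>..T}"] that by auto
    have M_C1: "C1_on {0..T} M (\<lambda>t. (norm (transpose B *v d (-1) t))\<^sup>2 - (norm (y t))\<^sup>2)"
      unfolding C1_on_def by (intro conjI ballI M_deriv continuous_intros y d1)
    have problem: "tracking_problem T A B C N' N Q y d \<tau> \<xi>t" if "\<tau> \<in> {0..<T}" "\<xi>t \<in> L2_on {0..\<tau>}" for \<tau> \<xi>t
      using that L2_absolutely_integrable(1)[OF that(2)] N' y Q d by unfold_locales auto
    have cost_min: "value_fn T A B C N y \<tau> \<xi>h \<xi>t =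
             \<xi>h \<bullet> (Q (-1) (-1) \<tau> *v \<xi>h)
             + 2 * (\<xi>h \<bullet> integral {0..\<tau>} (\<lambda>s. Q (-1) s \<tau> *v \<xi>t s))
             + integral {0..\<tau>} (\<lambda>s. integral {0..\<tau>} (\<lambda>\<nu>. \<xi>t s \<bullet> (Q s \<nu> \<tau> *v \<xi>t \<nu>)))
             + 2 * (\<xi>h \<bullet> d (-1) \<tau>)
             + 2 * integral {0..\<tau>} (\<lambda>s. \<xi>t s \<bullet> d s \<tau>)
             + M \<tau>" (is "?V \<tau> \<xi>h \<xi>t")
      and control: "opt_control T A B C N y \<tau> \<xi>h \<xi>t \<tau> = - (transpose B *v
                (Q (-1) (-1) \<tau> *v \<xi>h + integral {0..\<tau>} (\<lambda>s. Q (-1) s \<tau> *v \<xi>t s) + d (-1) \<tau>))" (is "?U \<tau> \<xi>h \<xi>t")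
      if \<tau>: "\<tau> \<in> {0..<T}" and \<xi>t: "\<xi>t \<in> L2_on {0..\<tau>}" for \<tau> \<xi>h \<xi>t
    proof -
      interpret tracking_problem T A B C N' N Q y d \<tau> \<xi>h \<xi>t by (rule problem[OF \<tau> \<xi>t])
      obtain w where w: "closed_loop T A B C N' N Q y d \<tau> \<xi>h \<xi>t w
        (\<lambda>t. - (transpose B *v (m w t (\<lambda>j. Q (-1) j t) + d (-1) t)))"
        using closed_loop_obtain by blast
      interpret closed_loop T A B C N' N Q y d \<tau> \<xi>h \<xi>t w
        "\<lambda>t. - (transpose B *v (m w t (\<lambda>j. Q (-1) j t) + d (-1) t))" by (rule w)
      have M1: "\<And>t. t \<in> {\<tau>..T} \<Longrightarrow> (M has_vector_derivative (norm (transpose B *v d (-1) t))\<^sup>2 - (norm (y t))\<^sup>2) (at t within {\<tau>..T})"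
        using M_deriv' \<tau> by simp
      show "?V \<tau> \<xi>h \<xi>t" using value_fn_eq[OF M1 M_end] V_init[of M] by (rule trans)
      have "opt_control T A B C N y \<tau> \<xi>h \<xi>t \<tau> = - (transpose B *v (m w \<tau> (\<lambda>j. Q (-1) j \<tau>) + d (-1) \<tau>))"
        using \<tau> by (intro opt_control_eq[OF M1 M_end]) auto
      then show "?U \<tau> \<xi>h \<xi>t" using q_init[of "-1"] by (simp add: R.q_def)
    qed
    have control0: "opt_control T A B C N y 0 \<xi>h (\<lambda>_. 0) \<tau> =
             - (transpose B *v
                (Q (-1) (-1) \<tau> *v opt_state T A B C N y 0 \<xi>h (\<lambda>_. 0) \<tau>
                 + integral {0..\<tau>} (\<lambda>s. Q (-1) s \<tau> *v opt_state T A B C N y 0 \<xi>h (\<lambda>_. 0) s)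
                 + d (-1) \<tau>))" if \<tau>: "\<tau> \<in> {0..<T}" for \<xi>h \<tau>
    proof -
      have z: "0 \<in> {0..<T}" "(\<lambda>_. 0 :: real^'d) \<in> L2_on {0..0}"
        by (simp add: T_pos) (rule L2_on_continuous[OF continuous_on_const])
      interpret tracking_problem T A B C N' N Q y d 0 \<xi>h "\<lambda>_. 0" by (rule problem[OF z])
      obtain w where w: "closed_loop T A B C N' N Q y d 0 \<xi>h (\<lambda>_. 0) w
        (\<lambda>t. - (transpose B *v (m w t (\<lambda>j. Q (-1) j t) + d (-1) t)))"
        using closed_loop_obtain by blast
      interpret closed_loop T A B C N' N Q y d 0 \<xi>h "\<lambda>_. 0" w
        "\<lambda>t. - (transpose B *v (m w t (\<lambda>j. Q (-1) j t) + d (-1) t))" by (rule w)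
      have os: "opt_state T A B C N y 0 \<xi>h (\<lambda>_. 0) t = w t" if "t \<in> {0..T}" for t
        by (rule opt_state_eq[OF M_deriv M_end that])
      have "integral {0..\<tau>} (\<lambda>s. Q (-1) s \<tau> *v opt_state T A B C N y 0 \<xi>h (\<lambda>_. 0) s)
          = integral {0..\<tau>} (\<lambda>s. Q (-1) s \<tau> *v w s)"
        using \<tau> by (intro integral_cong) (simp add: os)
      \<comment> \<open>For initial time 0 the history up to \<tau> is the trajectory itself, so the
        moving integral in \<open>act\<close> becomes the \<open>P1\<close> term, and the feedback
        can be read off at every \<tau> from one closed loop.\<close>
      moreover have "opt_control T A B C N y 0 \<xi>h (\<lambda>_. 0) \<tau> = - (transpose B *v (m w \<tau> (\<lambda>j. Q (-1) j \<tau>) + d (-1) \<tau>))"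
        using \<tau> by (intro opt_control_eq[OF M_deriv M_end]) auto
      ultimately show ?thesis using \<tau> os[of \<tau>] by (simp add: act_def past_def)
    qed
    show ?thesis
    proof (rule exI[of _ "d (-1)"], rule exI[of _ "\<lambda>t. - L.drhs Q y d (-1) t"], rule exI[of _ d],
        rule exI[of _ "\<lambda>s t. - L.drhs Q y d s t"], rule exI[of _ M],
        rule exI[of _ "\<lambda>t. (norm (transpose B *v d (-1) t))\<^sup>2 - (norm (y t))\<^sup>2"], intro conjI)
      show "(\<forall>t\<in>{0..T}. y t = 0) \<longrightarrow>
           (\<forall>\<tau>\<in>{0..T}. d (-1) \<tau> = 0) \<and> (\<forall>(s, \<tau>)\<in>dom2 T. d s \<tau> = 0) \<and> (\<forall>\<tau>\<in>{0..T}. M \<tau> = 0)"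
      proof
        assume y0: "\<forall>t\<in>{0..T}. y t = 0"
        then have dz: "\<forall>i\<in>{-1..T}. \<forall>t\<in>{0..T}. d i t = 0" using d0 by blast
        have "M \<tau> = 0" if "\<tau> \<in> {0..T}" for \<tau>
        proof -
          have "M \<tau> = integral {\<tau>..T} (\<lambda>_. 0)"
            unfolding M_def using that y0 dz T_pos by (intro integral_cong) (auto simp: f_def)
          then show ?thesis by simp
        qed
        then show "(\<forall>\<tau>\<in>{0..T}. d (-1) \<tau> = 0) \<and> (\<forall>(s, \<tau>)\<in>dom2 T. d s \<tau> = 0) \<and> (\<forall>\<tau>\<in>{0..T}. M \<tau> = 0)"
          using dz T_pos by (auto simp: dom2_def)
      qed
      show "\<forall>\<tau>\<in>{0..T}. - L.drhs Q y d (-1) \<tau> + (transpose A - Q (-1) (-1) \<tau> ** B ** transpose B) *v d (-1) \<tau> + d \<tau> \<tau>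
           - transpose C *v y \<tau> = 0"
        by (simp add: L.drhs_def Sv matrix_vector_mult_diff_rdistrib)
      show "\<forall>(s, \<tau>)\<in>dom2 T. - L.drhs Q y d s \<tau> + transpose (N (\<tau> - s)) *v d (-1) \<tau>
           - (transpose (Q (-1) s \<tau>) ** B ** transpose B) *v d (-1) \<tau> = 0"
      proof clarify
        fix s \<tau> assume "(s, \<tau>) \<in> dom2 T"
        then have st: "0 \<le> s" "s \<in> L.I" "\<tau> \<in> {0..T}" "\<tau> - s \<in> {0..T}" by (auto simp: dom2_def)
        show "- L.drhs Q y d s \<tau> + transpose (N (\<tau> - s)) *v d (-1) \<tau>
           - (transpose (Q (-1) s \<tau>) ** B ** transpose B) *v d (-1) \<tau> = 0"
          using st Q_sym[OF star st(2,3)] by (simp add: L.drhs_def Sv N')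
      qed
    qed (use L.tracking_regularity[OF Q d y] M_C1 M_end d_end cost_min control control0 in \<open>simp_all\<close>)
  qed
  \<comment> \<open>The index \<open>-1\<close> in both slots, in the first slot only, and in
    neither slot gives \<open>P0\<close>, \<open>P1\<close> and \<open>P2\<close>.\<close>
  show ?thesis
  proof (rule exI[of _ "Q (-1) (-1)"], rule exI[of _ "\<lambda>t. - L.ric (\<lambda>X. X) Q (-1) (-1) t"],
      rule exI[of _ "Q (-1)"], rule exI[of _ "\<lambda>s t. - L.ric (\<lambda>X. X) Q (-1) s t"],
      rule exI[of _ Q], rule exI[of _ "\<lambda>s \<nu> t. - L.ric (\<lambda>X. X) Q s \<nu> t"], intro conjI)
    show "\<forall>\<tau>\<in>{0..T}. Q (-1) (-1) \<tau> = transpose (Q (-1) (-1) \<tau>)"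
      using Q_sym[OF star star] by blast
    show "\<forall>(s, \<nu>, \<tau>)\<in>dom3 T. Q s \<nu> \<tau> = transpose (Q \<nu> s \<tau>)"
    proof clarify
      fix s \<nu> \<tau> assume "(s, \<nu>, \<tau>) \<in> dom3 T"
      then show "Q s \<nu> \<tau> = transpose (Q \<nu> s \<tau>)" by (intro Q_sym) (auto simp: dom3_def)
    qed
    show "\<forall>\<tau>\<in>{0..T}. - L.ric (\<lambda>X. X) Q (-1) (-1) \<tau> + transpose A ** Q (-1) (-1) \<tau> + Q (-1) (-1) \<tau> ** A
       + Q (-1) \<tau> \<tau> + transpose (Q (-1) \<tau> \<tau>)
       - Q (-1) (-1) \<tau> ** B ** transpose B ** Q (-1) (-1) \<tau> + transpose C ** C = 0"
    proof
      fix \<tau> assume \<tau>: "\<tau> \<in> {0..T}"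
      then have "Q \<tau> (-1) \<tau> = transpose (Q (-1) \<tau> \<tau>)" by (intro Q_sym) auto
      then show "- L.ric (\<lambda>X. X) Q (-1) (-1) \<tau> + transpose A ** Q (-1) (-1) \<tau> + Q (-1) (-1) \<tau> ** A
       + Q (-1) \<tau> \<tau> + transpose (Q (-1) \<tau> \<tau>)
       - Q (-1) (-1) \<tau> ** B ** transpose B ** Q (-1) (-1) \<tau> + transpose C ** C = 0"
        by (simp add: L.ric_def S)
    qed
    show "\<forall>(s, \<tau>)\<in>dom2 T. - L.ric (\<lambda>X. X) Q (-1) s \<tau> + transpose A ** Q (-1) s \<tau>
       + Q (-1) (-1) \<tau> ** N (\<tau> - s) + Q \<tau> s \<tau> - Q (-1) (-1) \<tau> ** B ** transpose B ** Q (-1) s \<tau> = 0"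
    proof clarify
      fix s \<tau> assume "(s, \<tau>) \<in> dom2 T"
      then have "0 \<le> s" "\<tau> - s \<in> {0..T}" by (auto simp: dom2_def)
      then show "- L.ric (\<lambda>X. X) Q (-1) s \<tau> + transpose A ** Q (-1) s \<tau>
       + Q (-1) (-1) \<tau> ** N (\<tau> - s) + Q \<tau> s \<tau> - Q (-1) (-1) \<tau> ** B ** transpose B ** Q (-1) s \<tau> = 0"
        by (simp add: L.ric_def S N')
    qed
    show "\<forall>(s, \<nu>, \<tau>)\<in>dom3 T. - L.ric (\<lambda>X. X) Q s \<nu> \<tau> + transpose (N (\<tau> - s)) ** Q (-1) \<nu> \<tau>
       + transpose (Q (-1) s \<tau>) ** N (\<tau> - \<nu>)
       - transpose (Q (-1) s \<tau>) ** B ** transpose B ** Q (-1) \<nu> \<tau> = 0"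
    proof clarify
      fix s \<nu> \<tau> assume "(s, \<nu>, \<tau>) \<in> dom3 T"
      then have h: "0 \<le> s" "0 \<le> \<nu>" "\<tau> - s \<in> {0..T}" "\<tau> - \<nu> \<in> {0..T}" "s \<in> L.I" "\<tau> \<in> {0..T}"
        by (auto simp: dom3_def)
      show "- L.ric (\<lambda>X. X) Q s \<nu> \<tau> + transpose (N (\<tau> - s)) ** Q (-1) \<nu> \<tau>
       + transpose (Q (-1) s \<tau>) ** N (\<tau> - \<nu>)
       - transpose (Q (-1) s \<tau>) ** B ** transpose B ** Q (-1) \<nu> \<tau> = 0"
        using h(1,2) Q_sym[OF star h(5,6)] by (simp add: L.ric_def S N'[OF h(3)] N'[OF h(4)])
    qed
    show "\<forall>y :: real \<Rightarrow> real^'p. continuous_on {0..T} y \<longrightarrow> ?Y y" by (blast intro: part_y)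
  qed (use L.kernel_regularity[OF Q] Q_end in simp_all)
qed

end
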